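(* Let $\alpha\in(0,2)$ and let $(Z_{it})_{i,t\in\mathbb{N}}$ be iid real random variables and $(a_n)$ a sequence of positive numbers with $$\lim_{n\to\infty} nP(|Z_{11}|>a_n x)=x^{-\alpha}\quad\text{for each }x>0 .$$ Let $p=p_n$ be a sequence of positive integers with $p_n\to\infty$ as $n\to\infty$, and let $X=(Z_{it})_{1\le i\le p,\,1\le t\le n}$. Suppose that either (i) $p_n=n^\kappa l(n)$ for some $\kappa\in[0,\infty)$, where $l$ is a slowly varying function which converges to infinity if $\kappa=0$ and is bounded away from zero if $\kappa=1$; or (ii) $p_n\sim C\exp(cn^\kappa)$ as $n\to\infty$ for some $\kappa,c,C>0$. Let $\lambda_1,\dots,\lambda_p\ge0$ be the eigenvalues of $XX^{\mathsf T}$. Then, as $n\to\infty$, the point process $$N_n=\sum_{i=1}^p\epsilon_{a_{np}^{-2}\lambda_i}$$ converges in distribution to a Poisson point process with intensity measure $\hat\nu$ given by $\hat\nu((x,\infty])=x^{-\alpha/2}$, $x>0$.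
   Context: $\epsilon_x$ denotes the Dirac measure at $x$. $a_{np}$ is the term of the sequence $(a_m)$ with index $m=np_n$. A function $l$ with positive values is slowly varying if $\lim_{t\to\infty}l(tx)/l(t)=1$ for each $x>0$. Point processes are considered on $(0,\infty]$: only points that are positive are counted, and the relatively compact sets are those bounded away from $0$ (contained in some $[c,\infty]$, $c>0$). Convergence in distribution of point processes $N_n\to N$ means weak convergence with respect to the vague topology, i.e. $N_n(f)\to N(f)$ in distribution for every nonnegative continuous $f$ on $(0,\infty]$ with compact support, where $N(f)=\int f\,dN$. *)

theory Defs
  imports
    "HOL-Probability.Probability"
    "HOL-Library.Landau_Symbols"
    "Jordan_Normal_Form.Char_Poly"
begin

text \<open>
  The eigenvalues of \<open>A\<close>, listed with algebraic multiplicity. For a real symmetric \<open>n \<times> n\<close> matrix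
  the characteristic polynomial splits over the reals, so this multiset has exactly \<open>n\<close> elements.
\<close>

definition eigenvalue_mset :: "real mat \<Rightarrow> real multiset" where
  "eigenvalue_mset A = proots (char_poly A)"

definition slowly_varying :: "(real \<Rightarrow> real) \<Rightarrow> bool" where
  "slowly_varying l \<longleftrightarrow> (\<forall>t>0. l t > 0) \<and> (\<forall>x>0. ((\<lambda>t. l (t * x) / l t) \<longlongrightarrow> 1) at_top)"

text \<open>
  Point processes live on a Borel subset \<open>E\<close> of a topological space; below, \<open>E\<close> is \<open>(0,\<infinity>]\<close>, i.e.
  \<open>{0<..}\<close> in the extended reals. The compact subsets of \<open>E\<close> are compact for the relative topology
  as well, so a set is relatively compact in \<open>(0,\<infinity>]\<close> iff it lies in some \<open>[c,\<infinity>]\<close> with \<open>c > 0\<close>.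
\<close>

definition relatively_compact_in :: "'e::topological_space set \<Rightarrow> 'e set \<Rightarrow> bool" where
  "relatively_compact_in E B \<longleftrightarrow> (\<exists>K. compact K \<and> B \<subseteq> K \<and> K \<subseteq> E)"

text \<open>
  The counting measure on \<open>E\<close> of a finite collection of points, \<open>\<Sum>\<^sub>i \<epsilon>\<^bsub>x\<^sub>i\<^esub>\<close>; points outside \<open>E\<close> do not
  contribute.
\<close>

definition dirac_sum :: "'e::topological_space set \<Rightarrow> 'e multiset \<Rightarrow> 'e measure" where
  "dirac_sum E S =
     measure_of E (sets (restrict_space borel E)) (\<lambda>A. \<Sum>x\<in>#S. emeasure (return borel x) A)"

text \<open>
  A point process is a random element of the space of locally finite, nonnegative-integer-valued
  measures on \<open>E\<close>. Membership in \<open>\<nat>\<close> excludes the value \<open>\<infinity>\<close>.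
\<close>

definition point_process ::
    "'e::topological_space set \<Rightarrow> 'a measure \<Rightarrow> ('a \<Rightarrow> 'e measure) \<Rightarrow> bool" where
  "point_process E M N \<longleftrightarrow>
     (\<forall>\<omega>\<in>space M. sets (N \<omega>) = sets (restrict_space borel E) \<and>
        (\<forall>B\<in>sets (restrict_space borel E).
           relatively_compact_in E B \<longrightarrow> emeasure (N \<omega>) B \<in> \<nat>)) \<and>
     (\<forall>B\<in>sets (restrict_space borel E). (\<lambda>\<omega>. emeasure (N \<omega>) B) \<in> borel_measurable M)"

definition poisson_point_process ::
    "'e::topological_space set \<Rightarrow> 'a measure \<Rightarrow> ('a \<Rightarrow> 'e measure) \<Rightarrow> 'e measure \<Rightarrow> bool" where
  "poisson_point_process E M N \<mu> \<longleftrightarrow>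
     prob_space M \<and> point_process E M N \<and> sets \<mu> = sets (restrict_space borel E) \<and>
     (\<forall>A\<in>sets \<mu>. emeasure \<mu> A < \<infinity> \<longrightarrow>
        (\<forall>k::nat. measure M {\<omega> \<in> space M. emeasure (N \<omega>) A = of_nat k} =
           measure \<mu> A ^ k / fact k * exp (- measure \<mu> A))) \<and>
     (\<forall>A\<in>sets \<mu>. emeasure \<mu> A = \<infinity> \<longrightarrow> (AE \<omega> in M. emeasure (N \<omega>) A = \<infinity>)) \<and>
     (\<forall>(m::nat) A. (\<forall>i<m. A i \<in> sets \<mu>) \<longrightarrow> disjoint_family_on A {..<m} \<longrightarrow>
        prob_space.indep_vars M (\<lambda>_. borel) (\<lambda>i \<omega>. emeasure (N \<omega>) (A i)) {..<m})"

definition pp_test_function :: "'e::topological_space set \<Rightarrow> ('e \<Rightarrow> real) \<Rightarrow> bool" where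
  "pp_test_function E f \<longleftrightarrow>
     continuous_on E f \<and> (\<forall>x\<in>E. f x \<ge> 0) \<and> relatively_compact_in E {x\<in>E. f x \<noteq> 0}"

definition pp_converges_in_distribution ::
    "'e::topological_space set \<Rightarrow> (nat \<Rightarrow> 'a measure) \<Rightarrow> (nat \<Rightarrow> 'a \<Rightarrow> 'e measure) \<Rightarrow>
     'b measure \<Rightarrow> ('b \<Rightarrow> 'e measure) \<Rightarrow> bool" where
  "pp_converges_in_distribution E Ms Ns M N \<longleftrightarrow>
     (\<forall>n. point_process E (Ms n) (Ns n)) \<and> point_process E M N \<and>
     (\<forall>f. pp_test_function E f \<longrightarrow>
        weak_conv_m (\<lambda>n. distr (Ms n) borel (\<lambda>\<omega>. \<integral>x. f x \<partial>Ns n \<omega>))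
                    (distr M borel (\<lambda>\<omega>. \<integral>x. f x \<partial>N \<omega>)))"

text \<open>
  The matrix \<open>(Z\<^bsub>it\<^esub>)\<close> with \<open>p\<close> rows and \<open>n\<close> columns. Indices start at \<open>0\<close>, so \<open>Z 0 0\<close> plays the role
  of \<open>Z\<^sub>1\<^sub>1\<close>.
\<close>

definition data_matrix :: "(nat \<Rightarrow> nat \<Rightarrow> 'a \<Rightarrow> real) \<Rightarrow> nat \<Rightarrow> nat \<Rightarrow> 'a \<Rightarrow> real mat" where
  "data_matrix Z p n \<omega> = Matrix.mat p n (\<lambda>(i, t). Z i t \<omega>)"

definition eigenvalue_process ::
    "(nat \<Rightarrow> nat \<Rightarrow> 'a \<Rightarrow> real) \<Rightarrow> (nat \<Rightarrow> real) \<Rightarrow> (nat \<Rightarrow> nat) \<Rightarrow> nat \<Rightarrow> 'a \<Rightarrow> ereal measure" where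
  "eigenvalue_process Z a p n \<omega> =
     (let X = data_matrix Z (p n) n \<omega>
      in dirac_sum {0<..}
           (image_mset (\<lambda>ev. ereal (ev / (a (n * p n))\<^sup>2)) (eigenvalue_mset (X * transpose_mat X))))"

end

theory Submission
  imports Defs
begin

text \<open>
  Write \<open>A = a\<^bsub>np\<^esub>\<close> and \<open>D\<^sub>i = \<Sum>\<^sub>t Z\<^bsub>it\<^esub>\<^sup>2\<close> for the diagonal entries of \<open>X X\<^sup>T\<close>. The theorem holds because
  on the scale \<open>A\<^sup>2\<close> the matrix \<open>X X\<^sup>T\<close> is almost diagonal, and its diagonal entries are \<open>p\<close> iid
  variables each of which is governed by a single summand.

  The squares \<open>Z\<^sup>2\<close> have tail index \<open>\<alpha>/2 < 1\<close>, so a sum of them is large only if one of them is: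
  \<open>p P(D\<^sub>1 > y A\<^sup>2)\<close> has the same limit as \<open>n p P(Z\<^sup>2 > y A\<^sup>2)\<close>, namely \<open>y\<^bsup>-\<alpha>/2\<^esup>\<close>
  (\<open>row_sum_tail_limit\<close>). For a triangular array of iid points this is all that is needed for
  convergence to a Poisson process; \<open>row_step_sum_char_limit\<close> is the corresponding statement for
  characteristic functions of step functionals.

  For the off-diagonal part, truncate all entries at \<open>K A\<close>; this changes something with probability
  of order \<open>K\<^bsup>-\<alpha>\<^esup>\<close> only. With \<open>V\<close> and \<open>B\<close> the truncated second and first absolute moments, the squared
  Frobenius norm of the off-diagonal part of the truncated matrix has expectation at most
  \<open>p\<^sup>2 (n V\<^sup>2 + n\<^sup>2 B\<^sup>4)\<close>. Regular variation with \<open>\<alpha> < 2\<close> gives \<open>n p V = O(A\<^sup>2)\<close> and \<open>n p B\<^sup>2 = o(A\<^sup>2)\<close>, so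
  the expectation is \<open>O(A\<^sup>4/n) + o(A\<^sup>4)\<close> (\<open>off_diagonal_negligible\<close>).

  The two parts are combined by Weyl's inequality, used in the form of a comparison of counting
  functions (\<open>eigenvalue_count_perturbation\<close>): for finitely many levels, with probability tending
  to one, as many eigenvalues as row sums exceed each level (\<open>exceptional_set\<close>). A test function is
  uniformly close to a step function that vanishes near \<open>0\<close> as well; hence the
  characteristic functions of the integrals against the eigenvalue process and against the Poisson
  process have the same limits, and Levy's continuity theorem applies. Weyl's inequality
  also shows that eigenvalues are measurable.
\<close>

section \<open>Eigenvalues of real symmetric matrices\<close>

text \<open>
  A complex eigenvector \<open>x + i y\<close> for \<open>a + i b\<close> exists since the characteristic polynomial has a complex
  root. Symmetry of \<open>A\<close>, applied to the pairing of \<open>y\<close> with \<open>A x\<close>, gives \<open>b (|x|\<^sup>2 + |y|\<^sup>2) = 0\<close>. So \<open>x\<close> and \<open>y\<close>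
  are real eigenvectors, unless they vanish.
\<close>

lemma symmetric_real_eigenvector:
  fixes A :: "real mat"
  assumes A: "A \<in> carrier_mat n n" and sym: "transpose_mat A = A" and n: "n > 0"
  shows "\<exists>v e. (\<exists>i<n. v i \<noteq> 0) \<and> (\<forall>i<n. (\<Sum>j<n. A $$ (i,j) * v j) = e * v i)"
proof -
  let ?C = "map_mat complex_of_real A"
  have C: "?C \<in> carrier_mat n n" using A by simp
  obtain as where as: "char_poly ?C = (\<Prod>a\<leftarrow>as. [:- a, 1:])" "length as = n"
    using char_poly_factorized[OF C] by blast
  then obtain \<mu> bs where "as = \<mu> # bs" using n by (cases as) auto
  then have "poly (char_poly ?C) \<mu> = 0" by (simp add: as(1))
  then obtain w where w: "w \<in> carrier_vec n" "w \<noteq> 0\<^sub>v n" "?C *\<^sub>v w = \<mu> \<cdot>\<^sub>v w"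
    using eigenvalue_root_char_poly[OF C] C unfolding eigenvalue_def eigenvector_def by auto
  define x where "x i = Re (vec_index w i)" for i
  define y where "y i = Im (vec_index w i)" for i
  define a where "a = Re \<mu>"
  define b where "b = Im \<mu>"
  have wi: "(\<Sum>j<n. complex_of_real (A $$ (i,j)) * vec_index w j) = \<mu> * vec_index w i" if "i < n" for i
  proof -
    have "vec_index (?C *\<^sub>v w) i = vec_index (\<mu> \<cdot>\<^sub>v w) i" by (simp only: w(3))
    then show ?thesis using that A w(1)
      by (simp add: scalar_prod_def lessThan_atLeast0)
  qed
  have X: "(\<Sum>j<n. A $$ (i,j) * x j) = a * x i - b * y i" if "i < n" for i
    using arg_cong[OF wi[OF that], of Re] by (simp add: x_def y_def a_def b_def)
  have Y: "(\<Sum>j<n. A $$ (i,j) * y j) = a * y i + b * x i" if "i < n" for i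
    using arg_cong[OF wi[OF that], of Im] by (simp add: x_def y_def a_def b_def)
  have symA: "A $$ (i,j) = A $$ (j,i)" if "i < n" "j < n" for i j
    using sym A that by (metis carrier_matD index_transpose_mat(1))
  have "(\<Sum>i<n. y i * (\<Sum>j<n. A $$ (i,j) * x j)) = (\<Sum>i<n. \<Sum>j<n. y i * A $$ (i,j) * x j)"
    by (simp add: sum_distrib_left mult.assoc)
  also have "\<dots> = (\<Sum>j<n. \<Sum>i<n. y i * A $$ (i,j) * x j)" by (rule sum.swap)
  also have "\<dots> = (\<Sum>j<n. x j * (\<Sum>i<n. A $$ (j,i) * y i))"
    by (intro sum.cong refl) (auto simp: sum_distrib_left symA algebra_simps intro!: sum.cong)
  finally have "(\<Sum>i<n. y i * (a * x i - b * y i)) = (\<Sum>j<n. x j * (a * y j + b * x j))"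
    using X Y by simp
  then have "b * (\<Sum>i<n. (x i)\<^sup>2 + (y i)\<^sup>2) = 0"
    by (simp add: sum_distrib_left algebra_simps power2_eq_square sum.distrib sum_subtractf)
  moreover obtain i0 where i0: "i0 < n" "vec_index w i0 \<noteq> 0"
    using w(1,2) by (metis carrier_vecD eq_vecI index_zero_vec)
  then have xy: "x i0 \<noteq> 0 \<or> y i0 \<noteq> 0" by (auto simp: x_def y_def complex_eq_iff)
  then have "(\<Sum>i<n. (x i)\<^sup>2 + (y i)\<^sup>2) > 0"
    using i0 by (intro sum_pos2[of _ i0]) (auto simp: sum_power2_gt_zero_iff)
  ultimately have "b = 0" by simp
  then have "(\<forall>i<n. (\<Sum>j<n. A $$ (i,j) * x j) = a * x i) \<and> (\<forall>i<n. (\<Sum>j<n. A $$ (i,j) * y j) = a * y i)"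
    using X Y by simp
  then show ?thesis using xy i0(1) by blast
qed

text \<open>
  The reflection that exchanges \<open>v\<close> and the first unit vector. Its explicit form avoids the completion
  of \<open>v\<close> to an orthonormal basis.
\<close>

lemma householder_reflection:
  fixes v :: "nat \<Rightarrow> real"
  assumes v: "(\<Sum>i<n. (v i)\<^sup>2) = 1" and n: "n > 0"
  shows "\<exists>H. H \<in> carrier_mat n n \<and> transpose_mat H = H \<and> H * H = 1\<^sub>m n \<and> (\<forall>i<n. H $$ (i,0) = v i)"
proof -
  define u where "u i = v i - (if i = 0 then 1 else 0)" for i
  \<comment> \<open>If \<open>v 0 = 1\<close> then \<open>u = 0\<close>, and the value \<open>1 / 0 = 0\<close> makes \<open>H\<close> the identity, as it should.\<close>
  define c where "c = 1 / (1 - v 0)"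
  define H where "H = Matrix.mat n n (\<lambda>(i,j). (if i = j then 1 else 0) - c * u i * u j)"
  have 1: "(\<Sum>i<n. (u i)\<^sup>2) = 2 * (1 - v 0)"
  proof -
    have "(\<Sum>i<n. (u i)\<^sup>2) = (\<Sum>i<n. (v i)\<^sup>2 + (if i = 0 then 1 - 2 * v 0 else 0))"
      by (intro sum.cong) (auto simp: u_def power2_eq_square algebra_simps)
    then show ?thesis using v n by (simp add: sum.distrib)
  qed
  have v1: "v i = (if i = 0 then 1 else 0)" if "v 0 = 1" "i < n" for i
  proof -
    have "(u i)\<^sup>2 = 0"
      using 1 that sum_nonneg_eq_0_iff[of "{..<n}" "\<lambda>i. (u i)\<^sup>2"] by simp
    then show ?thesis by (simp add: u_def)
  qed
  have cc: "c * c * (\<Sum>i<n. (u i)\<^sup>2) = 2 * c"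
  proof -
    have "1 / d * (1 / d) * (2 * d) = 2 * (1 / d)" for d :: real by (cases "d = 0") auto
    then show ?thesis unfolding 1 c_def .
  qed
  have "H $$ (i,0) = v i" if "i < n" for i
    using that n v1[of i] by (cases "v 0 = 1") (auto simp: H_def u_def c_def field_simps)
  moreover have "H * H = 1\<^sub>m n"
  proof (rule eq_matI)
    fix i j assume "i < dim_row (1\<^sub>m n :: real mat)" "j < dim_col (1\<^sub>m n :: real mat)"
    then have ij: "i < n" "j < n" by auto
    have "(H * H) $$ (i,j) = (\<Sum>k<n. ((if i = k then 1 else 0) - c * u i * u k) *
            ((if k = j then 1 else 0) - c * u k * u j))"
      using ij by (simp add: H_def scalar_prod_def lessThan_atLeast0)
    also have "\<dots> = (\<Sum>k<n. (if k = i then (if k = j then 1 else 0) - c * u k * u j else 0)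
        - (if k = j then c * u i * u k else 0) + c * c * u i * u j * (u k)\<^sup>2)"
      by (intro sum.cong) (auto simp: algebra_simps power2_eq_square)
    also have "\<dots> = (if i = j then 1 else 0) - 2 * c * u i * u j + u i * u j * (c * c * (\<Sum>k<n. (u k)\<^sup>2))"
      using ij by (simp add: sum.distrib sum_subtractf sum_distrib_left algebra_simps)
    also have "\<dots> = (if i = j then 1 else 0)" unfolding cc by (simp add: algebra_simps)
    finally show "(H * H) $$ (i,j) = 1\<^sub>m n $$ (i,j)" using ij by simp
  qed (auto simp: H_def)
  moreover have "H \<in> carrier_mat n n" "transpose_mat H = H"
    by (auto simp: H_def intro!: eq_matI)
  ultimately show ?thesis by blast
qed

text \<open>
  Induction on the dimension: conjugation with the Householder reflection that moves the first unit
  vector to an eigenvector leaves, by symmetry, a block diagonal matrix.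
\<close>

theorem real_spectral_theorem:
  fixes A :: "real mat"
  assumes "A \<in> carrier_mat n n" "transpose_mat A = A"
  shows "\<exists>P D. similar_mat_wit A D P (transpose_mat P) \<and> diagonal_mat D"
  using assms
proof (induction n arbitrary: A)
  case 0
  then show ?case
    by (intro exI[of _ "1\<^sub>m 0"] exI[of _ A] conjI similar_mat_witI[of _ _ 0])
       (auto simp: diagonal_mat_def intro!: eq_matI)
next
  case (Suc m)
  let ?n = "Suc m"
  note A = Suc.prems
  obtain v0 e where v0: "\<exists>i<?n. v0 i \<noteq> 0" and e0: "\<And>i. i < ?n \<Longrightarrow> (\<Sum>j<?n. A $$ (i,j) * v0 j) = e * v0 i"
    using symmetric_real_eigenvector[OF A] by auto
  define r where "r = sqrt (\<Sum>i<?n. (v0 i)\<^sup>2)"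
  have "(\<Sum>i<?n. (v0 i)\<^sup>2) > 0" using v0 by (auto intro: sum_pos2 simp del: sum.lessThan_Suc)
  then have r: "r > 0" "r\<^sup>2 = (\<Sum>i<?n. (v0 i)\<^sup>2)" by (auto simp: r_def sum_nonneg)
  define v where "v i = v0 i / r" for i
  have v: "(\<Sum>i<?n. (v i)\<^sup>2) = 1"
    unfolding v_def power_divide sum_divide_distrib[symmetric] r(2)[symmetric] using r(1) by simp
  have e: "(\<Sum>j<?n. A $$ (i,j) * v j) = e * v i" if "i < ?n" for i
    using e0[OF that] by (simp add: v_def sum_divide_distrib[symmetric] add_divide_distrib[symmetric])
  obtain H where H: "H \<in> carrier_mat ?n ?n" "transpose_mat H = H" "H * H = 1\<^sub>m ?n"
    and Hv: "\<And>i. i < ?n \<Longrightarrow> H $$ (i,0) = v i"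
    using householder_reflection[OF v] by auto
  define B where "B = H * A * H"
  have B: "B \<in> carrier_mat ?n ?n" using H A by (simp add: B_def)
  have simAB: "similar_mat_wit A B H H"
  proof (rule similar_mat_wit_sym, rule similar_mat_witI[OF H(3,3) B_def B A(1) H(1,1)])
  qed
  have symB: "transpose_mat B = B"
    using H A by (simp add: B_def transpose_mult[of _ ?n ?n _ ?n] assoc_mult_mat[of _ ?n ?n _ ?n _ ?n])
  have AH0: "col (A * H) 0 = e \<cdot>\<^sub>v col H 0"
    using A H e Hv by (intro eq_vecI) (auto simp: scalar_prod_def lessThan_atLeast0)
  have "B = H * (A * H)" using H A by (simp add: B_def assoc_mult_mat[of _ ?n ?n _ ?n _ ?n])
  then have "col B 0 = H *\<^sub>v col (A * H) 0" using H A by (simp add: col_mult2[of _ ?n ?n _ ?n])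
  also have "\<dots> = e \<cdot>\<^sub>v (H *\<^sub>v col H 0)" unfolding AH0 
    by (rule mult_mat_vec[OF H(1) col_carrier_vec[OF _ H(1)]]) simp
  also have "H *\<^sub>v col H 0 = col (H * H) 0" 
    by (rule col_mult2[OF H(1) H(1), symmetric]) simp
  also have "\<dots> = col (1\<^sub>m ?n) 0" by (simp only: H(3))
  finally have colB: "col B 0 = e \<cdot>\<^sub>v col (1\<^sub>m ?n) 0" .
  have Bi0: "B $$ (i,0) = (if i = 0 then e else 0)" if "i < ?n" for i
    using arg_cong[OF colB, of "\<lambda>w. vec_index w i"] that B by simp
  have B0j: "B $$ (0,i) = (if i = 0 then e else 0)" if "i < ?n" for i
    using Bi0[OF that] symB B that by (metis carrier_matD index_transpose_mat(1) zero_less_Suc)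
  define E where "E = Matrix.mat 1 1 (\<lambda>_. e)"
  define B3 where "B3 = Matrix.mat m m (\<lambda>(i,j). B $$ (Suc i, Suc j))"
  have c: "E \<in> carrier_mat 1 1" "B3 \<in> carrier_mat m m" by (auto simp: E_def B3_def)
  have Beq: "B = four_block_mat E (0\<^sub>m 1 m) (0\<^sub>m m 1) B3"
    using B by (intro eq_matI) (auto simp: E_def B3_def Bi0 B0j)
  have "B $$ (i,j) = B $$ (j,i)" if "i < ?n" "j < ?n" for i j
    using symB B that by (metis carrier_matD index_transpose_mat(1))
  then have "transpose_mat B3 = B3" by (intro eq_matI) (auto simp: B3_def)
  from Suc.IH[OF c(2) this] obtain P3 D3 where
    PD: "similar_mat_wit B3 D3 P3 (transpose_mat P3)" "diagonal_mat D3" by blast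
  note PDc = similar_mat_witD2[OF c(2) PD(1)]
  let ?Q = "four_block_mat (1\<^sub>m 1) (0\<^sub>m 1 m) (0\<^sub>m m 1) P3"
  let ?D = "four_block_mat E (0\<^sub>m 1 m) (0\<^sub>m m 1) D3"
  have "similar_mat_wit B ?D ?Q (four_block_mat (1\<^sub>m 1) (0\<^sub>m 1 m) (0\<^sub>m m 1) (transpose_mat P3))"
    unfolding Beq
    by (rule similar_mat_wit_four_block[OF similar_mat_wit_refl[OF c(1)] PD(1) _ _ c])
       (use PDc in auto)
  also have "four_block_mat (1\<^sub>m 1) (0\<^sub>m 1 m) (0\<^sub>m m 1) (transpose_mat P3) = transpose_mat ?Q"
    using PDc(6) by (subst transpose_four_block_mat[of _ 1 1 _ m _ m])
      (auto intro!: eq_matI)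
  finally have "similar_mat_wit A ?D (H * ?Q) (transpose_mat ?Q * H)"
    by (rule similar_mat_wit_trans[OF simAB])
  moreover have "transpose_mat ?Q * H = transpose_mat (H * ?Q)"
    using H PDc(6) by (subst transpose_mult[of _ ?n ?n _ ?n]) auto
  moreover have "diagonal_mat ?D" using PD(2) PDc(5) c by (auto simp: diagonal_mat_def)
  ultimately show ?case by metis
qed

lemma eigenvalue_mset_mat_diag:
  "eigenvalue_mset (mat_diag n d) = image_mset d (mset_set {..<n})"
proof -
  have "char_poly (mat_diag n d) = (\<Prod>a\<leftarrow>diag_mat (mat_diag n d). [:- a, 1:])"
    by (intro char_poly_upper_triangular[of _ n]) (auto simp: mat_diag_def)
  also have "diag_mat (mat_diag n d) = map d [0..<n]" by (simp add: diag_mat_def mat_diag_def)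
  also have "(\<Prod>a\<leftarrow>map d [0..<n]. [:- a, 1:]) = (\<Prod>i<n. [:- d i, 1:])"
    by (simp add: prod.list_conv_set_nth lessThan_atLeast0)
  finally have "eigenvalue_mset (mat_diag n d) = (\<Sum>i<n. {#d i#})"
    by (simp add: eigenvalue_mset_def proots_prod)
  also have "\<dots> = image_mset d (mset_set {..<n})"
    by (simp add: sum_unfold_sum_mset)
  finally show ?thesis .
qed

text \<open>
  The spectral theorem in coordinates, with the columns of \<open>P\<close> as an orthonormal basis of eigenvectors.
\<close>

lemma eigenvalue_expansion:
  fixes A :: "real mat"
  assumes A: "A \<in> carrier_mat n n" and sym: "transpose_mat A = A"
  obtains P :: "nat \<Rightarrow> nat \<Rightarrow> real" and \<Lambda> :: "nat \<Rightarrow> real" where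
    "\<And>k l. k < n \<Longrightarrow> l < n \<Longrightarrow> (\<Sum>i<n. P i k * P i l) = (if k = l then 1 else 0)"
    "\<And>i j. i < n \<Longrightarrow> j < n \<Longrightarrow> (\<Sum>k<n. P i k * P j k) = (if i = j then 1 else 0)"
    "\<And>i j. i < n \<Longrightarrow> j < n \<Longrightarrow> A $$ (i,j) = (\<Sum>k<n. \<Lambda> k * P i k * P j k)"
    "eigenvalue_mset A = image_mset \<Lambda> (mset_set {..<n})"
proof -
  obtain P D where PD: "similar_mat_wit A D P (transpose_mat P)" "diagonal_mat D"
    using real_spectral_theorem[OF A sym] by blast
  note w = similar_mat_witD2[OF A PD(1)]
  have dims[simp]: "dim_row P = n" "dim_col P = n" "dim_row D = n" "dim_col D = n" using w by auto
  define Q where "Q i k = P $$ (i,k)" for i k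
  define \<Lambda> where "\<Lambda> k = D $$ (k,k)" for k
  have Dmat: "D = mat_diag n \<Lambda>"
    using PD(2) by (intro eq_matI) (auto simp: mat_diag_def \<Lambda>_def diagonal_mat_def)
  have 1: "(\<Sum>i<n. Q i k * Q i l) = (if k = l then 1 else 0)" if "k < n" "l < n" for k l
    using arg_cong[OF w(2), of "\<lambda>M. M $$ (k,l)"] that
    by (simp add: Q_def scalar_prod_def lessThan_atLeast0)
  have 2: "(\<Sum>k<n. Q i k * Q j k) = (if i = j then 1 else 0)" if "i < n" "j < n" for i j
    using arg_cong[OF w(1), of "\<lambda>M. M $$ (i,j)"] that
    by (simp add: Q_def scalar_prod_def lessThan_atLeast0)
  have 3: "A $$ (i,j) = (\<Sum>k<n. \<Lambda> k * Q i k * Q j k)" if "i < n" "j < n" for i j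
  proof -
    have "A = Matrix.mat n n (\<lambda>(i,j). P $$ (i,j) * \<Lambda> j) * transpose_mat P"
      using w(3) w(6) by (simp add: Dmat mat_diag_mult_right[of _ n n])
    from arg_cong[OF this, of "\<lambda>M. M $$ (i,j)"] show ?thesis using that
      by (simp add: Q_def scalar_prod_def lessThan_atLeast0 mult_ac)
  qed
  have "char_poly A = char_poly D"
    using PD(1) by (intro char_poly_similar) (auto simp: similar_mat_def)
  then have "eigenvalue_mset A = image_mset \<Lambda> (mset_set {..<n})"
    using eigenvalue_mset_mat_diag[of n \<Lambda>] by (simp add: eigenvalue_mset_def Dmat)
  then show thesis using that[of Q \<Lambda>] 1 2 3 by blast
qed

text \<open>
  Gaussian elimination of one equation at a time.
\<close>

lemma underdetermined_homogeneous_system: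
  fixes M :: "'j \<Rightarrow> 'i \<Rightarrow> real"
  assumes "finite J" "finite I" "card J < card I"
  shows "\<exists>c. (\<exists>i\<in>I. c i \<noteq> 0) \<and> (\<forall>i. i \<notin> I \<longrightarrow> c i = 0) \<and> (\<forall>j\<in>J. (\<Sum>i\<in>I. M j i * c i) = 0)"
  using assms
proof (induction J arbitrary: I M rule: finite_induct)
  case empty
  then obtain i where "i \<in> I" by fastforce
  then show ?case by (intro exI[of _ "\<lambda>k. if k = i then 1 else 0"]) auto
next
  case (insert j J)
  show ?case
  proof (cases "\<forall>i\<in>I. M j i = 0")
    case True
    have "card J < card I" using insert by simp
    from insert.IH[OF insert.prems(1) this, of M] obtain c where
      c: "\<exists>i\<in>I. c i \<noteq> 0" "\<forall>i. i \<notin> I \<longrightarrow> c i = 0" "\<forall>j\<in>J. (\<Sum>i\<in>I. M j i * c i) = 0" by blast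
    have "(\<Sum>i\<in>I. M j i * c i) = 0" using True by (intro sum.neutral) auto
    with c show ?thesis by (intro exI[of _ c]) auto
  next
    case False
    then obtain i0 where i0: "i0 \<in> I" "M j i0 \<noteq> 0" by blast
    define M' where "M' j' i = M j' i - M j' i0 * M j i / M j i0" for j' i
    have "card J < card (I - {i0})" using insert i0 by simp
    moreover have "finite (I - {i0})" using insert.prems(1) by simp
    ultimately obtain c where
      c: "\<exists>i\<in>I - {i0}. c i \<noteq> 0" "\<And>i. i \<notin> I - {i0} \<Longrightarrow> c i = 0"
         "\<And>j. j \<in> J \<Longrightarrow> (\<Sum>i\<in>I - {i0}. M' j i * c i) = 0"
      using insert.IH[of "I - {i0}" M'] by blast
    define s where "s = (\<Sum>i\<in>I - {i0}. M j i * c i)"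
    define d where "d = c(i0 := - s / M j i0)"
    have S: "(\<Sum>i\<in>I. M j' i * d i) = (\<Sum>i\<in>I - {i0}. M j' i * c i) - M j' i0 * s / M j i0" for j'
    proof -
      have "(\<Sum>i\<in>I - {i0}. M j' i * d i) = (\<Sum>i\<in>I - {i0}. M j' i * c i)"
        by (intro sum.cong) (auto simp: d_def)
      then show ?thesis using insert.prems(1) i0 by (simp add: sum.remove[of I i0] d_def)
    qed
    have "(\<Sum>i\<in>I. M j' i * d i) = 0" if "j' \<in> J" for j'
    proof -
      have "(\<Sum>i\<in>I - {i0}. M' j' i * c i) = (\<Sum>i\<in>I - {i0}. M j' i * c i - M j' i0 / M j i0 * (M j i * c i))"
        by (intro sum.cong) (auto simp: M'_def algebra_simps)
      also have "\<dots> = (\<Sum>i\<in>I - {i0}. M j' i * c i) - M j' i0 / M j i0 * s"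
        by (simp add: sum_subtractf sum_distrib_left s_def)
      finally show ?thesis using c(3)[OF that] by (simp add: S)
    qed
    moreover have "(\<Sum>i\<in>I. M j i * d i) = 0" using i0 by (simp add: S s_def)
    moreover have "\<exists>i\<in>I. d i \<noteq> 0" using c(1) by (auto simp: d_def)
    moreover have "\<forall>i. i \<notin> I \<longrightarrow> d i = 0" using c(2) i0 by (auto simp: d_def)
    ultimately show ?thesis by auto
  qed
qed

definition eigenvalue_count :: "real \<Rightarrow> real mat \<Rightarrow> nat" where
  "eigenvalue_count y A = size (filter_mset (\<lambda>x. x > y) (eigenvalue_mset A))"

lemma quadratic_form_eigenvalue_expansion:
  fixes P :: "nat \<Rightarrow> nat \<Rightarrow> real" and A :: "nat \<Rightarrow> nat \<Rightarrow> real"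
  assumes "\<And>i j. i < n \<Longrightarrow> j < n \<Longrightarrow> A i j = (\<Sum>k<n. \<Lambda> k * P i k * P j k)"
  shows "(\<Sum>i<n. \<Sum>j<n. v i * A i j * v j) = (\<Sum>k<n. \<Lambda> k * (\<Sum>i<n. P i k * v i)\<^sup>2)"
proof -
  have "(\<Sum>i<n. \<Sum>j<n. v i * A i j * v j) = (\<Sum>i<n. \<Sum>j<n. \<Sum>k<n. \<Lambda> k * (P i k * v i) * (P j k * v j))"
    by (intro sum.cong refl) (auto simp: assms sum_distrib_left sum_distrib_right mult_ac)
  also have "\<dots> = (\<Sum>i<n. \<Sum>k<n. \<Sum>j<n. \<Lambda> k * (P i k * v i) * (P j k * v j))"
    by (intro sum.cong refl sum.swap)
  also have "\<dots> = (\<Sum>k<n. \<Sum>i<n. \<Sum>j<n. \<Lambda> k * (P i k * v i) * (P j k * v j))"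
    by (rule sum.swap)
  also have "\<dots> = (\<Sum>k<n. \<Lambda> k * (\<Sum>i<n. P i k * v i)\<^sup>2)"
    by (intro sum.cong refl) (simp add: power2_eq_square sum_product sum_distrib_left mult_ac)
  finally show ?thesis .
qed

text \<open>
  Weyl's inequality. If \<open>A\<close> had more eigenvalues above \<open>x + \<eta>\<close> than \<open>B\<close> has above \<open>x\<close>, then, by counting
  dimensions, some \<open>v \<noteq> 0\<close> would lie in the span of the former eigenvectors of \<open>A\<close> and be orthogonal to the
  latter eigenvectors of \<open>B\<close>. Its quadratic forms would satisfy \<open>v A v > (x + \<eta>) |v|\<^sup>2\<close> and
  \<open>v B v \<le> x |v|\<^sup>2\<close>, although they differ by at most \<open>\<eta> |v|\<^sup>2\<close>: the Frobenius norm dominates the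
  operator norm, by the Cauchy-Schwarz inequality.
\<close>

theorem eigenvalue_count_perturbation:
  fixes A B :: "real mat"
  assumes A: "A \<in> carrier_mat n n" "transpose_mat A = A"
    and B: "B \<in> carrier_mat n n" "transpose_mat B = B"
    and \<eta>: "\<eta> \<ge> 0" "(\<Sum>i<n. \<Sum>j<n. (A $$ (i,j) - B $$ (i,j))\<^sup>2) \<le> \<eta>\<^sup>2"
  shows "eigenvalue_count (x + \<eta>) A \<le> eigenvalue_count x B"
proof -
  obtain P \<Lambda> where P:
    "\<And>k l. k < n \<Longrightarrow> l < n \<Longrightarrow> (\<Sum>i<n. P i k * P i l) = (if k = l then 1 else 0)"
    "\<And>i j. i < n \<Longrightarrow> j < n \<Longrightarrow> (\<Sum>k<n. P i k * P j k) = (if i = j then 1 else 0)"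
    "\<And>i j. i < n \<Longrightarrow> j < n \<Longrightarrow> A $$ (i,j) = (\<Sum>k<n. \<Lambda> k * P i k * P j k)"
    "eigenvalue_mset A = image_mset \<Lambda> (mset_set {..<n})"
    using eigenvalue_expansion[OF A] by blast
  obtain Q \<Delta> where Q:
    "\<And>k l. k < n \<Longrightarrow> l < n \<Longrightarrow> (\<Sum>i<n. Q i k * Q i l) = (if k = l then 1 else 0)"
    "\<And>i j. i < n \<Longrightarrow> j < n \<Longrightarrow> (\<Sum>k<n. Q i k * Q j k) = (if i = j then 1 else 0)"
    "\<And>i j. i < n \<Longrightarrow> j < n \<Longrightarrow> B $$ (i,j) = (\<Sum>k<n. \<Delta> k * Q i k * Q j k)"
    "eigenvalue_mset B = image_mset \<Delta> (mset_set {..<n})"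
    using eigenvalue_expansion[OF B] by blast
  define I where "I = {k\<in>{..<n}. \<Lambda> k > x + \<eta>}"
  define J where "J = {k\<in>{..<n}. \<Delta> k > x}"
  have cI: "eigenvalue_count (x + \<eta>) A = card I"
    by (simp add: eigenvalue_count_def P(4) filter_mset_image_mset I_def)
  have cJ: "eigenvalue_count x B = card J"
    by (simp add: eigenvalue_count_def Q(4) filter_mset_image_mset J_def)
  show ?thesis
  proof (rule ccontr)
    assume "\<not> ?thesis"
    then have "card J < card I" by (simp add: cI cJ)
    then obtain c where c: "\<exists>i\<in>I. c i \<noteq> 0" "\<And>i. i \<notin> I \<Longrightarrow> c i = 0"
      "\<And>j. j \<in> J \<Longrightarrow> (\<Sum>i\<in>I. (\<Sum>l<n. Q l j * P l i) * c i) = 0"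
      using underdetermined_homogeneous_system[of J I "\<lambda>j i. (\<Sum>l<n. Q l j * P l i)"]
      by (auto simp: I_def J_def)
    define v where "v l = (\<Sum>i<n. P l i * c i)" for l
    define d where "d j = (\<Sum>l<n. Q l j * v l)" for j
    \<comment> \<open>\<open>c\<close> and \<open>d\<close> are the coordinates of \<open>v\<close> in the two eigenbases.\<close>
    have Pv: "(\<Sum>l<n. P l k * v l) = c k" if "k < n" for k
    proof -
      have "(\<Sum>l<n. P l k * v l) = (\<Sum>l<n. \<Sum>i<n. P l k * P l i * c i)"
        by (simp add: v_def sum_distrib_left mult_ac)
      also have "\<dots> = (\<Sum>i<n. \<Sum>l<n. P l k * P l i * c i)" by (rule sum.swap)
      also have "\<dots> = (\<Sum>i<n. if i = k then c i else 0)"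
        using that P(1) by (intro sum.cong refl) (auto simp: sum_distrib_right[symmetric])
      finally show ?thesis using that by simp
    qed
    have dJ: "d j = 0" if "j \<in> J" for j
    proof -
      have "d j = (\<Sum>l<n. \<Sum>i<n. Q l j * P l i * c i)"
        by (simp add: d_def v_def sum_distrib_left mult_ac)
      also have "\<dots> = (\<Sum>i<n. (\<Sum>l<n. Q l j * P l i) * c i)"
        by (subst sum.swap) (simp add: sum_distrib_right)
      also have "\<dots> = (\<Sum>i\<in>I. (\<Sum>l<n. Q l j * P l i) * c i)"
        using c(2) by (intro sum.mono_neutral_right) (auto simp: I_def)
      finally show ?thesis using c(3)[OF that] by simp
    qed
    have norm: "(\<Sum>l<n. (v l)\<^sup>2) = (\<Sum>k<n. (\<Sum>l<n. R l k * v l)\<^sup>2)"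
      if "\<And>i j. i < n \<Longrightarrow> j < n \<Longrightarrow> (\<Sum>k<n. R i k * R j k) = (if i = j then 1 else 0)"
      for R :: "nat \<Rightarrow> nat \<Rightarrow> real"
    proof -
      have "(\<Sum>l<n. (v l)\<^sup>2) = (\<Sum>i<n. \<Sum>j<n. v i * (if i = j then 1 else 0) * v j)"
      proof (rule sum.cong[OF refl])
        fix i assume "i \<in> {..<n}"
        have "(\<Sum>j<n. v i * (if i = j then 1 else 0) * v j) = (\<Sum>j<n. if j = i then (v i)\<^sup>2 else 0)"
          by (intro sum.cong) (auto simp: power2_eq_square)
        then show "(v i)\<^sup>2 = (\<Sum>j<n. v i * (if i = j then 1 else 0) * v j)"
          using \<open>i \<in> {..<n}\<close> by simp
      qed
      also have "\<dots> = (\<Sum>k<n. 1 * (\<Sum>l<n. R l k * v l)\<^sup>2)"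
        by (rule quadratic_form_eigenvalue_expansion) (simp add: that)
      finally show ?thesis by simp
    qed
    define V where "V = (\<Sum>l<n. (v l)\<^sup>2)"
    have V: "V = (\<Sum>k<n. (c k)\<^sup>2)" "V = (\<Sum>k<n. (d k)\<^sup>2)"
      using norm[OF P(2)] norm[OF Q(2)] Pv by (simp_all add: V_def d_def)
    have "(x + \<eta>) * V = (\<Sum>k<n. (x + \<eta>) * (c k)\<^sup>2)" by (simp add: V(1) sum_distrib_left)
    also have "\<dots> < (\<Sum>k<n. \<Lambda> k * (c k)\<^sup>2)"
    proof (rule sum_strict_mono_ex1)
      show "\<forall>k\<in>{..<n}. (x + \<eta>) * (c k)\<^sup>2 \<le> \<Lambda> k * (c k)\<^sup>2"
      proof
        fix k assume "k \<in> {..<n}"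
        then show "(x + \<eta>) * (c k)\<^sup>2 \<le> \<Lambda> k * (c k)\<^sup>2"
          using c(2)[of k] by (cases "k \<in> I") (auto simp: I_def intro!: mult_right_mono)
      qed
      from c(1) obtain i where "i \<in> I" "c i \<noteq> 0" by blast
      then show "\<exists>k\<in>{..<n}. (x + \<eta>) * (c k)\<^sup>2 < \<Lambda> k * (c k)\<^sup>2"
        by (intro bexI[of _ i]) (auto simp: I_def intro!: mult_strict_right_mono)
    qed simp
    also have "\<dots> = (\<Sum>i<n. \<Sum>j<n. v i * A $$ (i,j) * v j)"
      using quadratic_form_eigenvalue_expansion[of n "\<lambda>i j. A $$ (i,j)" \<Lambda> P v] P(3) Pv by simp
    finally have 1: "(x + \<eta>) * V < (\<Sum>i<n. \<Sum>j<n. v i * A $$ (i,j) * v j)" .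
    have "(\<Sum>i<n. \<Sum>j<n. v i * B $$ (i,j) * v j) = (\<Sum>k<n. \<Delta> k * (d k)\<^sup>2)"
      using quadratic_form_eigenvalue_expansion[of n "\<lambda>i j. B $$ (i,j)" \<Delta> Q v] Q(3) by (simp add: d_def)
    also have "\<dots> \<le> (\<Sum>k<n. x * (d k)\<^sup>2)"
    proof (rule sum_mono)
      fix k assume "k \<in> {..<n}"
      then show "\<Delta> k * (d k)\<^sup>2 \<le> x * (d k)\<^sup>2"
        using dJ[of k] by (cases "k \<in> J") (auto simp: J_def intro!: mult_right_mono)
    qed
    also have "\<dots> = x * V" by (simp add: V(2) sum_distrib_left)
    finally have 2: "(\<Sum>i<n. \<Sum>j<n. v i * B $$ (i,j) * v j) \<le> x * V" .
    let ?E = "\<lambda>p. A $$ p - B $$ p"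
    have "(\<Sum>i<n. \<Sum>j<n. v i * A $$ (i,j) * v j) - (\<Sum>i<n. \<Sum>j<n. v i * B $$ (i,j) * v j)
        = (\<Sum>p\<in>{..<n}\<times>{..<n}. ?E p * (v (fst p) * v (snd p)))" (is "_ = ?S")
      by (simp add: sum_subtractf[symmetric] sum.cartesian_product split_def algebra_simps)
    moreover have "?S \<le> \<eta> * V"
    proof -
      have "?S\<^sup>2 \<le> (\<Sum>p\<in>{..<n}\<times>{..<n}. (?E p)\<^sup>2) * (\<Sum>p\<in>{..<n}\<times>{..<n}. (v (fst p) * v (snd p))\<^sup>2)"
        by (rule Cauchy_Schwarz_ineq_sum)
      also have "(\<Sum>p\<in>{..<n}\<times>{..<n}. (v (fst p) * v (snd p))\<^sup>2) = V\<^sup>2"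
        unfolding V_def power2_eq_square[of "sum _ _"]
        by (simp add: sum_product sum.cartesian_product split_def power_mult_distrib)
      also have "(\<Sum>p\<in>{..<n}\<times>{..<n}. (?E p)\<^sup>2) = (\<Sum>i<n. \<Sum>j<n. (A $$ (i,j) - B $$ (i,j))\<^sup>2)"
        by (simp add: sum.cartesian_product split_def)
      also have "\<dots> * V\<^sup>2 \<le> \<eta>\<^sup>2 * V\<^sup>2" using \<eta> by (intro mult_right_mono) auto
      finally have "?S\<^sup>2 \<le> (\<eta> * V)\<^sup>2" by (simp add: power_mult_distrib)
      moreover have "\<eta> * V \<ge> 0" using \<eta>(1) by (simp add: V_def sum_nonneg)
      ultimately show ?thesis by (rule power2_le_imp_le)
    qed
    ultimately show False using 1 2 by (simp add: algebra_simps)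
  qed
qed

section \<open>Measurability of the eigenvalue process\<close>

text \<open>
  The matrix \<open>X X\<^sup>T\<close> as a function on the product space \<open>\<nat> \<times> \<nat> \<Rightarrow> \<real>\<close>, whose topology is second countable, so that
  topological arguments about it yield measurability.
\<close>

definition gram_matrix :: "nat \<Rightarrow> nat \<Rightarrow> (nat \<times> nat \<Rightarrow> real) \<Rightarrow> real mat" where
  "gram_matrix p n x = Matrix.mat p p (\<lambda>(i, j). \<Sum>t<n. x (i, t) * x (j, t))"

lemma gram_matrix_carrier: "gram_matrix p n x \<in> carrier_mat p p"
  and gram_matrix_symmetric: "transpose_mat (gram_matrix p n x) = gram_matrix p n x"
  by (auto simp: gram_matrix_def mult.commute intro!: eq_matI)

lemma data_matrix_gram:
  "data_matrix Z p n w * transpose_mat (data_matrix Z p n w) = gram_matrix p n (\<lambda>(i, t). Z i t w)"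
  by (rule eq_matI) (auto simp: data_matrix_def gram_matrix_def scalar_prod_def lessThan_atLeast0)

lemma size_eigenvalue_mset:
  assumes "A \<in> carrier_mat n n" "transpose_mat A = A"
  shows "size (eigenvalue_mset A) = n"
proof -
  obtain \<Lambda> :: "nat \<Rightarrow> real" where "eigenvalue_mset A = image_mset \<Lambda> (mset_set {..<n})"
    using eigenvalue_expansion[OF assms] by metis
  then show ?thesis by simp
qed

lemma eigenvalue_count_right_continuous:
  "\<exists>\<eta>>0. eigenvalue_count (y + \<eta>) A = eigenvalue_count y A"
proof -
  let ?S = "{ev \<in> set_mset (eigenvalue_mset A). ev > y}"
  define \<eta> where "\<eta> = (if ?S = {} then 1 else (Min ?S - y) / 2)"
  have "Min ?S > y" if "?S \<noteq> {}"
    using Min_in[OF _ that] by auto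
  then have \<eta>: "\<eta> > 0" by (auto simp: \<eta>_def)
  have "ev > y + \<eta>" if "ev \<in> ?S" for ev
  proof -
    have "Min ?S \<le> ev" using that by (intro Min_le) auto
    moreover have "Min ?S > y" using that \<open>?S \<noteq> {} \<Longrightarrow> Min ?S > y\<close> by blast
    moreover have "\<eta> = (Min ?S - y) / 2" using that by (auto simp: \<eta>_def)
    ultimately show ?thesis by (simp add: field_simps)
  qed
  then have "filter_mset (\<lambda>x. x > y + \<eta>) (eigenvalue_mset A) = filter_mset (\<lambda>x. x > y) (eigenvalue_mset A)"
    using \<eta> by (intro filter_mset_cong) force+
  then show ?thesis using \<eta> unfolding eigenvalue_count_def by metis
qed

text \<open>
  Lower semicontinuity of the counting function: a small perturbation cannot push any of the
  eigenvalues above \<open>y\<close> down to \<open>y\<close>, by Weyl's inequality.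
\<close>

lemma open_eigenvalue_count_ge: "open {x. k \<le> eigenvalue_count y (gram_matrix p n x)}"
proof (subst open_subopen, safe)
  fix x assume k: "k \<le> eigenvalue_count y (gram_matrix p n x)"
  obtain \<eta> where \<eta>: "\<eta> > 0" "eigenvalue_count (y + \<eta>) (gram_matrix p n x) = eigenvalue_count y (gram_matrix p n x)"
    using eigenvalue_count_right_continuous by blast
  define T where "T = {x' :: nat \<times> nat \<Rightarrow> real. (\<Sum>i<p. \<Sum>j<p.
      ((\<Sum>t<n. x (i, t) * x (j, t)) - (\<Sum>t<n. x' (i, t) * x' (j, t)))\<^sup>2) < \<eta>\<^sup>2}"
  have "open T" unfolding T_def
    by (intro open_Collect_less continuous_intros continuous_on_product_coordinates)
  moreover have "x \<in> T" using \<eta>(1) by (simp add: T_def)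
  moreover have "T \<subseteq> {x. k \<le> eigenvalue_count y (gram_matrix p n x)}"
  proof
    fix x' assume "x' \<in> T"
    then have "(\<Sum>i<p. \<Sum>j<p. (gram_matrix p n x $$ (i,j) - gram_matrix p n x' $$ (i,j))\<^sup>2) \<le> \<eta>\<^sup>2"
      by (simp add: T_def gram_matrix_def)
    from eigenvalue_count_perturbation[OF gram_matrix_carrier gram_matrix_symmetric
        gram_matrix_carrier gram_matrix_symmetric _ this, of y] \<eta> k
    show "x' \<in> {x. k \<le> eigenvalue_count y (gram_matrix p n x)}" by simp
  qed
  ultimately show "\<exists>T. open T \<and> x \<in> T \<and> T \<subseteq> {x. k \<le> eigenvalue_count y (gram_matrix p n x)}" by blast
qed

lemma sorted_nth_greater_iff:
  fixes xs :: "real list"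
  assumes "sorted xs" "k < length xs"
  shows "y < xs ! k \<longleftrightarrow> length xs - k \<le> length (filter (\<lambda>x. x > y) xs)"
proof
  assume y: "y < xs ! k"
  have "filter (\<lambda>x. x > y) (drop k xs) = drop k xs"
  proof (rule filter_True, rule ballI)
    fix x assume "x \<in> set (drop k xs)"
    then obtain j where "j < length xs - k" "x = xs ! (k + j)"
      by (auto simp: in_set_conv_nth)
    moreover from this have "xs ! k \<le> xs ! (k + j)" by (intro sorted_nth_mono[OF assms(1)]) auto
    ultimately show "x > y" using y by simp
  qed
  then have "length xs - k \<le> length (filter (\<lambda>x. x > y) (take k xs @ drop k xs))"
    by (simp only: filter_append length_append) simp
  then show "length xs - k \<le> length (filter (\<lambda>x. x > y) xs)" by simp
next
  assume *: "length xs - k \<le> length (filter (\<lambda>x. x > y) xs)"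
  show "y < xs ! k"
  proof (rule ccontr)
    assume "\<not> y < xs ! k"
    have "filter (\<lambda>x. x > y) (take (Suc k) xs) = []"
    proof (rule filter_False, rule ballI)
      fix x assume "x \<in> set (take (Suc k) xs)"
      then obtain j where "j \<le> k" "x = xs ! j" using assms(2)
        by (auto simp: in_set_conv_nth less_Suc_eq_le)
      then show "\<not> x > y" using \<open>\<not> y < xs ! k\<close> sorted_nth_mono[OF assms(1), of j k] assms(2) by auto
    qed
    then have "length (filter (\<lambda>x. x > y) (take (Suc k) xs @ drop (Suc k) xs)) \<le> length xs - Suc k"
      by (simp only: filter_append length_append) (metis add_0 length_drop length_filter_le list.size(3))
    then show False using * assms(2) by simp
  qed
qed

lemma length_sorted_eigenvalues:
  "length (sorted_list_of_multiset (eigenvalue_mset (gram_matrix p n x))) = p"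
  by (metis gram_matrix_carrier gram_matrix_symmetric mset_sorted_list_of_multiset size_eigenvalue_mset size_mset)

text \<open>
  The eigenvalues in increasing order, indexed from \<open>0\<close>. Each is a measurable function of the entries,
  because \<open>y\<close> lies below the one with index \<open>k\<close> iff at least \<open>p - k\<close> eigenvalues exceed \<open>y\<close>.
\<close>

definition ordered_eigenvalue :: "nat \<Rightarrow> nat \<Rightarrow> nat \<Rightarrow> (nat \<times> nat \<Rightarrow> real) \<Rightarrow> real" where
  "ordered_eigenvalue p n k x = sorted_list_of_multiset (eigenvalue_mset (gram_matrix p n x)) ! k"

lemma eigenvalue_mset_ordered:
  "eigenvalue_mset (gram_matrix p n x) = image_mset (\<lambda>k. ordered_eigenvalue p n k x) (mset_set {..<p})"
proof -
  let ?xs = "sorted_list_of_multiset (eigenvalue_mset (gram_matrix p n x))"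
  have "eigenvalue_mset (gram_matrix p n x) = mset ?xs" by simp
  also have "?xs = map (\<lambda>k. ?xs ! k) [0..<p]" using map_nth[of ?xs] by (simp add: length_sorted_eigenvalues)
  also have "mset \<dots> = image_mset (\<lambda>k. ordered_eigenvalue p n k x) (mset_set {..<p})"
    unfolding ordered_eigenvalue_def mset_map mset_upt lessThan_atLeast0 ..
  finally show ?thesis .
qed

lemma borel_measurable_ordered_eigenvalue:
  assumes "k < p"
  shows "ordered_eigenvalue p n k \<in> borel_measurable borel"
proof (subst borel_measurable_iff_greater, rule allI)
  fix y
  have "{x. y < ordered_eigenvalue p n k x} = {x. p - k \<le> eigenvalue_count y (gram_matrix p n x)}"
  proof (rule Collect_cong)
    fix x
    let ?xs = "sorted_list_of_multiset (eigenvalue_mset (gram_matrix p n x))"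
    have "length (filter (\<lambda>z. z > y) ?xs) = size (filter_mset (\<lambda>z. z > y) (mset ?xs))"
      by (simp only: mset_filter[symmetric] size_mset)
    then have "length (filter (\<lambda>z. z > y) ?xs) = eigenvalue_count y (gram_matrix p n x)"
      by (simp add: eigenvalue_count_def)
    then show "(y < ordered_eigenvalue p n k x) = (p - k \<le> eigenvalue_count y (gram_matrix p n x))"
      using sorted_nth_greater_iff[of ?xs k y] assms
      by (simp add: ordered_eigenvalue_def length_sorted_eigenvalues)
  qed
  then show "{w \<in> space borel. y < ordered_eigenvalue p n k w} \<in> sets borel"
    using open_eigenvalue_count_ge[of "p - k" y p n] by simp
qed

text \<open>
  The sum of Dirac masses is countably additive, so \<open>measure_of\<close> does not collapse to the zero measure.
\<close>

lemma
  fixes E :: "'e::topological_space set"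
  assumes E: "E \<in> sets borel"
  shows sets_dirac_sum: "sets (dirac_sum E S) = sets (restrict_space borel E)"
    and emeasure_dirac_sum: "B \<in> sets (restrict_space borel E) \<Longrightarrow>
      emeasure (dirac_sum E S) B = (\<Sum>x\<in>#S. indicator B x)"
proof -
  let ?R = "restrict_space borel E"
  have spR: "space ?R = E" by (simp add: space_restrict_space)
  have Pow: "sets ?R \<subseteq> Pow E" using sets.space_closed[of ?R] spR by simp
  have sig: "sigma_sets E (sets ?R) = sets ?R" using sets.sigma_sets_eq[of ?R] spR by simp
  show "sets (dirac_sum E S) = sets ?R"
    unfolding dirac_sum_def using Pow sig by (simp add: sets_measure_of)
  have borel: "B \<in> sets borel" if "B \<in> sets ?R" for B
    using that E by (simp add: sets_restrict_space_iff)
  have eq: "(\<Sum>x\<in>#S. emeasure (return borel x) B) = (\<Sum>x\<in>#S. indicator B x)" if "B \<in> sets ?R" for B and S :: "'e multiset"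
    using borel[OF that] by simp
  assume B: "B \<in> sets ?R"
  have "emeasure (dirac_sum E S) B = (\<Sum>x\<in>#S. emeasure (return borel x) B)"
  proof (rule emeasure_measure_of[OF dirac_sum_def Pow])
    show "B \<in> sets (dirac_sum E S)" using B \<open>sets (dirac_sum E S) = sets ?R\<close> by simp
    show "positive (sets (dirac_sum E S)) (\<lambda>A. \<Sum>x\<in>#S. emeasure (return borel x) A)"
      by (simp add: positive_def)
    show "countably_additive (sets (dirac_sum E S)) (\<lambda>A. \<Sum>x\<in>#S. emeasure (return borel x) A)"
    proof (rule countably_additiveI)
      fix A :: "nat \<Rightarrow> 'e set"
      assume A: "range A \<subseteq> sets (dirac_sum E S)" "disjoint_family A"
      then have A': "range A \<subseteq> sets borel"
        using borel \<open>sets (dirac_sum E S) = sets ?R\<close> by blast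
      show "(\<Sum>i. \<Sum>x\<in>#S. emeasure (return borel x) (A i)) = (\<Sum>x\<in>#S. emeasure (return borel x) (\<Union>i. A i))"
      proof (induction S)
        case (add x S)
        have "(\<Sum>i. emeasure (return borel x) (A i)) = emeasure (return borel x) (\<Union>i. A i)"
          using A' A(2) by (intro suminf_emeasure) auto
        then show ?case using add by (simp add: suminf_add[symmetric])
      qed simp
    qed
  qed
  with eq[OF B] show "emeasure (dirac_sum E S) B = (\<Sum>x\<in>#S. indicator B x)" by simp
qed

lemma sets_eigenvalue_process: "sets (eigenvalue_process Z a p n w) = sets (restrict_space borel {0<..})"
  unfolding eigenvalue_process_def Let_def by (rule sets_dirac_sum) simp

lemma emeasure_eigenvalue_process:
  assumes "B \<in> sets (restrict_space borel {0<..})"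
  shows "emeasure (eigenvalue_process Z a p n w) B =
    (\<Sum>k<p n. indicator B (ereal (ordered_eigenvalue (p n) n k (\<lambda>(i, t). Z i t w) / (a (n * p n))\<^sup>2)))"
  unfolding eigenvalue_process_def Let_def data_matrix_gram eigenvalue_mset_ordered
  using assms by (simp add: emeasure_dirac_sum image_mset.compositionality comp_def sum_unfold_sum_mset)

lemma emeasure_eigenvalue_process_Ioi:
  assumes "x > 0" "a (n * p n) > 0"
  shows "emeasure (eigenvalue_process Z a p n w) {ereal x<..} =
    of_nat (eigenvalue_count (x * (a (n * p n))\<^sup>2) (gram_matrix (p n) n (\<lambda>(i, t). Z i t w)))"
proof -
  have meas: "{ereal x<..} \<in> sets (restrict_space borel {0<..})"
    using assms(1) by (subst sets_restrict_space_iff) auto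
  then have "emeasure (eigenvalue_process Z a p n w) {ereal x<..} =
    (\<Sum>k<p n. if ordered_eigenvalue (p n) n k (\<lambda>(i, t). Z i t w) > x * (a (n * p n))\<^sup>2 then 1 else 0)"
    unfolding emeasure_eigenvalue_process[OF meas] using assms(2)
    by (intro sum.cong refl) (auto simp: indicator_def field_simps)
  also have "\<dots> = of_nat (card {k \<in> {..<p n}. ordered_eigenvalue (p n) n k (\<lambda>(i, t). Z i t w) > x * (a (n * p n))\<^sup>2})"
    by (subst sum.inter_filter[symmetric]) auto
  finally show ?thesis
    by (simp add: eigenvalue_count_def eigenvalue_mset_ordered filter_mset_image_mset)
qed

lemma point_process_eigenvalue_process:
  assumes Z: "\<And>i t. Z i t \<in> borel_measurable M"
  shows "point_process {0<..} M (eigenvalue_process Z a p n)"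
proof -
  have "(\<lambda>w. emeasure (eigenvalue_process Z a p n w) B) \<in> borel_measurable M"
    if B: "B \<in> sets (restrict_space borel {0<..})" for B
  proof -
    have [measurable]: "B \<in> sets borel" using B by (simp add: sets_restrict_space_iff)
    have Z': "(\<lambda>w. \<lambda>(i, t). Z i t w) \<in> borel_measurable M"
      by (rule measurable_coordinatewise_then_product) (auto simp: split_def Z)
    have [measurable]: "(\<lambda>w. ordered_eigenvalue (p n) n k (\<lambda>(i, t). Z i t w)) \<in> borel_measurable M" if "k < p n" for k
      using measurable_compose[OF Z' borel_measurable_ordered_eigenvalue[OF that]] by simp
    show ?thesis unfolding emeasure_eigenvalue_process[OF B]
      by (intro borel_measurable_sum) simp
  qed
  moreover have Nats_sum: "(\<Sum>k<m. indicator B (g k) :: ennreal) \<in> \<nat>" for g :: "nat \<Rightarrow> ereal" and B and m :: nat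
    by (induction m) (auto simp: indicator_def)
  have "emeasure (eigenvalue_process Z a p n w) B \<in> \<nat>"
    if "B \<in> sets (restrict_space borel {0<..})" for B w
    unfolding emeasure_eigenvalue_process[OF that] by (rule Nats_sum)
  ultimately show ?thesis by (auto simp: point_process_def sets_eigenvalue_process)
qed

section \<open>Step approximation of test functions\<close>

text \<open>
  The points \<open>x 0 \<le> \<dots> \<le> x m\<close> cut \<open>(x 0, \<infinity>]\<close> into \<open>m\<close> bounded cells and the unbounded cell with index \<open>m\<close>,
  which contains \<open>\<infinity>\<close>.
\<close>

definition grid_cell :: "nat \<Rightarrow> (nat \<Rightarrow> real) \<Rightarrow> nat \<Rightarrow> ereal set" where
  "grid_cell m x k = (if k < m then {ereal (x k)<..ereal (x (Suc k))} else {ereal (x m)<..})"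

lemma grid_cell_Union:
  assumes "mono x"
  shows "(\<Union>k\<le>m. grid_cell m x k) = {ereal (x 0)<..}"
proof (intro equalityI subsetI)
  fix y assume "y \<in> (\<Union>k\<le>m. grid_cell m x k)"
  then obtain k where "k \<le> m" "y > ereal (x k)"
    by (auto simp: grid_cell_def split: if_splits)
  moreover have "x 0 \<le> x k" using monoD[OF assms, of 0 k] by simp
  ultimately show "y \<in> {ereal (x 0)<..}" by (auto intro: le_less_trans[of _ "ereal (x k)"])
next
  fix y assume y: "y \<in> {ereal (x 0)<..}"
  define k where "k = (GREATEST k. k \<le> m \<and> ereal (x k) < y)"
  have k: "k \<le> m \<and> ereal (x k) < y" unfolding k_def
    by (rule GreatestI_nat[of _ 0 m]) (use y in auto)
  have max: "j \<le> k" if "j \<le> m" "ereal (x j) < y" for j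
    unfolding k_def by (rule Greatest_le_nat[of _ _ m]) (use that in auto)
  have "y \<in> grid_cell m x k"
    using k max[of "Suc k"] by (auto simp: grid_cell_def not_less[symmetric])
  then show "y \<in> (\<Union>k\<le>m. grid_cell m x k)" using k by blast
qed

lemma grid_cell_disjoint:
  assumes "mono x" "j \<le> m" "k \<le> m" "j \<noteq> k"
  shows "grid_cell m x j \<inter> grid_cell m x k = {}"
proof -
  have *: "grid_cell m x j \<inter> grid_cell m x k = {}" if "j < k" "k \<le> m" for j k
  proof -
    have "x (Suc j) \<le> x k" using that by (intro monoD[OF assms(1)]) auto
    then show ?thesis using that
      by (auto simp: grid_cell_def) (metis ereal_less_eq(3) leD order_trans)+
  qed
  show ?thesis using *[of j k] *[of k j] assms by (cases j k rule: linorder_cases) auto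
qed

lemma sets_grid_cell:
  assumes "mono x" "x 0 > 0" "k \<le> m"
  shows "grid_cell m x k \<in> sets (restrict_space borel {0<..})"
proof -
  have "grid_cell m x k \<subseteq> {ereal (x 0)<..}" using grid_cell_Union[OF assms(1), of m] assms(3) by blast
  also have "\<dots> \<subseteq> {0<..}" using assms(2) by auto
  finally show ?thesis by (subst sets_restrict_space_iff) (auto simp: grid_cell_def)
qed

text \<open>
  A test function has a limit at \<open>\<infinity>\<close> and is uniformly continuous on compact intervals of the real
  line. The left end \<open>x0\<close> of the grid depends on the support of \<open>f\<close> but not on \<open>\<epsilon>\<close>, so the error of
  the integrals below is controlled by the mass of one fixed set.
\<close>

lemma test_function_step_approximation:
  assumes "pp_test_function {0<..} f"
  obtains x0 :: real where "x0 > 0" "\<And>y. 0 < y \<Longrightarrow> y \<le> ereal x0 \<Longrightarrow> f y = 0"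
    "\<And>\<epsilon>. \<epsilon> > 0 \<Longrightarrow> \<exists>m x c. mono x \<and> x 0 = x0 \<and> (\<forall>k\<le>m. \<forall>y\<in>grid_cell m x k. \<bar>f y - c k\<bar> \<le> \<epsilon>)"
proof -
  have cont: "continuous_on {0<..} f" and rc: "relatively_compact_in {0<..} {x\<in>{0<..}. f x \<noteq> 0}"
    using assms by (auto simp: pp_test_function_def)
  obtain K where K: "compact K" "{x\<in>{0<..}. f x \<noteq> 0} \<subseteq> K" "K \<subseteq> {0<..}"
    using rc by (auto simp: relatively_compact_in_def)
  have "\<exists>x0>0. \<forall>y\<in>K. ereal x0 < y"
  proof (cases "K = {}")
    case False
    then obtain s where s: "s \<in> K" "\<And>t. t \<in> K \<Longrightarrow> s \<le> t" using compact_attains_inf[OF K(1)] by blast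
    then have "0 < s" using K(3) by auto
    then obtain x0 where "0 < ereal x0" "ereal x0 < s" using ereal_dense2 by blast
    then show ?thesis using s(2) by (intro exI[of _ x0]) (auto intro: less_le_trans)
  qed (auto intro: exI[of _ 1])
  then obtain x0 where x0: "x0 > 0" "\<And>y. y \<in> K \<Longrightarrow> ereal x0 < y" by blast
  show thesis
  proof (rule that[OF x0(1)])
    show "f y = 0" if "0 < y" "y \<le> ereal x0" for y
      using K(2) x0(2)[of y] that by (auto simp: not_less[symmetric])
    fix \<epsilon> :: real assume \<epsilon>: "\<epsilon> > 0"
    obtain A where A: "open A" "\<infinity> \<in> A" "\<And>y. y \<in> {0<..} \<Longrightarrow> y \<in> A \<Longrightarrow> f y \<in> ball (f \<infinity>) \<epsilon>"
      using cont[unfolded continuous_on_topological, rule_format, of \<infinity> "ball (f \<infinity>) \<epsilon>"] \<epsilon> by auto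
    obtain X0 where X0: "{ereal X0<..} \<subseteq> A" using A(1,2) open_PInfty by blast
    define X where "X = max X0 x0 + 1"
    have X: "X > x0" "X > X0" by (auto simp: X_def)
    have "continuous_on {x0..X} (f \<circ> ereal)"
      using x0(1) by (intro continuous_on_compose continuous_on_subset[OF cont])
        (auto intro!: continuous_on_ereal continuous_intros)
    then have "uniformly_continuous_on {x0..X} (f \<circ> ereal)"
      by (rule compact_uniformly_continuous) simp
    then obtain \<delta> where \<delta>: "\<delta> > 0"
      "\<And>y z. y \<in> {x0..X} \<Longrightarrow> z \<in> {x0..X} \<Longrightarrow> dist z y < \<delta> \<Longrightarrow> dist (f (ereal z)) (f (ereal y)) < \<epsilon>"
      unfolding uniformly_continuous_on_def comp_def using \<epsilon> by metis
    obtain m :: nat where m: "(X - x0) / \<delta> < real m" using reals_Archimedean2 by blast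
    have m0: "m > 0" using m X \<delta>(1) by (intro Nat.gr0I) (auto simp: field_simps)
    define h where "h = (X - x0) / real m"
    have h: "h > 0" "h < \<delta>" using m m0 X \<delta>(1) by (auto simp: h_def field_simps)
    define x where "x k = x0 + real k * h" for k
    define c where "c k = (if k < m then f (ereal (x (Suc k))) else f \<infinity>)" for k
    have xm: "x m = X" using m0 by (simp add: x_def h_def)
    have mono: "mono x" using h(1) by (auto simp: mono_def x_def intro!: mult_right_mono)
    have "\<bar>f y - c k\<bar> \<le> \<epsilon>" if k: "k \<le> m" and y: "y \<in> grid_cell m x k" for k y
    proof (cases "k < m")
      case True
      then have y': "ereal (x k) < y" "y \<le> ereal (x (Suc k))" using y by (auto simp: grid_cell_def)
      then obtain r where r: "y = ereal r" by (cases y) auto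
      have "x 0 \<le> x k" "x (Suc k) \<le> x m" using True by (auto intro!: monoD[OF mono])
      then have "r \<in> {x0..X}" "x (Suc k) \<in> {x0..X}" using y' r xm by (auto simp: x_def)
      moreover have "dist r (x (Suc k)) < \<delta>" using y' r h by (auto simp: dist_real_def x_def algebra_simps)
      ultimately show ?thesis using \<delta>(2)[of "x (Suc k)" r] True r by (simp add: c_def dist_real_def)
    next
      case False
      then have "y > ereal X" using y k xm by (auto simp: grid_cell_def)
      moreover have "ereal X0 < ereal X" "0 < ereal X" using X x0(1) by auto
      ultimately have "y > ereal X0" "y > 0" by (meson less_trans)+
      then have "y \<in> A" "y \<in> {0<..}" using X0 by auto
      then show ?thesis using A(3)[of y] False by (simp add: c_def dist_real_def abs_minus_commute)
    qed
    then show "\<exists>m x c. mono x \<and> x 0 = x0 \<and> (\<forall>k\<le>m. \<forall>y\<in>grid_cell m x k. \<bar>f y - c k\<bar> \<le> \<epsilon>)"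
      using mono by (intro exI[of _ m] exI[of _ x] exI[of _ c]) (auto simp: x_def)
  qed
qed

lemma integral_step_approximation:
  fixes \<mu> :: "ereal measure"
  assumes f: "pp_test_function {0<..} f" and x: "mono x" "x 0 > 0"
    and zero: "\<And>y. 0 < y \<Longrightarrow> y \<le> ereal (x 0) \<Longrightarrow> f y = 0"
    and approx: "\<And>k y. k \<le> m \<Longrightarrow> y \<in> grid_cell m x k \<Longrightarrow> \<bar>f y - c k\<bar> \<le> \<epsilon>"
    and \<mu>: "sets \<mu> = sets (restrict_space borel {0<..})" "emeasure \<mu> {ereal (x 0)<..} < \<infinity>"
  shows "\<bar>(\<integral>y. f y \<partial>\<mu>) - (\<Sum>k\<le>m. c k * measure \<mu> (grid_cell m x k))\<bar> \<le> \<epsilon> * measure \<mu> {ereal (x 0)<..}"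
proof -
  let ?T = "{ereal (x 0)<..}"
  let ?I = "grid_cell m x"
  define g where "g y = (\<Sum>k\<le>m. c k * indicator (?I k) y)" for y
  have sp: "space \<mu> = {0<..}" using sets_eq_imp_space_eq[OF \<mu>(1)] by (simp add: space_restrict_space)
  have I: "?I k \<in> sets \<mu>" if "k \<le> m" for k using sets_grid_cell[OF x that] \<mu>(1) by simp
  have T: "?T \<in> sets \<mu>" unfolding grid_cell_Union[OF x(1), of m, symmetric]
    using I by (intro sets.finite_UN) auto
  have I_space: "?I k \<inter> space \<mu> = ?I k" if "k \<le> m" for k using sets.sets_into_space[OF I[OF that]] by blast
  have fin: "emeasure \<mu> (?I k) < \<infinity>" if "k \<le> m" for k
    using le_less_trans[OF emeasure_mono[OF _ T] \<mu>(2)] grid_cell_Union[OF x(1), of m] that by blast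
  have f_meas: "f \<in> borel_measurable \<mu>"
  proof -
    have "f \<in> borel_measurable (restrict_space borel {0<..})"
      using f by (intro borel_measurable_continuous_on_restrict) (simp add: pp_test_function_def)
    then show ?thesis using measurable_cong_sets[OF \<mu>(1) refl] by blast
  qed
  have g_int: "integrable \<mu> g" unfolding g_def
    using I fin by (intro Bochner_Integration.integrable_sum integrable_mult_right integrable_real_indicator) auto
  have g_eq: "g y = c k" if "k \<le> m" "y \<in> ?I k" for k y
  proof -
    have "g y = (\<Sum>j\<le>m. if j = k then c k else 0)" unfolding g_def
      using grid_cell_disjoint[OF x(1)] that by (intro sum.cong) (auto simp: indicator_def)
    then show ?thesis using that by simp
  qed
  have diff: "\<bar>f y - g y\<bar> \<le> \<epsilon> * indicator ?T y" if "y \<in> space \<mu>" for y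
  proof (cases "y \<in> ?T")
    case True
    then obtain k where "k \<le> m" "y \<in> ?I k" using grid_cell_Union[OF x(1), of m] by blast
    then show ?thesis using approx g_eq True by simp
  next
    case False
    then have "g y = 0" unfolding g_def
      using grid_cell_Union[OF x(1), of m] by (intro sum.neutral) (auto simp: indicator_def)
    moreover have "f y = 0" using False that by (intro zero) (auto simp: sp)
    ultimately show ?thesis using False by simp
  qed
  have e_int: "integrable \<mu> (\<lambda>y. \<epsilon> * indicator ?T y)"
    using T \<mu>(2) by (intro integrable_mult_right integrable_real_indicator) auto
  have d_int: "integrable \<mu> (\<lambda>y. f y - g y)"
    using e_int by (rule Bochner_Integration.integrable_bound)
      (use f_meas g_int diff in \<open>auto intro!: AE_I2 order_trans[OF diff] borel_measurable_diff\<close>)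
  have f_int: "integrable \<mu> f" using Bochner_Integration.integrable_add[OF d_int g_int] by simp
  have "(\<integral>y. g y \<partial>\<mu>) = (\<Sum>k\<le>m. c k * measure \<mu> (?I k))"
    unfolding g_def using I fin I_space
    by (subst Bochner_Integration.integral_sum)
       (auto intro!: integrable_mult_right integrable_real_indicator sum.cong)
  then have "\<bar>(\<integral>y. f y \<partial>\<mu>) - (\<Sum>k\<le>m. c k * measure \<mu> (?I k))\<bar> = \<bar>\<integral>y. f y - g y \<partial>\<mu>\<bar>"
    using f_int g_int by simp
  also have "\<dots> \<le> (\<integral>y. \<bar>f y - g y\<bar> \<partial>\<mu>)" by (rule integral_abs_bound)
  also have "\<dots> \<le> (\<integral>y. \<epsilon> * indicator ?T y \<partial>\<mu>)"
    using d_int e_int diff by (intro integral_mono) auto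
  also have "\<dots> = \<epsilon> * measure \<mu> ?T" using T \<mu>(2) sets.sets_into_space[OF T] by (simp add: Int_absorb2)
  finally show ?thesis .
qed

lemma relatively_compact_in_Ioi:
  assumes "x > 0" "B \<subseteq> {ereal x<..}"
  shows "relatively_compact_in {0<..} B"
proof -
  have "compact {ereal x..}"
    using closed_ereal_atLeast compact_eq_closed by blast
  then show ?thesis unfolding relatively_compact_in_def
    using assms by (intro exI[of _ "{ereal x..}"]) (auto intro: less_le_trans[of _ "ereal x"])
qed

lemma point_process_finite:
  assumes N: "point_process {0<..} M N" and x: "x > 0" and w: "w \<in> space M"
  shows "emeasure (N w) {ereal x<..} < \<infinity>"
proof -
  have "{ereal x<..} \<in> sets (restrict_space borel {0<..})"
    using x by (subst sets_restrict_space_iff) auto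
  then have "emeasure (N w) {ereal x<..} \<in> \<nat>"
    using N w relatively_compact_in_Ioi[OF x order_refl] unfolding point_process_def by blast
  then show ?thesis by (auto elim!: Nats_cases simp: of_nat_less_top)
qed

text \<open>
  A sequence of step functions, the one with index \<open>j\<close> within \<open>1 / (j + 1)\<close> of \<open>f\<close>: it has the value
  \<open>c j k\<close> on the cell with index \<open>k\<close> of the grid \<open>x j\<close>.
\<close>

definition step_approximation ::
    "(ereal \<Rightarrow> real) \<Rightarrow> real \<Rightarrow> (nat \<Rightarrow> nat) \<Rightarrow> (nat \<Rightarrow> nat \<Rightarrow> real) \<Rightarrow> (nat \<Rightarrow> nat \<Rightarrow> real) \<Rightarrow> bool" where
  "step_approximation f x0 m x c \<longleftrightarrow> x0 > 0 \<and> (\<forall>y. 0 < y \<longrightarrow> y \<le> ereal x0 \<longrightarrow> f y = 0) \<and>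
     (\<forall>j. mono (x j) \<and> x j 0 = x0 \<and>
       (\<forall>k\<le>m j. \<forall>y\<in>grid_cell (m j) (x j) k. \<bar>f y - c j k\<bar> \<le> 1 / real (Suc j)))"

lemma step_approximation_exists:
  assumes "pp_test_function {0<..} f"
  shows "\<exists>x0 m x c. step_approximation f x0 m x c"
proof -
  obtain x0 where x0: "x0 > 0" "\<And>y. 0 < y \<Longrightarrow> y \<le> ereal x0 \<Longrightarrow> f y = 0"
    "\<And>\<epsilon>. \<epsilon> > 0 \<Longrightarrow> \<exists>m x c. mono x \<and> x 0 = x0 \<and> (\<forall>k\<le>m. \<forall>y\<in>grid_cell m x k. \<bar>f y - c k\<bar> \<le> \<epsilon>)"
    using test_function_step_approximation[OF assms] by metis
  have "\<forall>j. \<exists>m x c. mono x \<and> x 0 = x0 \<and> (\<forall>k\<le>m. \<forall>y\<in>grid_cell m x k. \<bar>f y - c k\<bar> \<le> 1 / real (Suc j))"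
    using x0(3) by simp
  then obtain m x c where "\<forall>j. mono (x j) \<and> x j 0 = x0 \<and>
      (\<forall>k\<le>m j. \<forall>y\<in>grid_cell (m j) (x j) k. \<bar>f y - c j k\<bar> \<le> 1 / real (Suc j))" by metis
  then show ?thesis using x0(1,2) unfolding step_approximation_def by blast
qed

lemma step_approximation_integral:
  fixes \<mu> :: "ereal measure"
  assumes f: "pp_test_function {0<..} f" and st: "step_approximation f x0 m x c"
    and \<mu>: "sets \<mu> = sets (restrict_space borel {0<..})" "emeasure \<mu> {ereal x0<..} < \<infinity>"
  shows "\<bar>(\<integral>y. f y \<partial>\<mu>) - (\<Sum>k\<le>m j. c j k * measure \<mu> (grid_cell (m j) (x j) k))\<bar>
    \<le> 1 / real (Suc j) * measure \<mu> {ereal x0<..}"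
proof -
  have x: "x j 0 = x0" "mono (x j)" "x0 > 0" and z: "\<And>y. 0 < y \<Longrightarrow> y \<le> ereal x0 \<Longrightarrow> f y = 0"
    and a: "\<And>k y. k \<le> m j \<Longrightarrow> y \<in> grid_cell (m j) (x j) k \<Longrightarrow> \<bar>f y - c j k\<bar> \<le> 1 / real (Suc j)"
    using st unfolding step_approximation_def by blast+
  show ?thesis
    using integral_step_approximation[OF f x(2) _ _ a \<mu>(1)] x z \<mu>(2) by simp
qed

lemma step_approximation_tendsto:
  fixes \<mu> :: "ereal measure"
  assumes f: "pp_test_function {0<..} f" and st: "step_approximation f x0 m x c"
    and \<mu>: "sets \<mu> = sets (restrict_space borel {0<..})" "emeasure \<mu> {ereal x0<..} < \<infinity>"
  shows "(\<lambda>j. \<Sum>k\<le>m j. c j k * measure \<mu> (grid_cell (m j) (x j) k)) \<longlonglongrightarrow> (\<integral>y. f y \<partial>\<mu>)"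
proof -
  let ?S = "\<lambda>j. \<Sum>k\<le>m j. c j k * measure \<mu> (grid_cell (m j) (x j) k)"
  have bnd: "\<bar>(\<integral>y. f y \<partial>\<mu>) - ?S j\<bar> \<le> 1 / real (Suc j) * measure \<mu> {ereal x0<..}" for j
    by (rule step_approximation_integral[OF f st \<mu>])
  have "(\<lambda>j. 1 / real (Suc j)) \<longlonglongrightarrow> 0"
    using lim_1_over_n[where 'a = real] by (rule LIMSEQ_Suc)
  then have lim0: "(\<lambda>j. 1 / real (Suc j) * measure \<mu> {ereal x0<..}) \<longlonglongrightarrow> 0"
    by (rule tendsto_mult_left_zero)
  have "(\<lambda>j. (\<integral>y. f y \<partial>\<mu>) - ?S j) \<longlonglongrightarrow> 0"
    by (rule Lim_null_comparison[OF _ lim0]) (rule always_eventually, simp only: real_norm_def bnd simp_thms)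
  from tendsto_diff[OF tendsto_const[of "\<integral>y. f y \<partial>\<mu>"] this]
  show ?thesis by simp
qed

lemma borel_measurable_point_process_measure:
  assumes N: "point_process {0<..} M N" and x: "mono x" "x 0 > 0" "k \<le> m"
  shows "(\<lambda>w. measure (N w) (grid_cell m x k)) \<in> borel_measurable M"
proof -
  have "(\<lambda>w. emeasure (N w) (grid_cell m x k)) \<in> borel_measurable M"
    using N sets_grid_cell[OF x] by (auto simp: point_process_def)
  then show ?thesis unfolding measure_def by measurable
qed

lemma borel_measurable_point_process_integral:
  fixes f :: "ereal \<Rightarrow> real"
  assumes N: "point_process {0<..} M N" and f: "pp_test_function {0<..} f"
  shows "(\<lambda>w. \<integral>y. f y \<partial>N w) \<in> borel_measurable M"
proof -
  obtain x0 m x c where st: "step_approximation f x0 m x c"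
    using step_approximation_exists[OF f] by blast
  have x: "x j 0 = x0" "mono (x j)" "x0 > 0" for j using st unfolding step_approximation_def by blast+
  show ?thesis
  proof (rule borel_measurable_LIMSEQ_real)
    fix w assume w: "w \<in> space M"
    have s: "sets (N w) = sets (restrict_space borel {0<..})" using N w by (simp add: point_process_def)
    show "(\<lambda>j. \<Sum>k\<le>m j. c j k * measure (N w) (grid_cell (m j) (x j) k)) \<longlonglongrightarrow> (\<integral>y. f y \<partial>N w)"
      by (rule step_approximation_tendsto[OF f st s point_process_finite[OF N x(3) w]])
  next
    fix j
    show "(\<lambda>w. \<Sum>k\<le>m j. c j k * measure (N w) (grid_cell (m j) (x j) k)) \<in> borel_measurable M"
      using x by (intro borel_measurable_sum borel_measurable_times borel_measurable_const
          borel_measurable_point_process_measure[OF N]) auto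
  qed
qed

section \<open>Truncated moments of a regularly varying variable\<close>

locale regularly_varying_variable = prob_space M for M :: "'a measure" +
  fixes X :: "'a \<Rightarrow> real" and a :: "nat \<Rightarrow> real" and \<alpha> :: real
  assumes X_measurable [measurable]: "X \<in> borel_measurable M"
    and alpha: "0 < \<alpha>" "\<alpha> < 2"
    and a_pos: "\<And>n. n \<ge> 1 \<Longrightarrow> a n > 0"
    and tail: "\<And>x::real. x > 0 \<Longrightarrow>
      (\<lambda>n. real n * measure M {w \<in> space M. \<bar>X w\<bar> > a n * x}) \<longlonglongrightarrow> x powr (-\<alpha>)"
begin

definition tail_prob :: "real \<Rightarrow> real" where
  "tail_prob u = \<P>(w in M. \<bar>X w\<bar> > u)"

definition truncated_moment :: "nat \<Rightarrow> real \<Rightarrow> real" where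
  "truncated_moment r u = expectation (\<lambda>w. \<bar>X w\<bar> ^ r * indicator {..u} \<bar>X w\<bar>)"

lemma tail_prob_antimono: "u \<le> v \<Longrightarrow> tail_prob v \<le> tail_prob u"
  unfolding tail_prob_def by (intro finite_measure_mono) auto

lemma tail_prob_nonneg: "tail_prob u \<ge> 0" by (simp add: tail_prob_def)

lemma tail_prob_limit: "x > 0 \<Longrightarrow> (\<lambda>n. real n * tail_prob (a n * x)) \<longlonglongrightarrow> x powr (-\<alpha>)"
  using tail[of x] by (simp add: tail_prob_def)

lemma tail_prob_seq_0: "x > 0 \<Longrightarrow> (\<lambda>n. tail_prob (a n * x)) \<longlonglongrightarrow> 0"
proof -
  assume x: "x > 0"
  have "(\<lambda>n. real n * tail_prob (a n * x) * (1 / real n)) \<longlonglongrightarrow> x powr (-\<alpha>) * 0"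
    by (intro tendsto_mult tail_prob_limit x lim_1_over_n)
  moreover have "\<forall>\<^sub>F n in sequentially. real n * tail_prob (a n * x) * (1 / real n) = tail_prob (a n * x)"
    using eventually_gt_at_top[of 0] by eventually_elim auto
  ultimately show ?thesis using Lim_transform_eventually by fastforce
qed

text \<open>
  If \<open>a\<close> were below some \<open>z\<close> infinitely often, then \<open>P(|X| > z x)\<close> would be below terms that tend to \<open>0\<close>, for
  every \<open>x > 0\<close>. So \<open>X\<close> would vanish almost surely, contrary to the assumption on its tail.
\<close>

lemma norming_at_top: "filterlim a at_top sequentially"
  unfolding filterlim_at_top_gt[where c = 0]
proof (intro allI impI, rule ccontr)
  fix z :: real assume z: "z > 0" and "\<not> (\<forall>\<^sub>F n in sequentially. z \<le> a n)"
  then have freq: "\<exists>\<^sub>F n in sequentially. a n < z" by (simp add: not_eventually not_le)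
  have zero: "tail_prob (z * x) = 0" if x: "x > 0" for x
  proof (rule ccontr)
    assume "tail_prob (z * x) \<noteq> 0"
    then have "tail_prob (z * x) > 0" using tail_prob_nonneg[of "z * x"] by simp
    then have "\<forall>\<^sub>F n in sequentially. tail_prob (a n * x) < tail_prob (z * x)"
      by (rule order_tendstoD(2)[OF tail_prob_seq_0[OF x]])
    with freq have "\<exists>\<^sub>F n in sequentially. tail_prob (a n * x) < tail_prob (z * x) \<and> a n < z"
      using frequently_eventually_conj by blast
    then obtain n where "tail_prob (a n * x) < tail_prob (z * x)" "a n < z"
      by (auto dest: frequently_ex)
    then show False using tail_prob_antimono[of "a n * x" "z * x"] x by (simp add: mult_right_mono)
  qed
  have "\<forall>\<^sub>F n in sequentially. real n * tail_prob (a n * 1) = 0"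
    using eventually_ge_at_top[of 1]
  proof eventually_elim
    case (elim n)
    then show ?case using zero[of "a n / z"] a_pos[of n] z by simp
  qed
  then have "(\<lambda>n. real n * tail_prob (a n * 1)) \<longlonglongrightarrow> 0" by (rule tendsto_eventually)
  then show False using tail_prob_limit[of 1] LIMSEQ_unique by fastforce
qed

lemma tail_prob_pos: "tail_prob u > 0"
proof -
  have "\<forall>\<^sub>F n in sequentially. real n * tail_prob (a n * 1) > 0"
    by (rule order_tendstoD(1)[OF tail_prob_limit]) auto
  moreover have "\<forall>\<^sub>F n in sequentially. a n \<ge> u"
    using norming_at_top by (simp add: filterlim_at_top)
  ultimately have "\<forall>\<^sub>F n in sequentially. real n * tail_prob (a n * 1) > 0 \<and> a n \<ge> u"
    by (rule eventually_conj)
  then obtain n where "real n * tail_prob (a n * 1) > 0" "a n \<ge> u"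
    using eventually_happens'[OF sequentially_bot] by blast
  then show ?thesis using tail_prob_antimono[of u "a n"] by (auto simp: zero_less_mult_iff)
qed

lemma tail_prob_at_top: "(tail_prob \<longlongrightarrow> 0) at_top"
proof -
  interpret D: real_distribution "distr M borel (\<lambda>w. \<bar>X w\<bar>)"
    by (rule real_distribution_distr) simp
  have "tail_prob = (\<lambda>u. 1 - cdf (distr M borel (\<lambda>w. \<bar>X w\<bar>)) u)"
  proof
    fix u
    have "{w \<in> space M. \<bar>X w\<bar> > u} = space M - {w \<in> space M. \<bar>X w\<bar> \<le> u}" by auto
    then have "tail_prob u = 1 - \<P>(w in M. \<bar>X w\<bar> \<le> u)"
      unfolding tail_prob_def by (simp add: prob_compl)
    also have "\<P>(w in M. \<bar>X w\<bar> \<le> u) = cdf (distr M borel (\<lambda>w. \<bar>X w\<bar>)) u"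
      unfolding cdf_def by (subst measure_distr) (auto intro!: arg_cong[where f = prob])
    finally show "tail_prob u = 1 - cdf (distr M borel (\<lambda>w. \<bar>X w\<bar>)) u" .
  qed
  moreover have "((\<lambda>u. 1 - cdf (distr M borel (\<lambda>w. \<bar>X w\<bar>)) u) \<longlongrightarrow> 1 - 1) at_top"
    by (intro tendsto_intros D.cdf_lim_at_top_prob)
  ultimately show ?thesis by simp
qed

text \<open>
  For large \<open>u\<close> put
  \<open>n = \<lfloor>1 / P(|X| > u)\<rfloor>\<close>. Comparing with \<open>P(|X| > \<theta> a n)\<close>, which is about \<open>\<theta>\<^bsup>-\<alpha>\<^esup> / n < 1 / n\<close>, gives \<open>u < \<theta> a n\<close>, and
  \<open>P(|X| > 2 u)\<close> is at least \<open>P(|X| > 2 \<theta> a n)\<close>, which is about \<open>(2 \<theta>)\<^bsup>-\<alpha>\<^esup> / n\<close>. Since \<open>\<alpha> < 2\<close>, \<open>\<theta> > 1\<close> can be chosen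
  with \<open>(2 \<theta>)\<^bsup>\<alpha>\<^esup> < 4\<close>.
\<close>

lemma tail_prob_doubling:
  "\<exists>K u0. 1 < K \<and> K < 4 \<and> u0 > 0 \<and> (\<forall>u\<ge>u0. tail_prob u \<le> K * tail_prob (2 * u))"
proof -
  \<comment> \<open>This choice gives \<open>(2 \<theta>)\<^bsup>\<alpha>\<^esup> = 2\<^bsup>1 + \<alpha>/2\<^esup>\<close>.\<close>
  define \<theta> where "\<theta> = 2 powr ((2 / \<alpha> - 1) / 2)"
  have s: "(2 / \<alpha> - 1) / 2 > 0" using alpha by (simp add: field_simps)
  have \<theta>: "\<theta> > 1" using s unfolding \<theta>_def by (intro gr_one_powr) auto
  define L where "L = (2 * \<theta>) powr \<alpha>"
  have "2 * \<theta> = 2 powr (1 + (2 / \<alpha> - 1) / 2)" by (simp add: \<theta>_def powr_add)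
  then have "L = 2 powr ((1 + (2 / \<alpha> - 1) / 2) * \<alpha>)" by (simp add: L_def powr_powr)
  also have "(1 + (2 / \<alpha> - 1) / 2) * \<alpha> = 1 + \<alpha> / 2" using alpha by (simp add: field_simps)
  finally have L_eq: "L = 2 powr (1 + \<alpha> / 2)" .
  have "L < 2 powr 2" unfolding L_eq using alpha by (intro powr_less_mono) auto
  moreover have "L > 1" unfolding L_eq using alpha by (intro gr_one_powr) auto
  ultimately have L: "1 < L" "L < 4" by auto
  define K where "K = (L + 4) / 2"
  have K: "1 < K" "L < K" "K < 4" using L by (auto simp: K_def)
  define N where "N u = nat \<lfloor>1 / tail_prob u\<rfloor>" for u
  have "filterlim (\<lambda>u. 1 / tail_prob u) at_top at_top"
    using tail_prob_at_top tail_prob_pos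
    by (auto intro!: filterlim_inverse_at_top simp: divide_inverse)
  then have N: "filterlim N at_top at_top" unfolding N_def
    by (intro filterlim_compose[OF filterlim_nat_sequentially] filterlim_compose[OF filterlim_floor_sequentially])
  have "(\<lambda>n. real n * tail_prob (a n * \<theta>) + tail_prob (a n * \<theta>)) \<longlonglongrightarrow> \<theta> powr (-\<alpha>) + 0"
    using \<theta> by (intro tendsto_add tail_prob_limit tail_prob_seq_0) auto
  moreover have "\<theta> powr (-\<alpha>) + 0 < 1" using \<theta> alpha by (simp add: powr_less_one)
  ultimately have S1: "\<forall>\<^sub>F n in sequentially. real n * tail_prob (a n * \<theta>) + tail_prob (a n * \<theta>) < 1"
    by (rule order_tendstoD(2))
  have "(2 * \<theta>) powr (-\<alpha>) > 1 / K"
    using K L \<theta> by (simp add: powr_minus L_def[symmetric] inverse_eq_divide frac_less2)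
  then have S2: "\<forall>\<^sub>F n in sequentially. real n * tail_prob (a n * (2 * \<theta>)) > 1 / K"
    using \<theta> by (intro order_tendstoD(1)[OF tail_prob_limit]) auto
  have "\<forall>\<^sub>F n in sequentially. real n * tail_prob (a n * \<theta>) + tail_prob (a n * \<theta>) < 1 \<and>
      real n * tail_prob (a n * (2 * \<theta>)) > 1 / K \<and> n \<ge> 1"
    using S1 S2 eventually_ge_at_top[of 1] by eventually_elim auto
  from eventually_compose_filterlim[OF this N]
  have "\<forall>\<^sub>F u in at_top. tail_prob u \<le> K * tail_prob (2 * u)"
  proof eventually_elim
    case (elim u)
    let ?n = "N u"
    have G: "tail_prob u > 0" by (rule tail_prob_pos)
    have "real ?n \<le> 1 / tail_prob u" "1 / tail_prob u < real ?n + 1"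
      using G unfolding N_def by (auto simp: of_nat_nat)
    then have n: "real ?n * tail_prob u \<le> 1" "1 < (real ?n + 1) * tail_prob u"
      using G by (auto simp: field_simps)
    have "u < a ?n * \<theta>"
    proof (rule ccontr)
      assume "\<not> u < a ?n * \<theta>"
      then have "tail_prob u \<le> tail_prob (a ?n * \<theta>)" by (intro tail_prob_antimono) simp
      then have "(real ?n + 1) * tail_prob u \<le> (real ?n + 1) * tail_prob (a ?n * \<theta>)"
        by (intro mult_left_mono) auto
      then show False using n(2) elim by (simp add: algebra_simps)
    qed
    then have "tail_prob (a ?n * (2 * \<theta>)) \<le> tail_prob (2 * u)" by (intro tail_prob_antimono) simp
    then have "real ?n * tail_prob (a ?n * (2 * \<theta>)) \<le> real ?n * tail_prob (2 * u)" by (intro mult_left_mono) auto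
    then have "1 / K < real ?n * tail_prob (2 * u)" using elim by linarith
    then have "1 < real ?n * (K * tail_prob (2 * u))" using K by (simp add: field_simps)
    then have "real ?n * tail_prob u < real ?n * (K * tail_prob (2 * u))" using n(1) by linarith
    then show ?case using elim by (simp add: mult_less_cancel_left)
  qed
  then obtain u1 where "\<And>u. u \<ge> u1 \<Longrightarrow> tail_prob u \<le> K * tail_prob (2 * u)"
    by (auto simp: eventually_at_top_linorder)
  then show ?thesis using K by (intro exI[of _ K] exI[of _ "max u1 1"]) auto
qed

lemma truncated_moment_integrable:
  "integrable M (\<lambda>w. \<bar>X w\<bar> ^ r * indicator {..u} \<bar>X w\<bar>)"
  by (rule integrable_const_bound[where B = "\<bar>u\<bar> ^ r"])
     (auto simp: indicator_def abs_mult power_abs intro!: AE_I2 power_mono)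

lemma truncated_moment_nonneg: "truncated_moment r u \<ge> 0"
  unfolding truncated_moment_def by (intro integral_nonneg_AE AE_I2) auto

lemma truncated_moment_mono: "u \<le> v \<Longrightarrow> truncated_moment r u \<le> truncated_moment r v"
  unfolding truncated_moment_def
  by (intro integral_mono truncated_moment_integrable) (auto simp: indicator_def)

lemma truncated_moment_le: "u \<ge> 0 \<Longrightarrow> truncated_moment r u \<le> u ^ r"
proof -
  assume u: "u \<ge> 0"
  have "truncated_moment r u \<le> expectation (\<lambda>_. u ^ r)"
    unfolding truncated_moment_def using u
    by (intro integral_mono truncated_moment_integrable) (auto simp: indicator_def intro!: power_mono)
  then show ?thesis by (simp add: prob_space)
qed

lemma truncated_moment_double:
  assumes "u \<ge> 0"
  shows "truncated_moment r (2 * u) \<le> truncated_moment r u + (2 * u) ^ r * tail_prob u"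
proof -
  have "truncated_moment r (2 * u) \<le> expectation (\<lambda>w. \<bar>X w\<bar> ^ r * indicator {..u} \<bar>X w\<bar>
      + (2 * u) ^ r * indicator {w \<in> space M. \<bar>X w\<bar> > u} w)"
    unfolding truncated_moment_def using assms power_mono[of "\<bar>X _\<bar>" "2 * u" r]
    by (intro integral_mono truncated_moment_integrable Bochner_Integration.integrable_add
          integrable_mult_right integrable_real_indicator)
       (auto simp: indicator_def emeasure_eq_measure)
  also have "\<dots> = truncated_moment r u + (2 * u) ^ r * tail_prob u"
    unfolding truncated_moment_def tail_prob_def
    by (subst Bochner_Integration.integral_add)
       (auto intro!: truncated_moment_integrable integrable_mult_right integrable_real_indicator
         simp: emeasure_eq_measure)
  finally show ?thesis .
qed

lemma dyadic_induct:
  fixes u0 w :: real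
  assumes u0: "u0 > 0" and w: "w \<ge> u0"
    and base: "\<And>v. u0 \<le> v \<Longrightarrow> v \<le> 2 * u0 \<Longrightarrow> Q 0 v"
    and step: "\<And>j v. u0 \<le> v \<Longrightarrow> Q j v \<Longrightarrow> Q (Suc j) (2 * v)"
  obtains j where "w < 2 ^ Suc j * u0" "Q j w"
proof -
  have "\<exists>j. v < 2 ^ Suc j * u0 \<and> Q j v" if "v \<ge> u0" "v < 2 ^ Suc k * u0" for v k
    using that
  proof (induction k arbitrary: v)
    case 0
    then show ?case using base[of v] by (intro exI[of _ 0]) auto
  next
    case (Suc k)
    show ?case
    proof (cases "v \<le> 2 * u0")
      case True
      with Suc.prems show ?thesis using base[of v] step[of u0 0] base[of u0] u0
        by (cases "v = 2 * u0") (auto intro: exI[of _ 0] exI[of _ 1])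
    next
      case False
      then obtain j where "v / 2 < 2 ^ Suc j * u0" "Q j (v / 2)"
        using Suc.IH[of "v / 2"] Suc.prems by auto
      then show ?thesis using step[of "v / 2" j] False by (intro exI[of _ "Suc j"]) auto
    qed
  qed
  moreover obtain k where "w / u0 < 2 ^ k" using real_arch_pow[of 2 "w / u0"] by auto
  then have "w < 2 ^ k * u0" using u0 by (simp add: field_simps)
  then have "w < 2 ^ Suc k * u0" using w u0 by simp
  ultimately show thesis using w that by blast
qed

text \<open>
  A form of Karamata's theorem. Let \<open>H u = u\<^sup>2 P(|X| > u)\<close>. Passing from \<open>u\<close> to \<open>2 u\<close> increases the truncated
  second moment by at most \<open>4 H u\<close>, but multiplies \<open>H\<close> by at least \<open>4 / K > 1\<close>; so a bound by \<open>C H\<close>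
  with \<open>(C + 4) K \<le> 4 C\<close> propagates along dyadic scales.
\<close>

lemma truncated_second_moment_bound:
  obtains C where "\<forall>\<^sub>F u in at_top. truncated_moment 2 u \<le> C * (u\<^sup>2 * tail_prob u)"
proof -
  obtain K u0 where K: "1 < K" "K < 4" "u0 > 0" "\<And>u. u \<ge> u0 \<Longrightarrow> tail_prob u \<le> K * tail_prob (2 * u)"
    using tail_prob_doubling by blast
  \<comment> \<open>The first term starts the induction on \<open>[u0, 2 u0]\<close>, the second one carries it on.\<close>
  define C where "C = max (4 / tail_prob (2 * u0)) (4 * K / (4 - K))"
  have "C \<ge> 4 * K / (4 - K)" by (simp add: C_def)
  then have CK: "(C + 4) * K \<le> 4 * C" using K by (simp add: field_simps)
  have C0: "C \<ge> 0" using tail_prob_pos[of "2 * u0"] by (simp add: C_def le_max_iff_disj)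
  have C1: "4 \<le> C * tail_prob (2 * u0)"
    using tail_prob_pos[of "2 * u0"] by (simp add: C_def max_mult_distrib_right le_max_iff_disj)
  let ?Q = "\<lambda>v. truncated_moment 2 v \<le> C * (v\<^sup>2 * tail_prob v)"
  have base: "?Q v" if "u0 \<le> v" "v \<le> 2 * u0" for v
  proof -
    have "truncated_moment 2 v \<le> v\<^sup>2" using that K by (intro truncated_moment_le) auto
    also have "\<dots> \<le> v\<^sup>2 * (C * tail_prob (2 * u0))" using C1 by (simp add: mult_le_cancel_left1)
    also have "\<dots> \<le> v\<^sup>2 * (C * tail_prob v)"
      using that C0 by (intro mult_left_mono tail_prob_antimono) auto
    finally show ?thesis by (simp add: mult_ac)
  qed
  have step: "?Q (2 * v)" if "u0 \<le> v" "?Q v" for v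
  proof -
    have "truncated_moment 2 (2 * v) \<le> truncated_moment 2 v + (2 * v)\<^sup>2 * tail_prob v"
      using that K(3) by (intro truncated_moment_double) auto
    also have "\<dots> \<le> (C + 4) * (v\<^sup>2 * tail_prob v)" using that(2) by (simp add: algebra_simps)
    also have "\<dots> \<le> (C + 4) * (v\<^sup>2 * (K * tail_prob (2 * v)))"
      using C0 K(4)[OF that(1)] by (intro mult_left_mono) auto
    also have "\<dots> = ((C + 4) * K) * (v\<^sup>2 * tail_prob (2 * v))" by (simp add: mult_ac)
    also have "\<dots> \<le> (4 * C) * (v\<^sup>2 * tail_prob (2 * v))"
      using CK by (intro mult_right_mono) (auto simp: tail_prob_nonneg)
    also have "\<dots> = C * ((2 * v)\<^sup>2 * tail_prob (2 * v))" by (simp add: power_mult_distrib)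
    finally show ?thesis .
  qed
  show thesis
  proof (rule that[of C], unfold eventually_at_top_linorder, intro exI[of _ u0] allI impI)
    fix w assume "w \<ge> u0"
    then show "?Q w" using dyadic_induct[OF K(3), of w "\<lambda>_. ?Q"] base step by blast
  qed
qed

lemma squared_tail_at_top: "filterlim (\<lambda>u. u\<^sup>2 * tail_prob u) at_top at_top"
proof -
  obtain K u0 where K: "1 < K" "K < 4" "u0 > 0" "\<And>u. u \<ge> u0 \<Longrightarrow> tail_prob u \<le> K * tail_prob (2 * u)"
    using tail_prob_doubling by blast
  define h where "h = u0\<^sup>2 * tail_prob (2 * u0)"
  have h: "h > 0" using K tail_prob_pos[of "2 * u0"] by (simp add: h_def)
  let ?Q = "\<lambda>j v. (4 / K) ^ j * h \<le> v\<^sup>2 * tail_prob v"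
  have base: "?Q 0 v" if "u0 \<le> v" "v \<le> 2 * u0" for v
    using that K by (auto simp: h_def intro!: mult_mono tail_prob_antimono power_mono tail_prob_nonneg)
  have step: "?Q (Suc j) (2 * v)" if "u0 \<le> v" "?Q j v" for j v
  proof -
    have "(4 / K) ^ Suc j * h \<le> 4 / K * (v\<^sup>2 * tail_prob v)"
      using that(2) K by (simp add: mult.assoc mult_left_mono divide_right_mono)
    also have "\<dots> \<le> 4 / K * (v\<^sup>2 * (K * tail_prob (2 * v)))"
      using K(4)[OF that(1)] K by (intro mult_left_mono) auto
    also have "\<dots> = (2 * v)\<^sup>2 * tail_prob (2 * v)" using K by (simp add: power_mult_distrib)
    finally show ?thesis .
  qed
  show ?thesis unfolding filterlim_at_top
  proof
    fix z :: real
    have K4: "4 / K > 1" using K by simp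
    obtain J where J: "z / h < (4 / K) ^ J" using real_arch_pow[OF K4] by blast
    show "\<forall>\<^sub>F u in at_top. z \<le> u\<^sup>2 * tail_prob u"
      unfolding eventually_at_top_linorder
    proof (intro exI[of _ "2 ^ J * u0"] allI impI)
      fix w assume w: "2 ^ J * u0 \<le> w"
      have "1 * u0 \<le> 2 ^ J * u0" using K(3) by (intro mult_right_mono) auto
      then have "u0 \<le> w" using w by simp
      then obtain j where j: "w < 2 ^ Suc j * u0" "?Q j w"
        using dyadic_induct[OF K(3), of w ?Q] base step by blast
      have "2 ^ J * u0 < 2 ^ Suc j * u0" using w j(1) by linarith
      then have "(2::real) ^ J < 2 ^ Suc j" using K(3) by simp
      then have "J \<le> j" using power_less_imp_less_exp[of "2::real" J "Suc j"] by simp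
      then have "(4 / K) ^ J \<le> (4 / K) ^ j" using K4 by (intro power_increasing) auto
      then have "(4 / K) ^ J * h \<le> (4 / K) ^ j * h" using h by (intro mult_right_mono) auto
      moreover have "z < (4 / K) ^ J * h" using J h by (simp only: pos_divide_less_eq)
      ultimately show "z \<le> w\<^sup>2 * tail_prob w" using j(2) by linarith
    qed
  qed
qed

lemma norming_square_dominates: "(\<lambda>n. real n / (a n)\<^sup>2) \<longlonglongrightarrow> 0"
proof -
  have "filterlim (\<lambda>n. (a n)\<^sup>2 * tail_prob (a n)) at_top sequentially"
    by (rule filterlim_compose[OF squared_tail_at_top norming_at_top])
  then have "(\<lambda>n. inverse ((a n)\<^sup>2 * tail_prob (a n))) \<longlonglongrightarrow> 0"
    by (rule tendsto_inverse_0_at_top)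
  from tendsto_mult[OF tail_prob_limit[of 1] this]
  have "(\<lambda>n. real n * tail_prob (a n * 1) * inverse ((a n)\<^sup>2 * tail_prob (a n))) \<longlonglongrightarrow> 0" by simp
  moreover have "real n * tail_prob (a n * 1) * inverse ((a n)\<^sup>2 * tail_prob (a n)) = real n / (a n)\<^sup>2" for n
    using tail_prob_pos[of "a n"] by (simp add: field_simps)
  ultimately show ?thesis by simp
qed

lemma truncated_second_moment_norming:
  assumes K: "K > 0"
  obtains C where "C > 0" "\<forall>\<^sub>F n in sequentially. real n * truncated_moment 2 (K * a n) / (a n)\<^sup>2 \<le> C"
proof -
  obtain C where C: "\<forall>\<^sub>F u in at_top. truncated_moment 2 u \<le> C * (u\<^sup>2 * tail_prob u)"
    by (rule truncated_second_moment_bound)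
  have "filterlim (\<lambda>n. K * a n) at_top sequentially"
    by (rule filterlim_tendsto_pos_mult_at_top[OF tendsto_const K norming_at_top])
  from eventually_compose_filterlim[OF C this]
  have 1: "\<forall>\<^sub>F n in sequentially. truncated_moment 2 (K * a n) \<le> C * ((K * a n)\<^sup>2 * tail_prob (K * a n))" .
  have 2: "\<forall>\<^sub>F n in sequentially. real n * tail_prob (a n * K) < K powr (-\<alpha>) + 1"
    by (rule order_tendstoD(2)[OF tail_prob_limit[OF K]]) simp
  have "\<forall>\<^sub>F n in sequentially. real n * truncated_moment 2 (K * a n) / (a n)\<^sup>2 \<le> \<bar>C\<bar> * K\<^sup>2 * (K powr (-\<alpha>) + 1) + 1"
    using 1 2 eventually_ge_at_top[of 1]
  proof eventually_elim
    case (elim n)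
    have an: "a n > 0" using a_pos elim by simp
    have "real n * truncated_moment 2 (K * a n) \<le> real n * (\<bar>C\<bar> * ((K * a n)\<^sup>2 * tail_prob (K * a n)))"
      using elim(1) by (intro mult_left_mono order_trans[OF elim(1)] mult_right_mono) (auto simp: tail_prob_nonneg)
    also have "\<dots> = (\<bar>C\<bar> * K\<^sup>2 * (real n * tail_prob (a n * K))) * (a n)\<^sup>2"
      by (simp add: power_mult_distrib mult_ac)
    also have "\<dots> \<le> (\<bar>C\<bar> * K\<^sup>2 * (K powr (-\<alpha>) + 1) + 1) * (a n)\<^sup>2"
      using elim(2) by (intro mult_right_mono order_trans[OF mult_left_mono[OF less_imp_le[OF elim(2)]]]) auto
    finally show ?case using an by (simp add: divide_le_eq)
  qed
  then show thesis by (rule that[rotated]) (intro add_nonneg_pos mult_nonneg_nonneg, auto)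
qed

text \<open>
  Separates the values of \<open>|X|\<close> up to \<open>s\<close> from the others, for which \<open>2 |X| \<le> c X\<^sup>2 + 1 / c\<close>.
\<close>

lemma truncated_first_moment_split:
  assumes "c > 0" "s \<ge> 0"
  shows "truncated_moment 1 u \<le> s + c / 2 * truncated_moment 2 u + tail_prob s / (2 * c)"
proof -
  have pt: "\<bar>X w\<bar> ^ 1 * indicator {..u} \<bar>X w\<bar> \<le> s + c / 2 * (\<bar>X w\<bar> ^ 2 * indicator {..u} \<bar>X w\<bar>)
      + 1 / (2 * c) * indicator {w \<in> space M. \<bar>X w\<bar> > s} w" if "w \<in> space M" for w
  proof (cases "\<bar>X w\<bar> \<le> s")
    case True
    then have "\<bar>X w\<bar> \<le> s + c * (X w)\<^sup>2 / 2" using assms by (intro add_increasing2) auto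
    then show ?thesis using True assms by (auto simp: indicator_def)
  next
    case False
    have "0 \<le> (c * \<bar>X w\<bar> - 1)\<^sup>2 / (2 * c)" using assms by simp
    also have "\<dots> = c / 2 * \<bar>X w\<bar>\<^sup>2 + 1 / (2 * c) - \<bar>X w\<bar>"
      using assms by (simp add: field_simps power2_eq_square)
    finally show ?thesis using False that assms by (auto simp: indicator_def)
  qed
  have "truncated_moment 1 u \<le> expectation (\<lambda>w. s + c / 2 * (\<bar>X w\<bar> ^ 2 * indicator {..u} \<bar>X w\<bar>)
      + 1 / (2 * c) * indicator {w \<in> space M. \<bar>X w\<bar> > s} w)"
    unfolding truncated_moment_def using pt
    by (intro integral_mono truncated_moment_integrable Bochner_Integration.integrable_add
          integrable_mult_right integrable_real_indicator integrable_const)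
       (auto simp: emeasure_eq_measure)
  also have "\<dots> = s + c / 2 * truncated_moment 2 u + tail_prob s / (2 * c)"
    unfolding truncated_moment_def tail_prob_def
    using truncated_moment_integrable[of 2 u]
    by (subst Bochner_Integration.integral_add Bochner_Integration.integral_add)
       (auto intro!: integrable_real_indicator simp: emeasure_eq_measure prob_space)
  finally show ?thesis .
qed

text \<open>
  With \<open>r = \<surd>n / a n\<close> and \<open>c = l r\<close>, the three terms of \<open>truncated_first_moment_split\<close>, multiplied by \<open>r\<close>, are
  \<open>r s\<close>, at most \<open>l C / 2\<close>, and \<open>P(|X| > s) / (2 l)\<close>. Choose first \<open>l\<close> small, then \<open>s\<close> large, then \<open>n\<close> large.
\<close>

lemma truncated_first_moment_norming:
  assumes K: "K > 0"
  shows "(\<lambda>n. real n * (truncated_moment 1 (K * a n))\<^sup>2 / (a n)\<^sup>2) \<longlonglongrightarrow> 0"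
proof -
  obtain C where C: "C > 0" "\<forall>\<^sub>F n in sequentially. real n * truncated_moment 2 (K * a n) / (a n)\<^sup>2 \<le> C"
    by (rule truncated_second_moment_norming[OF K])
  let ?B = "\<lambda>n. truncated_moment 1 (K * a n)"
  have "(\<lambda>n. sqrt (real n) / a n * ?B n) \<longlonglongrightarrow> 0"
  proof (rule tendstoI)
    fix e :: real assume e: "e > 0"
    define l where "l = e / (2 * C)"
    have l: "l > 0" "l * C / 2 = e / 4" using e C by (auto simp: l_def)
    have "\<forall>\<^sub>F s in at_top. tail_prob s < l * e"
      using l e by (intro order_tendstoD(2)[OF tail_prob_at_top]) simp
    then have "\<forall>\<^sub>F s in at_top. tail_prob s < l * e \<and> s \<ge> 0"
      using eventually_ge_at_top by (rule eventually_conj)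
    then obtain s where s: "tail_prob s < l * e" "s \<ge> 0" using eventually_happens'[OF trivial_limit_at_top_linorder] by blast
    have "(\<lambda>n. sqrt (real n / (a n)\<^sup>2) * s) \<longlonglongrightarrow> sqrt 0 * s"
      by (intro tendsto_intros norming_square_dominates)
    then have 3: "\<forall>\<^sub>F n in sequentially. sqrt (real n / (a n)\<^sup>2) * s < e / 4"
      by (rule order_tendstoD(2)) (use e in simp)
    show "\<forall>\<^sub>F n in sequentially. dist (sqrt (real n) / a n * ?B n) 0 < e"
      using C(2) 3 eventually_ge_at_top[of 1]
    proof eventually_elim
      case (elim n)
      define r where "r = sqrt (real n) / a n"
      have an: "a n > 0" using a_pos elim by simp
      have r: "r > 0" "r\<^sup>2 = real n / (a n)\<^sup>2" "sqrt (real n / (a n)\<^sup>2) = r"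
        using an elim by (auto simp: r_def power_divide real_sqrt_divide)
      have "?B n \<le> s + (l * r) / 2 * truncated_moment 2 (K * a n) + tail_prob s / (2 * (l * r))"
        by (rule truncated_first_moment_split) (use l r s in auto)
      then have "r * ?B n \<le> r * (s + (l * r) / 2 * truncated_moment 2 (K * a n) + tail_prob s / (2 * (l * r)))"
        using r by (intro mult_left_mono) auto
      also have "\<dots> = r * s + l / 2 * (r\<^sup>2 * truncated_moment 2 (K * a n)) + tail_prob s / (2 * l)"
        using r(1) l(1) by (simp add: field_simps power2_eq_square)
      also have "\<dots> < e / 4 + e / 4 + e / 2"
      proof (intro add_le_less_mono add_mono)
        show "r * s \<le> e / 4" using elim(2) r by simp
        have "l / 2 * (r\<^sup>2 * truncated_moment 2 (K * a n)) \<le> l / 2 * C"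
          using elim(1) l by (intro mult_left_mono) (auto simp: r)
        then show "l / 2 * (r\<^sup>2 * truncated_moment 2 (K * a n)) \<le> e / 4" using l by simp
        show "tail_prob s / (2 * l) < e / 2" using s l by (simp add: field_simps)
      qed
      finally have "r * ?B n < e" by simp
      moreover have "r * ?B n \<ge> 0" using r truncated_moment_nonneg by simp
      ultimately show ?case by (simp add: r_def)
    qed
  qed
  from tendsto_power[OF this, of 2] show ?thesis
    by (simp add: power_mult_distrib power_divide)
qed

end

section \<open>Tails of the row sums of squares\<close>

locale heavy_tailed_array = prob_space M for M :: "'a measure" +
  fixes Z :: "nat \<Rightarrow> nat \<Rightarrow> 'a \<Rightarrow> real" and a :: "nat \<Rightarrow> real" and \<alpha> :: real and p :: "nat \<Rightarrow> nat"
  assumes indep: "indep_vars (\<lambda>_. borel) (\<lambda>(i, t). Z i t) UNIV"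
    and ident: "\<And>i t. distr M borel (Z i t) = distr M borel (Z 0 0)"
    and alpha: "0 < \<alpha>" "\<alpha> < 2"
    and a_pos: "\<And>n. n \<ge> 1 \<Longrightarrow> a n > 0"
    and tail: "\<And>x::real. x > 0 \<Longrightarrow>
      (\<lambda>n. real n * measure M {w \<in> space M. \<bar>Z 0 0 w\<bar> > a n * x}) \<longlonglongrightarrow> x powr (-\<alpha>)"
    and p_pos: "\<And>n. n \<ge> 1 \<Longrightarrow> p n \<ge> 1"
    and p_lim: "filterlim p at_top sequentially"
begin

lemma Z_measurable [measurable]: "Z i t \<in> borel_measurable M"
proof -
  have "\<forall>q\<in>UNIV. (\<lambda>(i, t). Z i t) q \<in> borel_measurable M"
    using indep unfolding indep_vars_def by blast
  from bspec[OF this, of "(i, t)"] show ?thesis by simp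
qed

sublocale regularly_varying_variable M "Z 0 0" a \<alpha>
  by unfold_locales (use alpha a_pos tail in auto)

abbreviation norming :: "nat \<Rightarrow> real" where "norming n \<equiv> a (n * p n)"

abbreviation scale :: "nat \<Rightarrow> real" where "scale n \<equiv> (norming n)\<^sup>2"

lemma norming_pos: "n \<ge> 1 \<Longrightarrow> norming n > 0"
  using p_pos[of n] by (intro a_pos) auto

lemma p_real_at_top: "filterlim (\<lambda>n. real (p n)) at_top sequentially"
  by (rule filterlim_compose[OF filterlim_real_sequentially p_lim])

lemma entries_at_top: "filterlim (\<lambda>n. n * p n) at_top sequentially"
proof (rule filterlim_at_top_mono[OF p_lim])
  show "\<forall>\<^sub>F n in sequentially. p n \<le> n * p n"
    using eventually_ge_at_top[of 1] by eventually_elim auto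
qed

lemmas entries_compose = filterlim_compose[OF _ entries_at_top]

lemma entry_tail_limit: "x > 0 \<Longrightarrow> (\<lambda>n. real (n * p n) * tail_prob (norming n * x)) \<longlonglongrightarrow> x powr (-\<alpha>)"
  by (rule entries_compose[OF tail_prob_limit])

lemma entry_expectation:
  fixes h :: "real \<Rightarrow> real"
  assumes [measurable]: "h \<in> borel_measurable borel"
  shows "expectation (\<lambda>w. h (Z i t w)) = expectation (\<lambda>w. h (Z 0 0 w))"
proof -
  have "expectation (\<lambda>w. h (Z i t w)) = integral\<^sup>L (distr M borel (Z i t)) h"
    by (simp add: integral_distr)
  also have "\<dots> = expectation (\<lambda>w. h (Z 0 0 w))" unfolding ident[of i t]
    by (simp add: integral_distr)
  finally show ?thesis .
qed

lemma entry_integrable: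
  fixes h :: "real \<Rightarrow> real"
  assumes [measurable]: "h \<in> borel_measurable borel" and "\<And>x. \<bar>h x\<bar> \<le> B"
  shows "integrable M (\<lambda>w. h (Z i t w))"
  using assms(2) by (intro integrable_const_bound[where B = B]) auto

lemma expectation_prod_entries:
  fixes h :: "real \<Rightarrow> real"
  assumes Q: "finite Q" and h[measurable]: "h \<in> borel_measurable borel" and B: "\<And>x. \<bar>h x\<bar> \<le> B"
  shows "expectation (\<lambda>w. \<Prod>(i,t)\<in>Q. h (Z i t w)) = (expectation (\<lambda>w. h (Z 0 0 w))) ^ card Q"
proof -
  have "indep_vars (\<lambda>_. borel) (\<lambda>(i, t). Z i t) Q" using indep by (rule indep_vars_subset) simp
  then have ind: "indep_vars (\<lambda>_. borel) (\<lambda>q w. h ((case q of (i, t) \<Rightarrow> Z i t) w)) Q"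
    by (rule indep_vars_compose2) simp
  have int: "integrable M (\<lambda>w. h ((case q of (i, t) \<Rightarrow> Z i t) w))" for q
    using entry_integrable[of h B "fst q" "snd q"] B by (cases q) auto
  have "expectation (\<lambda>w. \<Prod>(i,t)\<in>Q. h (Z i t w)) = expectation (\<lambda>w. \<Prod>q\<in>Q. h ((case q of (i, t) \<Rightarrow> Z i t) w))"
    by (simp add: split_def)
  also have "\<dots> = (\<Prod>q\<in>Q. expectation (\<lambda>w. h ((case q of (i, t) \<Rightarrow> Z i t) w)))"
    by (rule indep_vars_lebesgue_integral[OF Q ind int])
  also have "\<dots> = (\<Prod>q\<in>Q. expectation (\<lambda>w. h (Z 0 0 w)))"
    by (intro prod.cong refl) (auto simp: split_def intro!: entry_expectation)
  finally show ?thesis by simp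
qed

text \<open>
  Used for row sums, where the \<open>U t\<close> are truncated squares, and for off-diagonal entries, where they
  are products of two truncated entries.
\<close>

lemma second_moment_sum_le:
  fixes U :: "nat \<Rightarrow> 'a \<Rightarrow> real"
  assumes int: "\<And>s t. s < n \<Longrightarrow> t < n \<Longrightarrow> integrable M (\<lambda>w. U s w * U t w)"
    and diag: "\<And>t. t < n \<Longrightarrow> expectation (\<lambda>w. U t w * U t w) = d"
    and off: "\<And>s t. s < n \<Longrightarrow> t < n \<Longrightarrow> s \<noteq> t \<Longrightarrow> expectation (\<lambda>w. U s w * U t w) = e"
    and e: "0 \<le> e"
  shows "integrable M (\<lambda>w. (\<Sum>t<n. U t w)\<^sup>2)"
    and "expectation (\<lambda>w. (\<Sum>t<n. U t w)\<^sup>2) \<le> real n * d + (real n)\<^sup>2 * e"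
proof -
  have eq: "(\<lambda>w. (\<Sum>t<n. U t w)\<^sup>2) = (\<lambda>w. \<Sum>s<n. \<Sum>t<n. U s w * U t w)"
    by (simp add: power2_eq_square sum_product)
  show "integrable M (\<lambda>w. (\<Sum>t<n. U t w)\<^sup>2)" unfolding eq
    by (intro Bochner_Integration.integrable_sum int) auto
  have "expectation (\<lambda>w. (\<Sum>t<n. U t w)\<^sup>2) = (\<Sum>s<n. expectation (\<lambda>w. \<Sum>t<n. U s w * U t w))"
    unfolding eq by (intro Bochner_Integration.integral_sum Bochner_Integration.integrable_sum int) auto
  also have "\<dots> = (\<Sum>s<n. \<Sum>t<n. expectation (\<lambda>w. U s w * U t w))"
    by (intro sum.cong refl Bochner_Integration.integral_sum int) auto
  also have "\<dots> \<le> (\<Sum>s<n. \<Sum>t<n. (if t = s then d else 0) + e)"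
    using diag off e by (intro sum_mono) auto
  also have "\<dots> = real n * d + (real n)\<^sup>2 * e"
    by (simp add: sum.distrib power2_eq_square algebra_simps)
  finally show "expectation (\<lambda>w. (\<Sum>t<n. U t w)\<^sup>2) \<le> real n * d + (real n)\<^sup>2 * e" .
qed

definition truncate :: "real \<Rightarrow> real \<Rightarrow> real" where
  "truncate u z = z * indicator {..u} \<bar>z\<bar>"

lemma truncate_measurable [measurable]: "truncate u \<in> borel_measurable borel"
  unfolding truncate_def by measurable

lemma truncate_bound: "\<bar>truncate u z\<bar> \<le> \<bar>u\<bar>"
  by (auto simp: truncate_def indicator_def)

lemma truncate_power_bound: "\<bar>truncate u z ^ r\<bar> \<le> \<bar>u\<bar> ^ r"
  unfolding power_abs by (intro power_mono truncate_bound) auto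

lemma expectation_truncate_square: "expectation (\<lambda>w. (truncate u (Z 0 0 w))\<^sup>2) = truncated_moment 2 u"
  unfolding truncated_moment_def
  by (intro Bochner_Integration.integral_cong refl) (auto simp: truncate_def indicator_def)

lemma expectation_truncate_fourth:
  "expectation (\<lambda>w. (truncate u (Z 0 0 w)) ^ 4) \<le> u\<^sup>2 * truncated_moment 2 u"
proof -
  have "expectation (\<lambda>w. (truncate u (Z 0 0 w)) ^ 4) \<le> expectation (\<lambda>w. u\<^sup>2 * (truncate u (Z 0 0 w))\<^sup>2)"
  proof (intro integral_mono integrable_mult_right)
    show "integrable M (\<lambda>w. truncate u (Z 0 0 w) ^ 4)"
      using truncate_power_bound[of u _ 4] by (intro entry_integrable[of "\<lambda>z. truncate u z ^ 4"]) auto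
    show "integrable M (\<lambda>w. (truncate u (Z 0 0 w))\<^sup>2)"
      using truncate_power_bound[of u _ 2] by (intro entry_integrable[of "\<lambda>z. (truncate u z)\<^sup>2"]) auto
    fix w
    let ?y = "truncate u (Z 0 0 w)"
    have "?y\<^sup>2 * ?y\<^sup>2 \<le> u\<^sup>2 * ?y\<^sup>2"
      using truncate_power_bound[of u "Z 0 0 w" 2] by (intro mult_right_mono) auto
    then show "?y ^ 4 \<le> u\<^sup>2 * ?y\<^sup>2" by (simp add: power2_eq_square power4_eq_xxxx mult_ac)
  qed
  also have "\<dots> = u\<^sup>2 * truncated_moment 2 u" by (simp add: expectation_truncate_square)
  finally show ?thesis .
qed

lemma expectation_truncate_abs: "\<bar>expectation (\<lambda>w. truncate u (Z 0 0 w))\<bar> \<le> truncated_moment 1 u"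
proof -
  have "\<bar>expectation (\<lambda>w. truncate u (Z 0 0 w))\<bar> \<le> expectation (\<lambda>w. \<bar>truncate u (Z 0 0 w)\<bar>)"
    by (rule integral_abs_bound)
  also have "\<dots> = truncated_moment 1 u" unfolding truncated_moment_def
    by (intro Bochner_Integration.integral_cong refl) (auto simp: truncate_def indicator_def)
  finally show ?thesis .
qed

definition row_sum :: "nat \<Rightarrow> nat \<Rightarrow> 'a \<Rightarrow> real" where
  "row_sum n i w = (\<Sum>t<n. (Z i t w)\<^sup>2)"

lemma row_sum_measurable [measurable]: "row_sum n i \<in> borel_measurable M"
  unfolding row_sum_def by measurable

lemma prob_entries_in:
  assumes Q: "finite Q" and B: "B \<in> sets borel"
  shows "\<P>(w in M. \<forall>(i,t)\<in>Q. Z i t w \<in> B) = (\<P>(w in M. Z 0 0 w \<in> B)) ^ card Q"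
proof -
  have "\<P>(w in M. \<forall>(i,t)\<in>Q. Z i t w \<in> B)
      = expectation (indicator {w \<in> space M. \<forall>(i,t)\<in>Q. Z i t w \<in> B})"
    by (auto intro!: arg_cong[where f = prob])
  also have "\<dots> = expectation (\<lambda>w. \<Prod>(i,t)\<in>Q. indicator B (Z i t w))"
    using Q by (intro Bochner_Integration.integral_cong refl)
      (auto simp: indicator_def prod_zero_iff split_def intro!: prod.neutral)
  also have "\<dots> = (expectation (\<lambda>w. indicator B (Z 0 0 w))) ^ card Q"
    using B by (intro expectation_prod_entries[OF Q, where B = 1]) (auto simp: indicator_def)
  also have "expectation (\<lambda>w. indicator B (Z 0 0 w)) = expectation (indicator {w \<in> space M. Z 0 0 w \<in> B})"
    by (intro Bochner_Integration.integral_cong refl) (auto simp: indicator_def)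
  finally show ?thesis by (simp add: Int_absorb2 subset_iff)
qed

lemma prob_entry_greater: "\<P>(w in M. \<bar>Z i t w\<bar> > u) = tail_prob u"
  using prob_entries_in[of "{(i,t)}" "{z. \<bar>z\<bar> > u}"] by (simp add: tail_prob_def)

lemma prob_two_entries_greater:
  assumes "s \<noteq> t"
  shows "\<P>(w in M. \<bar>Z i s w\<bar> > u \<and> \<bar>Z i t w\<bar> > u) = (tail_prob u)\<^sup>2"
proof -
  have "card {(i,s),(i,t)} = 2" using assms by simp
  then show ?thesis
    using prob_entries_in[of "{(i,s),(i,t)}" "{z. \<bar>z\<bar> > u}"] by (simp add: tail_prob_def)
qed

lemma prob_row_entries_le:
  "\<P>(w in M. \<forall>t<n. \<bar>Z i t w\<bar> \<le> u) = (1 - tail_prob u) ^ n"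
proof -
  have "1 - tail_prob u = prob (space M - {w \<in> space M. \<bar>Z 0 0 w\<bar> > u})"
    by (simp add: tail_prob_def prob_compl)
  also have "space M - {w \<in> space M. \<bar>Z 0 0 w\<bar> > u} = {w \<in> space M. \<bar>Z 0 0 w\<bar> \<le> u}" by auto
  finally have "(1 - tail_prob u) ^ n = \<P>(w in M. \<forall>(i,t)\<in>Pair i ` {..<n}. Z i t w \<in> {z. \<bar>z\<bar> \<le> u})"
    using prob_entries_in[of "Pair i ` {..<n}" "{z. \<bar>z\<bar> \<le> u}"] by (simp add: card_image inj_on_def)
  then show ?thesis by (auto intro!: arg_cong[where f = prob])
qed

text \<open>
  If the sum exceeds \<open>u\<^sup>2 + d\<close>, then some entry exceeds \<open>u\<close>, or two entries exceed \<open>v\<close>, or the squares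
  of the entries up to \<open>v\<close> add up to more than \<open>d\<close>. The three terms bound these events, the last one
  by Markov's inequality for the second moment.
\<close>

lemma row_sum_tail_upper:
  assumes u: "u > 0" and v: "v > 0" and d: "d > 0"
  shows "\<P>(w in M. row_sum n i w > u\<^sup>2 + d) \<le> real n * tail_prob u + (real n * tail_prob v)\<^sup>2
    + (real n * (v\<^sup>2 * truncated_moment 2 v) + (real n * truncated_moment 2 v)\<^sup>2) / d\<^sup>2"
proof -
  define W where "W t w = (truncate v (Z i t w))\<^sup>2" for t w
  have [measurable]: "W t \<in> borel_measurable M" for t unfolding W_def by measurable
  let ?E1 = "\<Union>t<n. {w \<in> space M. \<bar>Z i t w\<bar> > u}"
  let ?P = "{(s, t). s < n \<and> t < n \<and> s \<noteq> t}"
  let ?E2 = "\<Union>(s,t)\<in>?P. {w \<in> space M. \<bar>Z i s w\<bar> > v \<and> \<bar>Z i t w\<bar> > v}"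
  let ?E3 = "{w \<in> space M. (\<Sum>t<n. W t w)\<^sup>2 \<ge> d\<^sup>2}"
  have finP: "finite ?P" by (rule finite_subset[of _ "{..<n} \<times> {..<n}"]) auto
  have "?E1 \<in> events" by (intro sets.finite_UN) auto
  moreover have "?E2 \<in> events" using finP by (intro sets.finite_UN) auto
  moreover have "?E3 \<in> events" by measurable
  ultimately have ev: "?E1 \<in> events" "?E2 \<in> events" "?E3 \<in> events" .
  have sub: "{w \<in> space M. row_sum n i w > u\<^sup>2 + d} \<subseteq> ?E1 \<union> ?E2 \<union> ?E3"
  proof (rule subsetI, rule ccontr)
    fix w assume mem: "w \<in> {w \<in> space M. row_sum n i w > u\<^sup>2 + d}" and no: "w \<notin> ?E1 \<union> ?E2 \<union> ?E3"
    from mem have w: "w \<in> space M" "row_sum n i w > u\<^sup>2 + d" by simp_all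
    have 1: "\<bar>Z i t w\<bar> \<le> u" if "t < n" for t using no w(1) that by (auto simp: not_less)
    have 2: "s = t" if "s < n" "t < n" "\<bar>Z i s w\<bar> > v" "\<bar>Z i t w\<bar> > v" for s t
      using no w(1) that by auto
    have "(\<Sum>t<n. W t w)\<^sup>2 < d\<^sup>2" using no w(1) by (auto simp: not_le)
    then have 3: "(\<Sum>t<n. W t w) < d" using d by (auto dest: power2_less_imp_less)
    have W: "W t w = (if \<bar>Z i t w\<bar> > v then 0 else (Z i t w)\<^sup>2)" for t
      by (auto simp: W_def truncate_def indicator_def)
    have "row_sum n i w \<le> u\<^sup>2 + (\<Sum>t<n. W t w)"
    proof (cases "\<exists>t0<n. \<bar>Z i t0 w\<bar> > v")
      case True
      then obtain t0 where t0: "t0 < n" "\<bar>Z i t0 w\<bar> > v" by blast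
      have "(Z i t w)\<^sup>2 = W t w + (if t = t0 then (Z i t0 w)\<^sup>2 else 0)" if "t < n" for t
      proof (cases "t = t0")
        case True
        then show ?thesis using t0 by (simp add: W)
      next
        case False
        then have "\<not> \<bar>Z i t w\<bar> > v" using 2[OF that t0(1) _ t0(2)] by blast
        then show ?thesis using False by (simp add: W)
      qed
      then have "row_sum n i w = (\<Sum>t<n. W t w + (if t = t0 then (Z i t0 w)\<^sup>2 else 0))"
        unfolding row_sum_def by (intro sum.cong refl) blast
      also have "\<dots> = (\<Sum>t<n. W t w) + (Z i t0 w)\<^sup>2"
        using t0(1) by (simp add: sum.distrib)
      finally have "row_sum n i w = (\<Sum>t<n. W t w) + (Z i t0 w)\<^sup>2" .
      moreover have "(Z i t0 w)\<^sup>2 \<le> u\<^sup>2" using 1[OF t0(1)] u by (simp add: abs_le_square_iff[symmetric])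
      ultimately show ?thesis by simp
    next
      case False
      then have "row_sum n i w = (\<Sum>t<n. W t w)" unfolding row_sum_def by (intro sum.cong) (auto simp: W)
      then show ?thesis by simp
    qed
    then show False using w(2) 3 by simp
  qed
  have p1: "prob ?E1 \<le> real n * tail_prob u"
  proof -
    have "prob ?E1 \<le> (\<Sum>t<n. \<P>(w in M. \<bar>Z i t w\<bar> > u))"
      by (intro finite_measure_subadditive_finite) auto
    then show ?thesis by (simp add: prob_entry_greater)
  qed
  have p2: "prob ?E2 \<le> (real n * tail_prob v)\<^sup>2"
  proof -
    have "prob ?E2 \<le> (\<Sum>(s,t)\<in>?P. \<P>(w in M. \<bar>Z i s w\<bar> > v \<and> \<bar>Z i t w\<bar> > v))"
      using finite_measure_subadditive_finite[OF finP, of "\<lambda>(s,t). {w \<in> space M. \<bar>Z i s w\<bar> > v \<and> \<bar>Z i t w\<bar> > v}"]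
      by (simp add: split_def image_subset_iff)
    also have "\<dots> = (\<Sum>q\<in>?P. (tail_prob v)\<^sup>2)"
      by (intro sum.cong) (auto simp: prob_two_entries_greater)
    also have "\<dots> \<le> (\<Sum>q\<in>{..<n}\<times>{..<n}. (tail_prob v)\<^sup>2)" by (rule sum_mono2) auto
    finally show ?thesis by (simp add: power2_eq_square mult_ac)
  qed
  have WW: "W s w * W t w = (\<Prod>(i,t)\<in>{(i,s),(i,t)}. (truncate v (Z i t w))\<^sup>2)" if "s \<noteq> t" for s t w
    using that by (simp add: W_def)
  have bd: "\<bar>(truncate v z)\<^sup>2\<bar> \<le> \<bar>v\<bar>\<^sup>2" for z using truncate_power_bound[of v z 2] by simp
  have Wint: "integrable M (\<lambda>w. W s w * W t w)" for s t
  proof (rule integrable_const_bound[where B = "\<bar>v\<bar>\<^sup>2 * \<bar>v\<bar>\<^sup>2"], rule AE_I2)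
    fix w show "norm (W s w * W t w) \<le> \<bar>v\<bar>\<^sup>2 * \<bar>v\<bar>\<^sup>2"
      unfolding real_norm_def abs_mult W_def by (intro mult_mono bd) auto
  qed measurable
  have Wd: "expectation (\<lambda>w. W t w * W t w) = expectation (\<lambda>w. (truncate v (Z 0 0 w)) ^ 4)" for t
    using entry_expectation[of "\<lambda>z. truncate v z ^ 4" i t]
    by (simp add: W_def power2_eq_square power4_eq_xxxx mult_ac)
  have Wo: "expectation (\<lambda>w. W s w * W t w) = (truncated_moment 2 v)\<^sup>2" if "s \<noteq> t" for s t
  proof -
    have "expectation (\<lambda>w. W s w * W t w)
        = (expectation (\<lambda>w. (truncate v (Z 0 0 w))\<^sup>2)) ^ card {(i,s),(i,t)}"
      unfolding WW[OF that] by (rule expectation_prod_entries[where h = "\<lambda>z. (truncate v z)\<^sup>2", OF _ _ bd]) auto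
    moreover have "card {(i,s),(i,t)} = 2" using that by simp
    ultimately show ?thesis by (simp only: expectation_truncate_square)
  qed
  note S = second_moment_sum_le[of n W, OF Wint Wd Wo]
  have p3: "prob ?E3 \<le> (real n * (v\<^sup>2 * truncated_moment 2 v) + (real n * truncated_moment 2 v)\<^sup>2) / d\<^sup>2"
  proof -
    have "prob ?E3 \<le> expectation (\<lambda>w. (\<Sum>t<n. W t w)\<^sup>2) / d\<^sup>2"
      using S(1) d by (intro integral_Markov_inequality_measure[where A = "{}"]) auto
    also have "\<dots> \<le> (real n * expectation (\<lambda>w. (truncate v (Z 0 0 w)) ^ 4) + (real n)\<^sup>2 * (truncated_moment 2 v)\<^sup>2) / d\<^sup>2"
      using S(2) d by (intro divide_right_mono) auto
    also have "\<dots> \<le> (real n * (v\<^sup>2 * truncated_moment 2 v) + (real n)\<^sup>2 * (truncated_moment 2 v)\<^sup>2) / d\<^sup>2"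
      by (intro divide_right_mono add_right_mono mult_left_mono expectation_truncate_fourth) auto
    finally show ?thesis by (simp add: power_mult_distrib)
  qed
  have "\<P>(w in M. row_sum n i w > u\<^sup>2 + d) \<le> prob (?E1 \<union> ?E2 \<union> ?E3)"
    using ev sub by (intro finite_measure_mono) auto
  also have "\<dots> \<le> prob (?E1 \<union> ?E2) + prob ?E3" using ev by (intro measure_Un_le) auto
  also have "\<dots> \<le> prob ?E1 + prob ?E2 + prob ?E3"
    using ev by (intro add_right_mono measure_Un_le) auto
  finally show ?thesis using p1 p2 p3 by linarith
qed

lemma one_minus_power_le:
  fixes g :: real
  assumes "0 \<le> g" "g \<le> 1"
  shows "(1 - g) ^ n \<le> 1 - real n * g + (real n * g)\<^sup>2"
proof -
  define x where "x = real n * g"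
  have x: "x \<ge> 0" using assms by (simp add: x_def)
  have "(1 - g) ^ n \<le> exp (-g) ^ n" using assms exp_ge_add_one_self[of "-g"] by (intro power_mono) auto
  also have "\<dots> = exp (-x)" by (simp add: x_def exp_of_nat_mult[symmetric])
  also have "\<dots> \<le> 1 / (1 + x)"
    using exp_ge_add_one_self[of x] x by (simp add: exp_minus inverse_eq_divide frac_le)
  also have "\<dots> \<le> 1 - x + x\<^sup>2"
  proof -
    have "(1 - x + x\<^sup>2) * (1 + x) = 1 + x ^ 3" by (simp add: algebra_simps power2_eq_square power3_eq_cube)
    then show ?thesis using x by (simp add: divide_le_eq)
  qed
  finally show ?thesis by (simp add: x_def)
qed

lemma row_sum_tail_lower:
  assumes u: "u \<ge> 0"
  shows "\<P>(w in M. row_sum n i w > u\<^sup>2) \<ge> real n * tail_prob u - (real n * tail_prob u)\<^sup>2"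
proof -
  have "tail_prob u \<le> 1" by (simp add: tail_prob_def)
  then have "(1 - tail_prob u) ^ n \<le> 1 - real n * tail_prob u + (real n * tail_prob u)\<^sup>2"
    using tail_prob_nonneg by (intro one_minus_power_le)
  then have "real n * tail_prob u - (real n * tail_prob u)\<^sup>2 \<le> 1 - \<P>(w in M. \<forall>t<n. \<bar>Z i t w\<bar> \<le> u)"
    by (simp add: prob_row_entries_le)
  also have "\<dots> = prob (space M - {w \<in> space M. \<forall>t<n. \<bar>Z i t w\<bar> \<le> u})"
    by (subst prob_compl) auto
  also have "\<dots> \<le> \<P>(w in M. row_sum n i w > u\<^sup>2)"
  proof (rule finite_measure_mono)
    show "space M - {w \<in> space M. \<forall>t<n. \<bar>Z i t w\<bar> \<le> u} \<subseteq> {w \<in> space M. row_sum n i w > u\<^sup>2}"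
    proof
      fix w assume "w \<in> space M - {w \<in> space M. \<forall>t<n. \<bar>Z i t w\<bar> \<le> u}"
      then obtain t where t: "w \<in> space M" "t < n" "\<bar>Z i t w\<bar> > u" by (auto simp: not_le)
      have "u\<^sup>2 < \<bar>Z i t w\<bar>\<^sup>2" using t u by (intro power_strict_mono) auto
      also have "\<dots> = (Z i t w)\<^sup>2" by simp
      also have "\<dots> \<le> row_sum n i w" unfolding row_sum_def using t by (intro member_le_sum) auto
      finally show "w \<in> {w \<in> space M. row_sum n i w > u\<^sup>2}" using t by simp
    qed
  qed measurable
  finally show ?thesis .
qed

text \<open>
  The principle of one big jump. In the upper bound take \<open>u = \<surd>z A\<close> with \<open>z\<close> just below \<open>y\<close>,
  \<open>d = (y - z) A\<^sup>2\<close> and \<open>v = \<epsilon> A\<close>. After multiplication by \<open>p\<close>, the first term tends to \<open>z\<^bsup>-\<alpha>/2\<^esup>\<close>, the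
  second one is \<open>O(1/p)\<close>, and the third one is \<open>O(\<epsilon>\<^sup>2) + O(1/p)\<close> because
  \<open>n p V\<close> is \<open>O(A\<^sup>2)\<close>. In the lower bound the quadratic term is \<open>O(1/p)\<close>.
\<close>

lemma row_sum_tail_limit:
  assumes y: "y > 0"
  shows "(\<lambda>n. real (p n) * \<P>(w in M. row_sum n i w > y * scale n)) \<longlonglongrightarrow> y powr (-\<alpha> / 2)"
proof (rule LIMSEQ_I)
  let ?T = "\<lambda>n. real (p n) * \<P>(w in M. row_sum n i w > y * scale n)"
  let ?G = "\<lambda>n x. real (n * p n) * tail_prob (norming n * x)"
  have sq: "sqrt x powr (-\<alpha>) = x powr (-\<alpha> / 2)" if "x > 0" for x
    using that by (simp add: powr_half_sqrt[symmetric] powr_powr)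
  have over_p: "(\<lambda>n. (?G n x)\<^sup>2 / real (p n)) \<longlonglongrightarrow> 0" if "x > 0" for x
    using tendsto_mult[OF tendsto_power[OF entry_tail_limit[OF that], of 2] tendsto_inverse_0_at_top[OF p_real_at_top]]
    by (simp add: divide_inverse)
  fix r :: real assume r: "r > 0"
  obtain C where C: "C > 0" "\<forall>\<^sub>F m in sequentially. real m * truncated_moment 2 (1 * a m) / (a m)\<^sup>2 \<le> C"
    using truncated_second_moment_norming[of 1] by auto
  have C': "\<forall>\<^sub>F n in sequentially. real (n * p n) * truncated_moment 2 (norming n) / scale n \<le> C"
    using eventually_compose_filterlim[OF C(2) entries_at_top] by simp
  have "((\<lambda>z. z powr (-\<alpha> / 2)) \<longlongrightarrow> y powr (-\<alpha> / 2)) (at_left y)"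
    using y by (intro tendsto_intros) auto
  then have "\<forall>\<^sub>F z in at_left y. z powr (-\<alpha> / 2) < y powr (-\<alpha> / 2) + r / 4"
    using r by (intro order_tendstoD(2)) auto
  moreover have "\<forall>\<^sub>F z in at_left y. z \<in> {0<..<y}" by (rule eventually_at_left_real[OF y])
  ultimately have "\<forall>\<^sub>F z in at_left y. z powr (-\<alpha> / 2) < y powr (-\<alpha> / 2) + r / 4 \<and> z \<in> {0<..<y}"
    by (rule eventually_conj)
  then obtain z where z: "z powr (-\<alpha> / 2) < y powr (-\<alpha> / 2) + r / 4" "0 < z" "z < y"
    using eventually_happens'[OF trivial_limit_at_left_real] by auto
  define \<delta> where "\<delta> = y - z"
  have \<delta>: "\<delta> > 0" using z by (simp add: \<delta>_def)
  define \<epsilon> where "\<epsilon> = min 1 (sqrt (r * \<delta>\<^sup>2 / (4 * C)))"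
  have \<epsilon>: "0 < \<epsilon>" "\<epsilon> \<le> 1" using r \<delta> C by (auto simp: \<epsilon>_def)
  have "\<epsilon>\<^sup>2 \<le> (sqrt (r * \<delta>\<^sup>2 / (4 * C)))\<^sup>2" using \<epsilon> by (intro power_mono) (auto simp: \<epsilon>_def)
  also have "\<dots> = r * \<delta>\<^sup>2 / (4 * C)" using r C by simp
  finally have \<epsilon>C: "\<epsilon>\<^sup>2 * C / \<delta>\<^sup>2 \<le> r / 4" using \<delta> C by (simp add: field_simps)
  have A1: "\<forall>\<^sub>F n in sequentially. ?G n (sqrt z) < y powr (-\<alpha> / 2) + r / 4"
    using z sq[of z] by (intro order_tendstoD(2)[OF entry_tail_limit]) auto
  have A2: "\<forall>\<^sub>F n in sequentially. (?G n \<epsilon>)\<^sup>2 / real (p n) < r / 8"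
    using r by (intro order_tendstoD(2)[OF over_p[OF \<epsilon>(1)]]) auto
  have "(\<lambda>n. C\<^sup>2 / \<delta>\<^sup>2 / real (p n)) \<longlonglongrightarrow> 0"
    by (intro tendsto_divide_0[OF tendsto_const] filterlim_at_top_imp_at_infinity p_real_at_top)
  then have A3: "\<forall>\<^sub>F n in sequentially. C\<^sup>2 / \<delta>\<^sup>2 / real (p n) < r / 8"
    using r by (intro order_tendstoD(2)) auto
  have A4: "\<forall>\<^sub>F n in sequentially. ?G n (sqrt y) > y powr (-\<alpha> / 2) - r / 4"
    using y sq[of y] r by (intro order_tendstoD(1)[OF entry_tail_limit]) auto
  have A5: "\<forall>\<^sub>F n in sequentially. (?G n (sqrt y))\<^sup>2 / real (p n) < r / 4"
    using r y by (intro order_tendstoD(2)[OF over_p]) auto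
  have "\<forall>\<^sub>F n in sequentially. \<bar>?T n - y powr (-\<alpha> / 2)\<bar> < r"
    using A1 A2 A3 A4 A5 C' eventually_ge_at_top[of 1]
  proof eventually_elim
    case (elim n)
    have pn: "real (p n) > 0" using p_pos[of n] elim by simp
    have A: "norming n > 0" using norming_pos elim by simp
    define V where "V = truncated_moment 2 (norming n * \<epsilon>)"
    \<comment> \<open>\<open>c\<close> stays bounded; every occurrence of \<open>V\<close> is expressed through it.\<close>
    define c where "c = real (n * p n) * V / scale n"
    have V0: "V \<ge> 0" by (simp add: V_def truncated_moment_nonneg)
    have "V \<le> truncated_moment 2 (norming n)" unfolding V_def
      using A \<epsilon> by (intro truncated_moment_mono) (simp add: mult_le_cancel_left1)
    then have "c \<le> real (n * p n) * truncated_moment 2 (norming n) / scale n" unfolding c_def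
      by (intro divide_right_mono mult_left_mono) auto
    then have c: "0 \<le> c" "c \<le> C" using elim V0 by (auto simp: c_def)
    have eq: "y * scale n = (norming n * sqrt z)\<^sup>2 + \<delta> * scale n"
      using z by (simp add: \<delta>_def power_mult_distrib algebra_simps)
    have "\<P>(w in M. row_sum n i w > y * scale n) \<le>
        real n * tail_prob (norming n * sqrt z) + (real n * tail_prob (norming n * \<epsilon>))\<^sup>2
        + (real n * ((norming n * \<epsilon>)\<^sup>2 * V) + (real n * V)\<^sup>2) / (\<delta> * scale n)\<^sup>2"
      unfolding eq V_def using A z \<epsilon> \<delta> by (intro row_sum_tail_upper) auto
    then have "?T n \<le> real (p n) * (real n * tail_prob (norming n * sqrt z) + (real n * tail_prob (norming n * \<epsilon>))\<^sup>2
        + (real n * ((norming n * \<epsilon>)\<^sup>2 * V) + (real n * V)\<^sup>2) / (\<delta> * scale n)\<^sup>2)"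
      using pn by (intro mult_left_mono) auto
    also have "\<dots> = ?G n (sqrt z) + (?G n \<epsilon>)\<^sup>2 / real (p n) + (\<epsilon>\<^sup>2 * c / \<delta>\<^sup>2 + c\<^sup>2 / \<delta>\<^sup>2 / real (p n))"
    proof -
      have "real (p n) * (real n * tail_prob (norming n * sqrt z)) = ?G n (sqrt z)" by simp
      moreover have "real (p n) * (real n * tail_prob (norming n * \<epsilon>))\<^sup>2 = (?G n \<epsilon>)\<^sup>2 / real (p n)"
        using pn by (simp add: field_simps power2_eq_square)
      moreover have "real (p n) * ((real n * ((norming n * \<epsilon>)\<^sup>2 * V)) / (\<delta> * scale n)\<^sup>2) = \<epsilon>\<^sup>2 * c / \<delta>\<^sup>2"
        using A \<delta> by (simp add: c_def field_simps power2_eq_square)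
      moreover have "real (p n) * ((real n * V)\<^sup>2 / (\<delta> * scale n)\<^sup>2) = c\<^sup>2 / \<delta>\<^sup>2 / real (p n)"
        using A \<delta> pn by (simp add: c_def field_simps power2_eq_square)
      ultimately show ?thesis by (simp only: distrib_left add_divide_distrib)
    qed
    also have "\<epsilon>\<^sup>2 * c / \<delta>\<^sup>2 \<le> \<epsilon>\<^sup>2 * C / \<delta>\<^sup>2" using c by (intro divide_right_mono mult_left_mono) auto
    also have "c\<^sup>2 / \<delta>\<^sup>2 / real (p n) \<le> C\<^sup>2 / \<delta>\<^sup>2 / real (p n)"
      using c by (intro divide_right_mono power_mono) auto
    finally have up: "?T n \<le> ?G n (sqrt z) + (?G n \<epsilon>)\<^sup>2 / real (p n) + (\<epsilon>\<^sup>2 * C / \<delta>\<^sup>2 + C\<^sup>2 / \<delta>\<^sup>2 / real (p n))"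
      by simp
    have "real n * tail_prob (norming n * sqrt y) - (real n * tail_prob (norming n * sqrt y))\<^sup>2
        \<le> \<P>(w in M. row_sum n i w > (norming n * sqrt y)\<^sup>2)"
      using A y by (intro row_sum_tail_lower) auto
    also have "(norming n * sqrt y)\<^sup>2 = y * scale n" using y by (simp add: power_mult_distrib)
    finally have "real (p n) * (real n * tail_prob (norming n * sqrt y) - (real n * tail_prob (norming n * sqrt y))\<^sup>2) \<le> ?T n"
      using pn by (intro mult_left_mono) auto
    moreover have "real (p n) * (real n * tail_prob (norming n * sqrt y) - (real n * tail_prob (norming n * sqrt y))\<^sup>2)
        = ?G n (sqrt y) - (?G n (sqrt y))\<^sup>2 / real (p n)"
      using pn by (simp add: field_simps power2_eq_square)
    ultimately have low: "?G n (sqrt y) - (?G n (sqrt y))\<^sup>2 / real (p n) \<le> ?T n" by simp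
    show ?case using up low elim(1-5) \<epsilon>C r by (simp only: abs_less_iff) linarith
  qed
  then show "\<exists>no. \<forall>n\<ge>no. norm (?T n - y powr (-\<alpha> / 2)) < r"
    by (simp add: eventually_sequentially)
qed

end

section \<open>The off-diagonal part of the Gram matrix\<close>

context heavy_tailed_array
begin

text \<open>
  The squared Frobenius norm of the off-diagonal part of \<open>X X\<^sup>T\<close>.
\<close>

definition off_diagonal_norm2 :: "nat \<Rightarrow> nat \<Rightarrow> 'a \<Rightarrow> real" where
  "off_diagonal_norm2 P n w = (\<Sum>i<P. \<Sum>j<P. if i = j then 0 else (\<Sum>t<n. Z i t w * Z j t w)\<^sup>2)"

lemma off_diagonal_norm2_measurable [measurable]: "off_diagonal_norm2 P n \<in> borel_measurable M"
  unfolding off_diagonal_norm2_def by measurable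

text \<open>
  In the expansion of the square, a pair \<open>s \<noteq> t\<close> involves four independent entries and contributes the
  fourth power of a mean; the terms with \<open>s = t\<close> involve two squared entries.
\<close>

lemma truncated_inner_product_second_moment:
  assumes ij: "i \<noteq> j"
  shows "integrable M (\<lambda>w. (\<Sum>t<n. truncate u (Z i t w) * truncate u (Z j t w))\<^sup>2)" (is ?int)
    and "expectation (\<lambda>w. (\<Sum>t<n. truncate u (Z i t w) * truncate u (Z j t w))\<^sup>2)
      \<le> real n * (truncated_moment 2 u)\<^sup>2 + (real n)\<^sup>2 * (truncated_moment 1 u) ^ 4" (is ?le)
proof -
  define U where "U t w = truncate u (Z i t w) * truncate u (Z j t w)" for t w
  have [measurable]: "U t \<in> borel_measurable M" for t unfolding U_def by measurable
  have int: "integrable M (\<lambda>w. U s w * U t w)" for s t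
  proof (rule integrable_const_bound[where B = "(\<bar>u\<bar> * \<bar>u\<bar>) * (\<bar>u\<bar> * \<bar>u\<bar>)"], rule AE_I2)
    fix w show "norm (U s w * U t w) \<le> (\<bar>u\<bar> * \<bar>u\<bar>) * (\<bar>u\<bar> * \<bar>u\<bar>)"
      unfolding real_norm_def abs_mult U_def by (intro mult_mono truncate_bound) auto
  qed measurable
  have bd: "\<bar>(truncate u z)\<^sup>2\<bar> \<le> \<bar>u\<bar>\<^sup>2" for z using truncate_power_bound[of u z 2] by simp
  have diag: "expectation (\<lambda>w. U t w * U t w) = (truncated_moment 2 u)\<^sup>2" for t
  proof -
    have "U t w * U t w = (\<Prod>(i,t)\<in>{(i,t),(j,t)}. (truncate u (Z i t w))\<^sup>2)" for w
      using ij by (simp add: U_def power2_eq_square mult_ac)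
    then have "expectation (\<lambda>w. U t w * U t w)
        = (expectation (\<lambda>w. (truncate u (Z 0 0 w))\<^sup>2)) ^ card {(i,t),(j,t)}"
      using expectation_prod_entries[where h = "\<lambda>z. (truncate u z)\<^sup>2" and Q = "{(i,t),(j,t)}", OF _ _ bd]
      by simp
    moreover have "card {(i,t),(j,t)} = 2" using ij by simp
    ultimately show ?thesis by (simp only: expectation_truncate_square)
  qed
  let ?b = "expectation (\<lambda>w. truncate u (Z 0 0 w))"
  have off: "expectation (\<lambda>w. U s w * U t w) = ?b ^ 4" if "s \<noteq> t" for s t
  proof -
    let ?Q = "{(i,s),(j,s),(i,t),(j,t)}"
    have "U s w * U t w = (\<Prod>(i,t)\<in>?Q. truncate u (Z i t w))" for w
      using ij that by (simp add: U_def mult_ac)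
    then have "expectation (\<lambda>w. U s w * U t w) = ?b ^ card ?Q"
      using expectation_prod_entries[where h = "truncate u" and Q = "?Q", OF _ _ truncate_bound] by simp
    moreover have "card ?Q = 4" using ij that by simp
    ultimately show ?thesis by (simp only:)
  qed
  note S = second_moment_sum_le[of n U, OF int diag off]
  show ?int using S(1) by (simp add: U_def)
  have "?b ^ 4 = \<bar>?b\<bar> ^ 4" by (simp add: power_even_abs)
  also have "\<dots> \<le> (truncated_moment 1 u) ^ 4" by (intro power_mono expectation_truncate_abs) auto
  finally have "(real n)\<^sup>2 * ?b ^ 4 \<le> (real n)\<^sup>2 * (truncated_moment 1 u) ^ 4" by (intro mult_left_mono) auto
  then show ?le using S(2) by (simp add: U_def)
qed

lemma off_diagonal_tail_bound:
  assumes u: "u > 0" and e: "e > 0"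
  shows "\<P>(w in M. off_diagonal_norm2 P n w \<ge> e) \<le> real (n * P) * tail_prob u
    + (real P)\<^sup>2 * (real n * (truncated_moment 2 u)\<^sup>2 + (real n)\<^sup>2 * (truncated_moment 1 u) ^ 4) / e"
proof -
  let ?m = "real n * (truncated_moment 2 u)\<^sup>2 + (real n)\<^sup>2 * (truncated_moment 1 u) ^ 4"
  let ?s = "\<lambda>i j w. if i = j then 0 else (\<Sum>t<n. truncate u (Z i t w) * truncate u (Z j t w))\<^sup>2"
  define R where "R w = (\<Sum>i<P. \<Sum>j<P. ?s i j w)" for w
  have [measurable]: "R \<in> borel_measurable M" unfolding R_def by measurable
  have int: "integrable M (?s i j)" for i j
    using truncated_inner_product_second_moment(1)[of i j] by (cases "i = j") auto
  have Rint: "integrable M R" unfolding R_def by (intro Bochner_Integration.integrable_sum int)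
  have "expectation R = (\<Sum>i<P. expectation (\<lambda>w. \<Sum>j<P. ?s i j w))"
    unfolding R_def by (intro Bochner_Integration.integral_sum Bochner_Integration.integrable_sum int)
  also have "\<dots> = (\<Sum>i<P. \<Sum>j<P. expectation (?s i j))"
    by (intro sum.cong refl Bochner_Integration.integral_sum int)
  also have "\<dots> \<le> (\<Sum>i<P. \<Sum>j<P. ?m)"
  proof (intro sum_mono)
    fix i j
    show "expectation (?s i j) \<le> ?m"
    proof (cases "i = j")
      case True
      have "0 \<le> ?m" by (intro add_nonneg_nonneg mult_nonneg_nonneg) (auto simp: truncated_moment_nonneg)
      then show ?thesis using True by simp
    next
      case False
      then show ?thesis using truncated_inner_product_second_moment(2)[OF False, of u n] by simp
    qed
  qed
  also have "\<dots> = (real P)\<^sup>2 * ?m" by (simp add: power2_eq_square)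
  finally have ER: "expectation R \<le> (real P)\<^sup>2 * ?m" .
  let ?E1 = "\<Union>i<P. \<Union>t<n. {w \<in> space M. \<bar>Z i t w\<bar> > u}"
  let ?E2 = "{w \<in> space M. R w \<ge> e}"
  have ev: "?E1 \<in> events" "?E2 \<in> events" by (intro sets.finite_UN; auto) measurable
  have "{w \<in> space M. off_diagonal_norm2 P n w \<ge> e} \<subseteq> ?E1 \<union> ?E2"
  proof (rule subsetI)
    fix w assume w: "w \<in> {w \<in> space M. off_diagonal_norm2 P n w \<ge> e}"
    show "w \<in> ?E1 \<union> ?E2"
    proof (cases "w \<in> ?E1")
      case False
      then have "truncate u (Z i t w) = Z i t w" if "i < P" "t < n" for i t
        using w that by (auto simp: truncate_def indicator_def not_less)
      then have "R w = off_diagonal_norm2 P n w"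
        unfolding R_def off_diagonal_norm2_def by (intro sum.cong refl) auto
      then show ?thesis using w by simp
    qed blast
  qed
  then have "\<P>(w in M. off_diagonal_norm2 P n w \<ge> e) \<le> prob (?E1 \<union> ?E2)"
    using ev by (intro finite_measure_mono) auto
  also have "\<dots> \<le> prob ?E1 + prob ?E2" using ev by (intro measure_Un_le) auto
  also have "prob ?E1 \<le> (\<Sum>i<P. prob (\<Union>t<n. {w \<in> space M. \<bar>Z i t w\<bar> > u}))"
    by (intro finite_measure_subadditive_finite) auto
  also have "\<dots> \<le> (\<Sum>i<P. \<Sum>t<n. \<P>(w in M. \<bar>Z i t w\<bar> > u))"
    by (intro sum_mono finite_measure_subadditive_finite) auto
  also have "\<dots> = real (n * P) * tail_prob u" by (simp add: prob_entry_greater)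
  also have "prob ?E2 \<le> expectation R / e"
    using e by (intro integral_Markov_inequality_measure[where A = "{}"] Rint)
      (auto simp: R_def intro!: sum_nonneg)
  also have "\<dots> \<le> (real P)\<^sup>2 * ?m / e" using ER e by (intro divide_right_mono) auto
  finally show ?thesis by simp
qed

text \<open>
  The bound \<open>off_diagonal_tail_bound\<close> at \<open>u = K A\<close> and \<open>e = (\<eta> A\<^sup>2)\<^sup>2\<close>: its first term tends to \<open>K\<^bsup>-\<alpha>\<^esup>\<close>, which is
  small for large \<open>K\<close>, the second one is \<open>O(1/n) + o(1)\<close> for fixed \<open>K\<close>.
\<close>

lemma off_diagonal_negligible:
  assumes \<eta>: "\<eta> > 0"
  shows "(\<lambda>n. \<P>(w in M. off_diagonal_norm2 (p n) n w \<ge> (\<eta> * scale n)\<^sup>2)) \<longlonglongrightarrow> 0"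
proof (rule LIMSEQ_I)
  let ?R = "\<lambda>n. \<P>(w in M. off_diagonal_norm2 (p n) n w \<ge> (\<eta> * scale n)\<^sup>2)"
  fix r :: real assume r: "r > 0"
  have "((\<lambda>K. K powr (-\<alpha>)) \<longlongrightarrow> 0) at_top"
    using alpha by (intro tendsto_neg_powr filterlim_ident) auto
  then have "\<forall>\<^sub>F K in at_top. K powr (-\<alpha>) < r / 4" using r by (intro order_tendstoD(2)) auto
  then have "\<forall>\<^sub>F K in at_top. K powr (-\<alpha>) < r / 4 \<and> (K::real) > 0"
    using eventually_gt_at_top by (rule eventually_conj)
  then obtain K :: real where K: "K powr (-\<alpha>) < r / 4" "K > 0"
    using eventually_happens'[OF trivial_limit_at_top_linorder] by blast
  obtain C where C: "C > 0" "\<forall>\<^sub>F m in sequentially. real m * truncated_moment 2 (K * a m) / (a m)\<^sup>2 \<le> C"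
    using truncated_second_moment_norming[OF K(2)] by auto
  have B1: "\<forall>\<^sub>F n in sequentially. real (n * p n) * truncated_moment 2 (K * norming n) / scale n \<le> C"
    by (rule eventually_compose_filterlim[OF C(2) entries_at_top])
  have B2: "(\<lambda>n. real (n * p n) * (truncated_moment 1 (K * norming n))\<^sup>2 / scale n) \<longlonglongrightarrow> 0"
    by (rule entries_compose[OF truncated_first_moment_norming[OF K(2)]])
  have "(\<lambda>n. (real (n * p n) * (truncated_moment 1 (K * norming n))\<^sup>2 / scale n)\<^sup>2 / \<eta>\<^sup>2) \<longlonglongrightarrow> 0\<^sup>2 / \<eta>\<^sup>2"
    using \<eta> by (intro tendsto_intros B2) auto
  then have A2: "\<forall>\<^sub>F n in sequentially. (real (n * p n) * (truncated_moment 1 (K * norming n))\<^sup>2 / scale n)\<^sup>2 / \<eta>\<^sup>2 < r / 4"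
    using r by (intro order_tendstoD(2)) auto
  have "(\<lambda>n. C\<^sup>2 / \<eta>\<^sup>2 / real n) \<longlonglongrightarrow> 0" by (intro lim_const_over_n)
  then have A3: "\<forall>\<^sub>F n in sequentially. C\<^sup>2 / \<eta>\<^sup>2 / real n < r / 4"
    using r by (intro order_tendstoD(2)) auto
  have A1: "\<forall>\<^sub>F n in sequentially. real (n * p n) * tail_prob (norming n * K) < r / 4"
    using K by (intro order_tendstoD(2)[OF entry_tail_limit]) auto
  have "\<forall>\<^sub>F n in sequentially. ?R n < r"
    using A1 A2 A3 B1 eventually_ge_at_top[of 1]
  proof eventually_elim
    case (elim n)
    define A where "A = norming n"
    have A: "A > 0" using norming_pos elim by (simp add: A_def)
    define V where "V = truncated_moment 2 (K * A)"
    define B where "B = truncated_moment 1 (K * A)"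
    define c where "c = real (n * p n) * V / A\<^sup>2"
    have c: "0 \<le> c" "c \<le> C" using elim by (auto simp: c_def V_def A_def truncated_moment_nonneg)
    have "?R n \<le> real (n * p n) * tail_prob (K * A)
        + (real (p n))\<^sup>2 * (real n * V\<^sup>2 + (real n)\<^sup>2 * B ^ 4) / (\<eta> * A\<^sup>2)\<^sup>2"
      unfolding A_def V_def B_def using A K(2) \<eta> by (intro off_diagonal_tail_bound) (auto simp: A_def)
    also have "(real (p n))\<^sup>2 * (real n * V\<^sup>2 + (real n)\<^sup>2 * B ^ 4) / (\<eta> * A\<^sup>2)\<^sup>2
        = c\<^sup>2 / \<eta>\<^sup>2 / real n + (real (n * p n) * B\<^sup>2 / A\<^sup>2)\<^sup>2 / \<eta>\<^sup>2"
      using A \<eta> elim by (simp add: c_def field_simps power2_eq_square power4_eq_xxxx)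
    also have "c\<^sup>2 / \<eta>\<^sup>2 / real n \<le> C\<^sup>2 / \<eta>\<^sup>2 / real n"
      using c by (intro divide_right_mono power_mono) auto
    finally have "?R n \<le> real (n * p n) * tail_prob (norming n * K)
        + (C\<^sup>2 / \<eta>\<^sup>2 / real n + (real (n * p n) * (truncated_moment 1 (K * norming n))\<^sup>2 / scale n)\<^sup>2 / \<eta>\<^sup>2)"
      by (simp add: A_def B_def mult.commute)
    then show ?case using elim(1-3) r by linarith
  qed
  then show "\<exists>no. \<forall>n\<ge>no. norm (?R n - 0) < r"
    by (simp add: eventually_sequentially)
qed

end

section \<open>Characteristic functions of Poisson step functionals\<close>

lemma norm_iexp_diff_le: "norm (iexp x - iexp y) \<le> \<bar>x - y\<bar>"
proof -
  have "iexp x - iexp y = iexp y * (iexp (x - y) - 1)"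
    by (simp add: exp_diff right_diff_distrib)
  then have "norm (iexp x - iexp y) = norm (iexp (x - y) - 1)"
    by (simp add: norm_mult)
  also have "\<dots> \<le> \<bar>x - y\<bar>" using iexp_approx1[of "x - y" 0] by simp
  finally show ?thesis .
qed

lemma norm_iexp_diff_le_2: "norm (iexp x - iexp y) \<le> 2"
  using norm_triangle_ineq4[of "iexp x" "iexp y"] by simp

lemma char_distr: "X \<in> borel_measurable M \<Longrightarrow> char (distr M borel X) s = (CLINT w|M. iexp (s * X w))"
  by (simp add: char_def integral_distr)

text \<open>
  \<open>1 + z\<close> and \<open>exp z\<close> lie in the unit disc and differ by \<open>O(|z|\<^sup>2)\<close>, so their powers differ by
  \<open>O(p |z|\<^sup>2) = O(1/p)\<close>.
\<close>

lemma one_plus_power_tendsto_exp: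
  fixes z :: "nat \<Rightarrow> complex" and p :: "nat \<Rightarrow> nat"
  assumes p: "filterlim p at_top sequentially"
    and lim: "(\<lambda>n. of_nat (p n) * z n) \<longlonglongrightarrow> w" and le: "\<And>n. norm (1 + z n) \<le> 1"
  shows "(\<lambda>n. (1 + z n) ^ p n) \<longlonglongrightarrow> exp w"
proof -
  have pr: "filterlim (\<lambda>n. real (p n)) at_top sequentially"
    by (rule filterlim_compose[OF filterlim_real_sequentially p])
  have Re: "Re (z n) \<le> 0" for n
    using complex_Re_le_cmod[of "1 + z n"] le[of n] by simp
  have bound: "norm ((1 + z n) ^ p n - exp (of_nat (p n) * z n))
      \<le> (norm (of_nat (p n) * z n))\<^sup>2 / real (p n) * exp (norm (z n))" for n
  proof -
    have "norm ((1 + z n) ^ p n - exp (of_nat (p n) * z n)) = norm ((1 + z n) ^ p n - exp (z n) ^ p n)"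
      by (simp add: exp_of_nat_mult)
    also have "\<dots> \<le> real (p n) * norm ((1 + z n) - exp (z n))"
      using le[of n] Re[of n] by (intro norm_power_diff) auto
    also have "norm ((1 + z n) - exp (z n)) = norm (exp (z n) - (\<Sum>i\<le>1. z n ^ i / fact i))"
      by (simp add: norm_minus_commute)
    also have "\<dots> \<le> exp (norm (z n)) * (norm (z n) ^ Suc 1) / fact 1" by (rule Taylor_exp_field)
    finally have "norm ((1 + z n) ^ p n - exp (of_nat (p n) * z n))
        \<le> real (p n) * (exp (norm (z n)) * (norm (z n))\<^sup>2)" by (simp add: mult_left_mono numeral_2_eq_2)
    also have "\<dots> = (norm (of_nat (p n) * z n))\<^sup>2 / real (p n) * exp (norm (z n))"
      by (simp add: norm_mult power2_eq_square)
    finally show ?thesis .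
  qed
  have z0: "(\<lambda>n. norm (z n)) \<longlonglongrightarrow> 0"
  proof -
    have "(\<lambda>n. norm (of_nat (p n) * z n) * inverse (real (p n))) \<longlonglongrightarrow> norm w * 0"
      by (intro tendsto_mult tendsto_norm lim tendsto_inverse_0_at_top pr)
    moreover have "\<forall>\<^sub>F n in sequentially. norm (of_nat (p n) * z n) * inverse (real (p n)) = norm (z n)"
      using filterlim_at_top_dense[THEN iffD1, OF pr, rule_format, of 0]
      by eventually_elim (simp add: norm_mult)
    ultimately show ?thesis using Lim_transform_eventually by fastforce
  qed
  have "(\<lambda>n. (norm (of_nat (p n) * z n))\<^sup>2 * inverse (real (p n)) * exp (norm (z n))) \<longlonglongrightarrow> (norm w)\<^sup>2 * 0 * exp 0"
    by (intro tendsto_mult tendsto_power tendsto_norm lim tendsto_inverse_0_at_top pr tendsto_exp z0)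
  then have "(\<lambda>n. (norm (of_nat (p n) * z n))\<^sup>2 / real (p n) * exp (norm (z n))) \<longlonglongrightarrow> 0"
    by (simp add: divide_inverse)
  then have "(\<lambda>n. (1 + z n) ^ p n - exp (of_nat (p n) * z n)) \<longlonglongrightarrow> 0"
    by (rule Lim_null_comparison[rotated]) (rule always_eventually, rule allI, rule bound)
  from tendsto_add[OF this tendsto_exp[OF lim]] show ?thesis by simp
qed

lemma (in prob_space) char_poisson_distributed:
  assumes X[measurable]: "X \<in> borel_measurable M" and nat: "\<And>w. w \<in> space M \<Longrightarrow> X w \<in> \<nat>"
    and pois: "\<And>k::nat. \<P>(w in M. X w = of_nat k) = \<rho> ^ k / fact k * exp (- \<rho>)"
  shows "char (distr M borel (\<lambda>w. c * enn2real (X w))) s = exp ((iexp (s * c) - 1) * of_real \<rho>)"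
proof -
  let ?F = "\<lambda>k. {w \<in> space M. X w = of_nat k}"
  let ?f = "\<lambda>k w. iexp (s * (c * real k)) * of_real (indicator (?F k) w)"
  have \<rho>: "\<rho> \<ge> 0"
  proof -
    have "0 \<le> \<rho> * exp (-\<rho>)" using pois[of 1] measure_nonneg[of M "?F 1"] by simp
    then show ?thesis by (simp add: zero_le_mult_iff)
  qed
  have ev: "?F k \<in> events" for k by measurable
  have int: "integrable M (\<lambda>w. complex_of_real (indicator (?F k) w))" for k
    using ev[of k] by (intro integrable_of_real integrable_real_indicator) (auto simp: emeasure_eq_measure)
  have sums: "(\<lambda>k. ?f k w) sums iexp (s * (c * enn2real (X w)))"
    "(\<lambda>k. norm (?f k w)) sums 1" if w: "w \<in> space M" for w
  proof -
    obtain k0 where k0: "X w = of_nat k0" using nat[OF w] by (auto elim!: Nats_cases)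
    have eq: "?f k w = (if k = k0 then iexp (s * (c * real k)) else 0)" for k
      using w k0 by (auto simp: indicator_def)
    have nm: "norm (?f k w) = (if k = k0 then 1 else 0)" for k
      unfolding eq by simp
    show "(\<lambda>k. ?f k w) sums iexp (s * (c * enn2real (X w)))"
      unfolding eq using sums_single[of k0 "\<lambda>k. iexp (s * (c * real k))"] k0 by simp
    show "(\<lambda>k. norm (?f k w)) sums 1" unfolding nm by (rule sums_single)
  qed
  have norms: "(\<integral>w. norm (?f k w) \<partial>M) = \<rho> ^ k / fact k * exp (-\<rho>)" for k
  proof -
    have "norm (?f k w) = indicator (?F k) w" for w by (simp add: norm_mult)
    then show ?thesis using ev[of k] pois[of k] by simp
  qed
  have "(\<lambda>k. \<rho> ^ k / fact k * exp (-\<rho>)) sums (exp \<rho> * exp (-\<rho>))"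
    using exp_converges[of \<rho>] by (intro sums_mult2) (simp add: divide_inverse mult.commute)
  then have summ: "summable (\<lambda>k. \<integral>w. norm (?f k w) \<partial>M)" unfolding norms by (rule sums_summable)
  have "(\<lambda>k. \<integral>w. ?f k w \<partial>M) sums (\<integral>w. (\<Sum>k. ?f k w) \<partial>M)"
  proof (rule sums_integral[OF _ _ summ])
    show "integrable M (?f k)" for k by (intro integrable_mult_right int)
    show "AE w in M. summable (\<lambda>k. norm (?f k w))"
      using sums(2) by (intro AE_I2) (rule sums_summable)
  qed
  also have "(\<integral>w. (\<Sum>k. ?f k w) \<partial>M) = (\<integral>w. iexp (s * (c * enn2real (X w))) \<partial>M)"
    using sums(1) by (intro Bochner_Integration.integral_cong refl) (simp add: sums_iff)
  finally have L: "(\<lambda>k. \<integral>w. ?f k w \<partial>M) sums (\<integral>w. iexp (s * (c * enn2real (X w))) \<partial>M)" .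
  have summand: "(\<integral>w. ?f k w \<partial>M) = (iexp (s * c) * of_real \<rho>) ^ k /\<^sub>R fact k * exp (- of_real \<rho>)" for k
  proof -
    have "(\<integral>w. ?f k w \<partial>M) = iexp (s * (c * real k)) * of_real (prob (?F k))"
      using int[of k] ev[of k] by (simp del: of_real_mult)
    also have "\<dots> = iexp (s * c) ^ k * of_real (\<rho> ^ k / fact k * exp (- \<rho>))"
      by (simp add: pois exp_of_nat_mult[symmetric] mult_ac)
    also have "\<dots> = (iexp (s * c) * of_real \<rho>) ^ k /\<^sub>R fact k * exp (- of_real \<rho>)"
      by (simp add: power_mult_distrib scaleR_conv_of_real divide_inverse exp_of_real[symmetric] of_real_inverse[symmetric] del: of_real_inverse)
    finally show ?thesis .
  qed
  have "(\<lambda>k. \<integral>w. ?f k w \<partial>M) sums (exp (iexp (s * c) * of_real \<rho>) * exp (- of_real \<rho>))"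
    unfolding summand by (intro sums_mult2 exp_converges)
  with L have "(\<integral>w. iexp (s * (c * enn2real (X w))) \<partial>M) = exp (iexp (s * c) * of_real \<rho>) * exp (- of_real \<rho>)"
    by (rule sums_unique2)
  also have "\<dots> = exp ((iexp (s * c) - 1) * of_real \<rho>)"
    by (simp add: exp_add[symmetric] algebra_simps)
  finally show ?thesis by (subst char_distr) simp_all
qed

text \<open>
  The mass of a cell under a measure for which \<open>(y, \<infinity>]\<close> has mass \<open>\<tau> y\<close>. With two choices of \<open>\<tau>\<close>
  it serves both for the intensity measure and for counts of points.
\<close>

definition grid_mass :: "(real \<Rightarrow> real) \<Rightarrow> nat \<Rightarrow> (nat \<Rightarrow> real) \<Rightarrow> nat \<Rightarrow> real" where
  "grid_mass \<tau> m x k = (if k < m then \<tau> (x k) - \<tau> (x (Suc k)) else \<tau> (x m))"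

lemma measure_grid_cell:
  fixes \<mu> :: "ereal measure"
  assumes x: "mono x" "x 0 > 0" and k: "k \<le> m"
    and \<mu>: "sets \<mu> = sets (restrict_space borel {0<..})"
    and \<tau>: "\<And>j. j \<le> m \<Longrightarrow> emeasure \<mu> {ereal (x j)<..} = ennreal (\<tau> (x j))" "\<And>j. j \<le> m \<Longrightarrow> 0 \<le> \<tau> (x j)"
  shows "emeasure \<mu> (grid_cell m x k) < \<infinity>" and "measure \<mu> (grid_cell m x k) = grid_mass \<tau> m x k"
proof -
  have xj: "x j > 0" for j using monoD[OF x(1), of 0 j] x(2) by simp
  have meas: "{ereal (x j)<..} \<in> sets \<mu>" for j
    unfolding \<mu> using xj[of j] by (subst sets_restrict_space_iff) auto
  have sub: "grid_cell m x k \<subseteq> {ereal (x k)<..}" using k by (auto simp: grid_cell_def)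
  have "emeasure \<mu> (grid_cell m x k) \<le> emeasure \<mu> {ereal (x k)<..}"
    by (rule emeasure_mono[OF sub meas])
  then show fin: "emeasure \<mu> (grid_cell m x k) < \<infinity>" using \<tau>(1)[OF k] by (auto simp: le_less_trans)
  show "measure \<mu> (grid_cell m x k) = grid_mass \<tau> m x k"
  proof (cases "k < m")
    case True
    have "x k \<le> x (Suc k)" by (rule monoD[OF x(1)]) simp
    then have "{ereal (x (Suc k))<..} \<subseteq> {ereal (x k)<..}" by (auto intro: le_less_trans[of _ "ereal (x (Suc k))"])
    moreover have "grid_cell m x k = {ereal (x k)<..} - {ereal (x (Suc k))<..}"
      using True by (auto simp: grid_cell_def not_less)
    ultimately have "measure \<mu> (grid_cell m x k) = measure \<mu> {ereal (x k)<..} - measure \<mu> {ereal (x (Suc k))<..}"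
      using \<tau>(1)[OF k] meas by (simp add: measure_Diff)
    then show ?thesis using True \<tau> k by (simp add: grid_mass_def measure_def)
  next
    case False
    then show ?thesis using \<tau>[of m] k by (simp add: grid_mass_def grid_cell_def measure_def)
  qed
qed

text \<open>
  The counts of the cells are independent Poisson variables.
\<close>

lemma poisson_step_char:
  assumes P: "poisson_point_process {0<..} M N \<nu>"
    and \<nu>: "\<And>y::real. y > 0 \<Longrightarrow> emeasure \<nu> {ereal y<..} = ennreal (\<tau> y)" "\<And>y. y > 0 \<Longrightarrow> 0 \<le> \<tau> y"
    and x: "mono x" "x 0 > 0"
  shows "char (distr M borel (\<lambda>w. \<Sum>k\<le>m. c k * measure (N w) (grid_cell m x k))) s
    = exp (\<Sum>k\<le>m. (iexp (s * c k) - 1) * of_real (grid_mass \<tau> m x k))"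
proof -
  have N: "prob_space M" "point_process {0<..} M N" "sets \<nu> = sets (restrict_space borel {0<..})"
    and pois: "\<And>A k. A \<in> sets \<nu> \<Longrightarrow> emeasure \<nu> A < \<infinity> \<Longrightarrow>
        measure M {w \<in> space M. emeasure (N w) A = of_nat k} = measure \<nu> A ^ k / fact k * exp (- measure \<nu> A)"
    and ind: "\<And>(m::nat) A. (\<And>i. i < m \<Longrightarrow> A i \<in> sets \<nu>) \<Longrightarrow> disjoint_family_on A {..<m} \<Longrightarrow>
        prob_space.indep_vars M (\<lambda>_. borel) (\<lambda>i w. emeasure (N w) (A i)) {..<m}"
    using P unfolding poisson_point_process_def by auto
  interpret prob_space M by fact
  have xj: "x j > 0" for j using monoD[OF x(1), of 0 j] x(2) by simp
  have cell: "grid_cell m x k \<in> sets \<nu>" if "k \<le> m" for k using sets_grid_cell[OF x that] N(3) by simp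
  have "indep_vars (\<lambda>_. borel) (\<lambda>i w. emeasure (N w) (grid_cell m x i)) {..<Suc m}"
    using cell grid_cell_disjoint[OF x(1)] by (intro ind) (auto simp: disjoint_family_on_def less_Suc_eq_le)
  then have "indep_vars (\<lambda>_. borel) (\<lambda>i w. c i * enn2real (emeasure (N w) (grid_cell m x i))) {..<Suc m}"
    by (rule indep_vars_compose2) measurable
  then have ind': "indep_vars (\<lambda>_. borel) (\<lambda>i w. c i * measure (N w) (grid_cell m x i)) {..m}"
    by (simp add: measure_def lessThan_Suc_atMost)
  have "char (distr M borel (\<lambda>w. \<Sum>k\<le>m. c k * measure (N w) (grid_cell m x k))) s
      = (\<Prod>k\<le>m. char (distr M borel (\<lambda>w. c k * measure (N w) (grid_cell m x k))) s)"
    by (rule char_distr_sum[OF ind'])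
  also have "\<dots> = (\<Prod>k\<le>m. exp ((iexp (s * c k) - 1) * of_real (grid_mass \<tau> m x k)))"
  proof (rule prod.cong[OF refl])
    fix k assume "k \<in> {..m}"
    then have k: "k \<le> m" by simp
    note mass = measure_grid_cell[OF x k N(3) \<nu>(1)[OF xj] \<nu>(2)[OF xj]]
    have "grid_cell m x k \<subseteq> {ereal (x 0)<..}" using grid_cell_Union[OF x(1), of m] k by blast
    then have rc: "relatively_compact_in {0<..} (grid_cell m x k)" by (rule relatively_compact_in_Ioi[OF x(2)])
    show "char (distr M borel (\<lambda>w. c k * measure (N w) (grid_cell m x k))) s
        = exp ((iexp (s * c k) - 1) * of_real (grid_mass \<tau> m x k))"
      unfolding measure_def
    proof (rule char_poisson_distributed)
      show "(\<lambda>w. emeasure (N w) (grid_cell m x k)) \<in> borel_measurable M"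
        using N(2) cell[OF k] N(3) by (auto simp: point_process_def)
      show "emeasure (N w) (grid_cell m x k) \<in> \<nat>" if "w \<in> space M" for w
        using N(2) cell[OF k] N(3) rc that by (auto simp: point_process_def)
      show "measure M {w \<in> space M. emeasure (N w) (grid_cell m x k) = of_nat j}
          = grid_mass \<tau> m x k ^ j / fact j * exp (- grid_mass \<tau> m x k)" for j
        using pois[OF cell[OF k] mass(1)] mass(2) by simp
    qed
  qed
  also have "\<dots> = exp (\<Sum>k\<le>m. (iexp (s * c k) - 1) * of_real (grid_mass \<tau> m x k))"
    by (simp add: exp_sum)
  finally show ?thesis .
qed

section \<open>Convergence of the eigenvalue process\<close>

lemma iexp_step:
  assumes x: "mono x"
  shows "iexp (s * (\<Sum>k\<le>m. c k * indicator (grid_cell m x k) y))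
    = 1 + (\<Sum>k\<le>m. (iexp (s * c k) - 1) * of_real (indicator (grid_cell m x k) y))"
proof (cases "\<exists>k0\<le>m. y \<in> grid_cell m x k0")
  case True
  then obtain k0 where k0: "k0 \<le> m" "y \<in> grid_cell m x k0" by blast
  have ind: "indicator (grid_cell m x k) y = (if k = k0 then 1 else 0 :: real)" if "k \<le> m" for k
    using grid_cell_disjoint[OF x that k0(1)] k0(2) by (auto simp: indicator_def)
  have "(\<Sum>k\<le>m. c k * indicator (grid_cell m x k) y) = (\<Sum>k\<le>m. if k = k0 then c k else 0)"
    by (intro sum.cong refl) (simp add: ind)
  moreover have "(\<Sum>k\<le>m. (iexp (s * c k) - 1) * of_real (indicator (grid_cell m x k) y))
      = (\<Sum>k\<le>m. if k = k0 then iexp (s * c k) - 1 else 0)"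
    by (intro sum.cong refl) (simp add: ind)
  ultimately show ?thesis using k0(1) by simp
next
  case False
  then have "(\<Sum>k\<le>m. c k * indicator (grid_cell m x k) y) = 0"
    "(\<Sum>k\<le>m. (iexp (s * c k) - 1) * complex_of_real (indicator (grid_cell m x k) y)) = 0"
    by (auto intro!: sum.neutral)
  then show ?thesis by simp
qed

context heavy_tailed_array
begin

lemma indep_row_sums: "indep_vars (\<lambda>_. borel) (row_sum n) L"
proof -
  let ?K = "\<lambda>i::nat. Pair i ` {..<n}"
  let ?Y = "\<lambda>i (f :: nat \<times> nat \<Rightarrow> real). \<Sum>t<n. (f (i, t))\<^sup>2"
  have "indep_vars (\<lambda>j. PiM (?K j) (\<lambda>_. borel)) (\<lambda>j w. restrict (\<lambda>q. (case q of (i, t) \<Rightarrow> Z i t) w) (?K j)) L"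
    using indep by (rule indep_vars_restrict) (auto simp: disjoint_family_on_def)
  then have "indep_vars (\<lambda>_. borel) (\<lambda>j w. ?Y j (restrict (\<lambda>q. (case q of (i, t) \<Rightarrow> Z i t) w) (?K j))) L"
  proof (rule indep_vars_compose2)
    fix j
    show "?Y j \<in> borel_measurable (PiM (?K j) (\<lambda>_. borel))"
      by (intro borel_measurable_sum borel_measurable_power measurable_component_singleton) auto
  qed
  moreover have "(\<lambda>j w. ?Y j (restrict (\<lambda>q. (case q of (i, t) \<Rightarrow> Z i t) w) (?K j))) = row_sum n"
    by (intro ext) (simp add: row_sum_def)
  ultimately show ?thesis by simp
qed

lemma distr_row_sum: "distr M borel (row_sum n i) = distr M borel (row_sum n 0)"
proof (rule Levy_uniqueness)
  have "char (distr M borel (row_sum n i)) s = (char (distr M borel (\<lambda>w. (Z 0 0 w)\<^sup>2)) s) ^ n" for i s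
  proof -
    let ?Q = "Pair i ` {..<n}"
    have "indep_vars (\<lambda>_. borel) (\<lambda>(i, t). Z i t) ?Q" using indep by (rule indep_vars_subset) simp
    then have ind: "indep_vars (\<lambda>_. borel) (\<lambda>q w. ((case q of (i, t) \<Rightarrow> Z i t) w)\<^sup>2) ?Q"
      by (rule indep_vars_compose2) measurable
    have "row_sum n i = (\<lambda>w. \<Sum>q\<in>?Q. ((case q of (i, t) \<Rightarrow> Z i t) w)\<^sup>2)"
      by (intro ext) (simp add: row_sum_def sum.reindex inj_on_def)
    then have "char (distr M borel (row_sum n i)) s
        = (\<Prod>q\<in>?Q. char (distr M borel (\<lambda>w. ((case q of (i, t) \<Rightarrow> Z i t) w)\<^sup>2)) s)"
      using char_distr_sum[OF ind] by simp
    also have "\<dots> = (\<Prod>q\<in>?Q. char (distr M borel (\<lambda>w. (Z 0 0 w)\<^sup>2)) s)"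
    proof (rule prod.cong[OF refl])
      fix q assume "q \<in> ?Q"
      then obtain t where q: "q = (i, t)" by auto
      have "distr M borel (\<lambda>w. (Z i t w)\<^sup>2) = distr (distr M borel (Z i t)) borel (\<lambda>z. z\<^sup>2)" for i t
        by (subst distr_distr) (auto simp: comp_def)
      then have "distr M borel (\<lambda>w. (Z i t w)\<^sup>2) = distr M borel (\<lambda>w. (Z 0 0 w)\<^sup>2)"
        using ident[of i t] by simp
      then show "char (distr M borel (\<lambda>w. ((case q of (i, t) \<Rightarrow> Z i t) w)\<^sup>2)) s
          = char (distr M borel (\<lambda>w. (Z 0 0 w)\<^sup>2)) s" by (simp add: q)
    qed
    also have "\<dots> = (char (distr M borel (\<lambda>w. (Z 0 0 w)\<^sup>2)) s) ^ n"
      by (simp add: card_image inj_on_def)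
    finally show ?thesis .
  qed
  then show "char (distr M borel (row_sum n i)) = char (distr M borel (row_sum n 0))"
    by (intro ext) simp
qed simp_all

definition row_tail :: "nat \<Rightarrow> real \<Rightarrow> real" where
  "row_tail n y = \<P>(w in M. row_sum n 0 w > y * scale n)"

lemma prob_row_greater: "\<P>(w in M. row_sum n i w > y * scale n) = row_tail n y"
proof -
  have eq: "\<P>(w in M. row_sum n i w > y * scale n)
      = measure (distr M borel (row_sum n i)) {y * scale n<..}" for i
    by (subst measure_distr) (auto intro!: arg_cong[where f = prob])
  show ?thesis unfolding row_tail_def eq distr_row_sum[of n i] ..
qed

lemma row_tail_limit: "y > 0 \<Longrightarrow> (\<lambda>n. real (p n) * row_tail n y) \<longlonglongrightarrow> y powr (-\<alpha> / 2)"
  unfolding row_tail_def by (rule row_sum_tail_limit)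

lemma prob_row_between:
  assumes "y \<le> z"
  shows "\<P>(w in M. y * scale n < row_sum n i w \<and> row_sum n i w \<le> z * scale n)
    = row_tail n y - row_tail n z"
proof -
  let ?G = "\<lambda>y. {w \<in> space M. row_sum n i w > y * scale n}"
  have "y * scale n \<le> z * scale n" using assms by (intro mult_right_mono) auto
  then have "?G z \<subseteq> ?G y" by auto
  moreover have "{w \<in> space M. y * scale n < row_sum n i w \<and> row_sum n i w \<le> z * scale n} = ?G y - ?G z"
    by auto
  ultimately show ?thesis by (simp add: finite_measure_Diff prob_row_greater[symmetric, of n _ i])
qed

text \<open>
  The value at the rescaled row sum \<open>d / A\<^sup>2\<close> of the step function with values \<open>c\<close> on the cells of \<open>x\<close>.
\<close>

definition step_value :: "nat \<Rightarrow> (nat \<Rightarrow> real) \<Rightarrow> (nat \<Rightarrow> real) \<Rightarrow> nat \<Rightarrow> real \<Rightarrow> real" where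
  "step_value m x c n d = (\<Sum>k\<le>m. c k * indicator (grid_cell m x k) (ereal (d / scale n)))"

lemma grid_cell_borel [measurable]: "grid_cell m x k \<in> sets borel"
  by (simp add: grid_cell_def)

lemma step_value_measurable [measurable]: "step_value m x c n \<in> borel_measurable borel"
  unfolding step_value_def by measurable

definition cell_prob :: "nat \<Rightarrow> (nat \<Rightarrow> real) \<Rightarrow> nat \<Rightarrow> nat \<Rightarrow> real" where
  "cell_prob m x n k = \<P>(w in M. ereal (row_sum n 0 w / scale n) \<in> grid_cell m x k)"

lemma cell_prob_limit:
  assumes x: "mono x" "x 0 > 0" and k: "k \<le> m"
  shows "(\<lambda>n. real (p n) * cell_prob m x n k) \<longlonglongrightarrow> grid_mass (\<lambda>y. y powr (-\<alpha> / 2)) m x k"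
proof -
  have xj: "x j > 0" for j using monoD[OF x(1), of 0 j] x(2) by simp
  have eq: "cell_prob m x n k = (if k < m then row_tail n (x k) - row_tail n (x (Suc k)) else row_tail n (x m))"
    if n: "n \<ge> 1" for n
  proof (cases "k < m")
    case True
    have "x k \<le> x (Suc k)" by (rule monoD[OF x(1)]) simp
    from prob_row_between[OF this, of n 0] show ?thesis
      using True norming_pos[OF n] by (simp add: cell_prob_def grid_cell_def field_simps)
  next
    case False
    then show ?thesis using k norming_pos[OF n]
      by (simp add: cell_prob_def grid_cell_def row_tail_def field_simps)
  qed
  have "(\<lambda>n. real (p n) * (if k < m then row_tail n (x k) - row_tail n (x (Suc k)) else row_tail n (x m)))
      \<longlonglongrightarrow> grid_mass (\<lambda>y. y powr (-\<alpha> / 2)) m x k"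
    using row_tail_limit[OF xj] by (auto simp: grid_mass_def right_diff_distrib intro!: tendsto_diff)
  moreover have "\<forall>\<^sub>F n in sequentially. real (p n) * (if k < m then row_tail n (x k) - row_tail n (x (Suc k)) else row_tail n (x m))
      = real (p n) * cell_prob m x n k"
    using eventually_ge_at_top[of 1] by eventually_elim (simp add: eq)
  ultimately show ?thesis by (rule Lim_transform_eventually)
qed

lemma row_step_char:
  assumes x: "mono x"
  shows "char (distr M borel (\<lambda>w. step_value m x c n (row_sum n i w))) s
    = 1 + (\<Sum>k\<le>m. (iexp (s * c k) - 1) * of_real (cell_prob m x n k))"
proof -
  let ?E = "\<lambda>k. {w \<in> space M. ereal (row_sum n 0 w / scale n) \<in> grid_cell m x k}"
  have "distr M borel (\<lambda>w. step_value m x c n (row_sum n i w)) = distr (distr M borel (row_sum n i)) borel (step_value m x c n)" for i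
    by (subst distr_distr) (auto simp: comp_def)
  then have "distr M borel (\<lambda>w. step_value m x c n (row_sum n i w)) = distr M borel (\<lambda>w. step_value m x c n (row_sum n 0 w))"
    using distr_row_sum[of n i] by simp
  then have "char (distr M borel (\<lambda>w. step_value m x c n (row_sum n i w))) s
      = (CLINT w|M. iexp (s * step_value m x c n (row_sum n 0 w)))"
    by (simp add: char_distr)
  also have "\<dots> = (CLINT w|M. 1 + (\<Sum>k\<le>m. (iexp (s * c k) - 1) * of_real (indicator (?E k) w)))"
  proof (intro Bochner_Integration.integral_cong refl)
    fix w assume "w \<in> space M"
    then have "indicator (grid_cell m x k) (ereal (row_sum n 0 w / scale n)) = (indicator (?E k) w :: real)" for k
      by (simp add: indicator_def)
    then show "iexp (s * step_value m x c n (row_sum n 0 w))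
        = 1 + (\<Sum>k\<le>m. (iexp (s * c k) - 1) * of_real (indicator (?E k) w))"
      unfolding step_value_def iexp_step[OF x] by simp
  qed
  also have "\<dots> = 1 + (\<Sum>k\<le>m. (iexp (s * c k) - 1) * of_real (prob (?E k)))"
  proof -
    have ev: "?E k \<in> events" for k by measurable
    have int: "integrable M (\<lambda>w. complex_of_real (indicator (?E k) w))" for k
      using ev[of k] by (intro integrable_of_real integrable_real_indicator) (auto simp: emeasure_eq_measure)
    have int': "integrable M (\<lambda>w. (iexp (s * c k) - 1) * complex_of_real (indicator (?E k) w))" for k
      by (intro integrable_mult_right int)
    have "(CLINT w|M. (iexp (s * c k) - 1) * complex_of_real (indicator (?E k) w))
        = (iexp (s * c k) - 1) * of_real (prob (?E k))" for k
      using int[of k] ev[of k] by simp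
    then show ?thesis
      using int' by (subst Bochner_Integration.integral_add)
        (auto simp: prob_space Bochner_Integration.integral_sum intro!: Bochner_Integration.integrable_sum)
  qed
  finally show ?thesis by (simp add: cell_prob_def)
qed

text \<open>
  The rows are iid, so the characteristic function is a power \<open>(1 + z n) ^ p n\<close>, where \<open>z n\<close> is a
  combination of cell probabilities of order \<open>1 / p n\<close>. The limit is the characteristic function of
  the same step functional of the Poisson process.
\<close>

lemma row_step_sum_char_limit:
  assumes x: "mono x" "x 0 > 0"
  shows "(\<lambda>n. char (distr M borel (\<lambda>w. \<Sum>i<p n. step_value m x c n (row_sum n i w))) s)
    \<longlonglongrightarrow> exp (\<Sum>k\<le>m. (iexp (s * c k) - 1) * of_real (grid_mass (\<lambda>y. y powr (-\<alpha> / 2)) m x k))"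
proof -
  let ?z = "\<lambda>n. \<Sum>k\<le>m. (iexp (s * c k) - 1) * of_real (cell_prob m x n k)"
  have "char (distr M borel (\<lambda>w. \<Sum>i<p n. step_value m x c n (row_sum n i w))) s = (1 + ?z n) ^ p n" for n
  proof -
    have "indep_vars (\<lambda>_. borel) (\<lambda>i w. step_value m x c n (row_sum n i w)) {..<p n}"
      by (rule indep_vars_compose2[OF indep_row_sums]) measurable
    from char_distr_sum[OF this, of s] show ?thesis by (simp add: row_step_char[OF x(1)])
  qed
  moreover have "(\<lambda>n. (1 + ?z n) ^ p n)
      \<longlonglongrightarrow> exp (\<Sum>k\<le>m. (iexp (s * c k) - 1) * of_real (grid_mass (\<lambda>y. y powr (-\<alpha> / 2)) m x k))"
  proof (rule one_plus_power_tendsto_exp[OF p_lim])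
    have "(\<lambda>n. \<Sum>k\<le>m. (iexp (s * c k) - 1) * complex_of_real (real (p n) * cell_prob m x n k))
        \<longlonglongrightarrow> (\<Sum>k\<le>m. (iexp (s * c k) - 1) * of_real (grid_mass (\<lambda>y. y powr (-\<alpha> / 2)) m x k))"
      by (intro tendsto_sum tendsto_mult tendsto_const tendsto_of_real cell_prob_limit x) simp
    moreover have "(\<Sum>k\<le>m. (iexp (s * c k) - 1) * complex_of_real (real (p n) * cell_prob m x n k)) = of_nat (p n) * ?z n" for n
      by (simp add: sum_distrib_left mult_ac)
    ultimately show "(\<lambda>n. of_nat (p n) * ?z n)
        \<longlonglongrightarrow> (\<Sum>k\<le>m. (iexp (s * c k) - 1) * of_real (grid_mass (\<lambda>y. y powr (-\<alpha> / 2)) m x k))"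
      by simp
    fix n
    interpret D: real_distribution "distr M borel (\<lambda>w. step_value m x c n (row_sum n 0 w))"
      by (rule real_distribution_distr) measurable
    show "norm (1 + ?z n) \<le> 1"
      using D.cmod_char_le_1[of s] by (simp add: row_step_char[OF x(1)])
  qed
  ultimately show ?thesis by simp
qed

definition row_count :: "nat \<Rightarrow> real \<Rightarrow> 'a \<Rightarrow> nat" where
  "row_count n y w = card {i \<in> {..<p n}. row_sum n i w > y}"

lemma eigenvalue_count_vs_row_count:
  assumes \<eta>: "\<eta> \<ge> 0" "off_diagonal_norm2 (p n) n w \<le> \<eta>\<^sup>2"
  shows "row_count n (y + \<eta>) w \<le> eigenvalue_count y (gram_matrix (p n) n (\<lambda>(i, t). Z i t w))"
    and "eigenvalue_count y (gram_matrix (p n) n (\<lambda>(i, t). Z i t w)) \<le> row_count n (y - \<eta>) w"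
proof -
  let ?A = "gram_matrix (p n) n (\<lambda>(i, t). Z i t w)"
  let ?B = "mat_diag (p n) (\<lambda>i. row_sum n i w)"
  have B: "?B \<in> carrier_mat (p n) (p n)" "transpose_mat ?B = ?B"
    by (auto simp: mat_diag_def intro!: eq_matI)
  have count: "eigenvalue_count z ?B = row_count n z w" for z
    by (simp add: eigenvalue_count_def eigenvalue_mset_mat_diag filter_mset_image_mset row_count_def)
  have entry: "(?A $$ (i,j) - ?B $$ (i,j))\<^sup>2 = (if i = j then 0 else (\<Sum>t<n. Z i t w * Z j t w)\<^sup>2)"
    if "i < p n" "j < p n" for i j
    using that by (simp add: gram_matrix_def mat_diag_def row_sum_def power2_eq_square)
  have "(\<Sum>i<p n. \<Sum>j<p n. (?A $$ (i,j) - ?B $$ (i,j))\<^sup>2) = off_diagonal_norm2 (p n) n w"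
    unfolding off_diagonal_norm2_def by (intro sum.cong refl entry) auto
  then have AB: "(\<Sum>i<p n. \<Sum>j<p n. (?A $$ (i,j) - ?B $$ (i,j))\<^sup>2) \<le> \<eta>\<^sup>2" using \<eta>(2) by simp
  then have BA: "(\<Sum>i<p n. \<Sum>j<p n. (?B $$ (i,j) - ?A $$ (i,j))\<^sup>2) \<le> \<eta>\<^sup>2" by (simp add: power2_commute)
  show "row_count n (y + \<eta>) w \<le> eigenvalue_count y ?A"
    using eigenvalue_count_perturbation[OF B gram_matrix_carrier gram_matrix_symmetric \<eta>(1) BA] by (simp add: count)
  show "eigenvalue_count y ?A \<le> row_count n (y - \<eta>) w"
    using eigenvalue_count_perturbation[OF gram_matrix_carrier gram_matrix_symmetric B \<eta>(1) AB, of "y - \<eta>"] by (simp add: count)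
qed

abbreviation eigenvalues :: "nat \<Rightarrow> 'a \<Rightarrow> ereal measure" where
  "eigenvalues \<equiv> eigenvalue_process Z a p"

text \<open>
  By Weyl's inequality the number of eigenvalues above \<open>y A\<^sup>2\<close> lies between the numbers of row sums above
  \<open>(y + \<eta>) A\<^sup>2\<close> and above \<open>(y - \<eta>) A\<^sup>2\<close>; these agree if no row sum lies in between.
\<close>

lemma eigenvalues_eq_row_count:
  assumes n: "n \<ge> 1" and y: "y > 0" and \<eta>: "\<eta> > 0"
    and off: "off_diagonal_norm2 (p n) n w \<le> (\<eta> * scale n)\<^sup>2"
    and gap: "\<And>i. i < p n \<Longrightarrow> \<not> ((y - \<eta>) * scale n < row_sum n i w \<and> row_sum n i w \<le> (y + \<eta>) * scale n)"
  shows "emeasure (eigenvalues n w) {ereal y<..} = of_nat (row_count n (y * scale n) w)"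
proof -
  let ?A2 = "scale n"
  have A: "norming n > 0" using norming_pos[OF n] .
  have "row_count n (y * ?A2 - \<eta> * ?A2) w \<le> row_count n (y * ?A2 + \<eta> * ?A2) w"
    unfolding row_count_def
  proof (intro card_mono subsetI)
    fix i assume i: "i \<in> {i \<in> {..<p n}. y * ?A2 - \<eta> * ?A2 < row_sum n i w}"
    then show "i \<in> {i \<in> {..<p n}. y * ?A2 + \<eta> * ?A2 < row_sum n i w}"
      using gap[of i] by (auto simp: algebra_simps)
  qed simp
  moreover have "row_count n (y * ?A2 + \<eta> * ?A2) w \<le> row_count n (y * ?A2) w"
    unfolding row_count_def using \<eta> A by (intro card_mono) (auto intro: le_less_trans[rotated])
  moreover have "row_count n (y * ?A2) w \<le> row_count n (y * ?A2 - \<eta> * ?A2) w"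
    unfolding row_count_def using \<eta> A by (intro card_mono) (auto intro: le_less_trans[rotated])
  moreover have "\<eta> * ?A2 \<ge> 0" using \<eta> by simp
  note eigenvalue_count_vs_row_count[OF this off, of "y * ?A2"]
  ultimately have "eigenvalue_count (y * ?A2) (gram_matrix (p n) n (\<lambda>(i, t). Z i t w)) = row_count n (y * ?A2) w"
    by linarith
  then show ?thesis using emeasure_eigenvalue_process_Ioi[of y a n p Z w, OF y A] by simp
qed

text \<open>
  Outside a set of small probability the eigenvalues cannot be told from the row sums by counting
  at the grid points. The set collects the outcomes where the off-diagonal part is not small or some
  row sum comes within \<open>\<eta> A\<^sup>2\<close> of a level \<open>x k A\<^sup>2\<close>. Since the limiting intensity has no atoms, the latter is
  unlikely for small \<open>\<eta>\<close>.
\<close>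

lemma exceptional_set:
  fixes x :: "nat \<Rightarrow> real" and m :: nat
  assumes x: "mono x" "x 0 > 0" and r: "r > 0"
  obtains Bad where "\<And>n. Bad n \<in> events" "\<forall>\<^sub>F n in sequentially. prob (Bad n) < r"
    "\<And>n w k. n \<ge> 1 \<Longrightarrow> w \<in> space M - Bad n \<Longrightarrow> k \<le> m \<Longrightarrow>
       emeasure (eigenvalues n w) {ereal (x k)<..} = of_nat (row_count n (x k * scale n) w)"
proof -
  let ?\<tau> = "\<lambda>y. y powr (-\<alpha> / 2)"
  have xj: "x j > 0" "x 0 \<le> x j" for j using monoD[OF x(1), of 0 j] x(2) by auto
  have "((\<lambda>\<eta>. \<Sum>k\<le>m. ?\<tau> (x k - \<eta>) - ?\<tau> (x k + \<eta>)) \<longlongrightarrow> (\<Sum>k\<le>m. ?\<tau> (x k - 0) - ?\<tau> (x k + 0))) (at_right 0)"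
    using xj by (intro tendsto_intros) (auto simp: less_imp_neq[symmetric])
  then have "\<forall>\<^sub>F \<eta> in at_right 0. (\<Sum>k\<le>m. ?\<tau> (x k - \<eta>) - ?\<tau> (x k + \<eta>)) < r / 2"
    using r by (intro order_tendstoD(2)) auto
  moreover have "\<forall>\<^sub>F \<eta> in at_right 0. \<eta> \<in> {0<..<x 0}"
    by (rule eventually_at_right_real[OF x(2)])
  ultimately have "\<forall>\<^sub>F \<eta> in at_right 0. (\<Sum>k\<le>m. ?\<tau> (x k - \<eta>) - ?\<tau> (x k + \<eta>)) < r / 2 \<and> \<eta> \<in> {0<..<x 0}"
    by (rule eventually_conj)
  then obtain \<eta> where \<eta>: "(\<Sum>k\<le>m. ?\<tau> (x k - \<eta>) - ?\<tau> (x k + \<eta>)) < r / 2" "\<eta> > 0" "\<eta> < x 0"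
    using eventually_happens'[OF trivial_limit_at_right_real] by auto
  let ?O = "\<lambda>n. {w \<in> space M. off_diagonal_norm2 (p n) n w \<ge> (\<eta> * scale n)\<^sup>2}"
  let ?S = "\<lambda>n k i. {w \<in> space M. (x k - \<eta>) * scale n < row_sum n i w \<and> row_sum n i w \<le> (x k + \<eta>) * scale n}"
  let ?D = "\<lambda>n k. real (p n) * row_tail n (x k - \<eta>) - real (p n) * row_tail n (x k + \<eta>)"
  define Bad where "Bad n = ?O n \<union> (\<Union>k\<le>m. \<Union>i<p n. ?S n k i)" for n
  have evS: "?S n k i \<in> events" for n k i by measurable
  have evO: "?O n \<in> events" for n by measurable
  have evU1: "(\<Union>i<p n. ?S n k i) \<in> events" for n k
    by (rule sets.finite_UN) (auto intro: evS)
  have evU2: "(\<Union>k\<le>m. \<Union>i<p n. ?S n k i) \<in> events" for n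
    by (rule sets.finite_UN) (auto intro: evU1)
  have ev: "Bad n \<in> events" for n unfolding Bad_def using evO evU2 by (intro sets.Un)
  have bound: "prob (Bad n) \<le> prob (?O n) + (\<Sum>k\<le>m. ?D n k)" for n
  proof -
    have "prob (Bad n) \<le> prob (?O n) + prob (\<Union>k\<le>m. \<Union>i<p n. ?S n k i)"
      unfolding Bad_def by (intro measure_Un_le evO evU2)
    also have "prob (\<Union>k\<le>m. \<Union>i<p n. ?S n k i) \<le> (\<Sum>k\<le>m. prob (\<Union>i<p n. ?S n k i))"
      by (rule finite_measure_subadditive_finite) (use evU1 in auto)
    also have "\<dots> \<le> (\<Sum>k\<le>m. \<Sum>i<p n. prob (?S n k i))"
      by (intro sum_mono finite_measure_subadditive_finite) (use evS in auto)
    also have "\<dots> = (\<Sum>k\<le>m. ?D n k)"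
      using \<eta>(2) by (simp add: prob_row_between right_diff_distrib)
    finally show ?thesis by simp
  qed
  have "(\<lambda>n. prob (?O n) + (\<Sum>k\<le>m. ?D n k))
      \<longlonglongrightarrow> 0 + (\<Sum>k\<le>m. ?\<tau> (x k - \<eta>) - ?\<tau> (x k + \<eta>))"
  proof (intro tendsto_add tendsto_sum tendsto_diff row_tail_limit off_diagonal_negligible \<eta>(2))
    fix k
    show "0 < x k - \<eta>" "0 < x k + \<eta>" using xj[of k] \<eta> by auto
  qed
  moreover have "0 + (\<Sum>k\<le>m. ?\<tau> (x k - \<eta>) - ?\<tau> (x k + \<eta>)) < r" using \<eta>(1) r by simp
  ultimately have "\<forall>\<^sub>F n in sequentially. prob (?O n) + (\<Sum>k\<le>m. ?D n k) < r"
    by (rule order_tendstoD(2))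
  then have small: "\<forall>\<^sub>F n in sequentially. prob (Bad n) < r"
    by eventually_elim (use bound le_less_trans in blast)
  show thesis
  proof (rule that[OF ev small])
    fix n w k assume n: "n \<ge> 1" and w: "w \<in> space M - Bad n" and k: "k \<le> m"
    show "emeasure (eigenvalues n w) {ereal (x k)<..} = of_nat (row_count n (x k * scale n) w)"
    proof (rule eigenvalues_eq_row_count[OF n xj(1) \<eta>(2)])
      show "off_diagonal_norm2 (p n) n w \<le> (\<eta> * scale n)\<^sup>2"
        using w unfolding Bad_def by auto
      show "\<not> ((x k - \<eta>) * scale n < row_sum n i w \<and> row_sum n i w \<le> (x k + \<eta>) * scale n)"
        if "i < p n" for i
        using w k that unfolding Bad_def by blast
    qed
  qed
qed

text \<open>
  Both sides are integrals of one step function, against the eigenvalue process and against the point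
  process of rescaled row sums. Equal counts above the grid points mean equal masses of the cells.
\<close>

lemma eigenvalue_step_sum:
  assumes n: "n \<ge> 1" and x: "mono x" "x 0 > 0"
    and eq: "\<And>k. k \<le> m \<Longrightarrow> emeasure (eigenvalues n w) {ereal (x k)<..} = of_nat (row_count n (x k * scale n) w)"
  shows "(\<Sum>k\<le>m. c k * measure (eigenvalues n w) (grid_cell m x k)) = (\<Sum>i<p n. step_value m x c n (row_sum n i w))"
proof -
  have xj: "x j > 0" for j using monoD[OF x(1), of 0 j] x(2) by simp
  have A: "norming n > 0" using norming_pos[OF n] .
  let ?\<mu> = "dirac_sum {0<..} (image_mset (\<lambda>i. ereal (row_sum n i w / scale n)) (mset_set {..<p n}))"
  let ?\<tau> = "\<lambda>y. real (row_count n (y * scale n) w)"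
  have sets\<mu>: "sets ?\<mu> = sets (restrict_space borel {0<..})" by (rule sets_dirac_sum) simp
  have em: "emeasure ?\<mu> B = ennreal (\<Sum>i<p n. indicator B (ereal (row_sum n i w / scale n)))"
    if "B \<in> sets (restrict_space borel {0<..})" for B
    using that by (simp add: emeasure_dirac_sum image_mset.compositionality comp_def sum_unfold_sum_mset[symmetric]
        sum_ennreal[symmetric] ennreal_indicator del: sum_ennreal)
  have \<mu>\<tau>: "emeasure ?\<mu> {ereal (x k)<..} = ennreal (?\<tau> (x k))" for k
  proof -
    have "{ereal (x k)<..} \<in> sets (restrict_space borel {0<..})"
      using xj[of k] by (subst sets_restrict_space_iff) auto
    then have "emeasure ?\<mu> {ereal (x k)<..} = ennreal (\<Sum>i<p n. indicator {ereal (x k)<..} (ereal (row_sum n i w / scale n)))"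
      by (rule em)
    also have "(\<Sum>i<p n. indicator {ereal (x k)<..} (ereal (row_sum n i w / scale n)))
        = (\<Sum>i<p n. if row_sum n i w > x k * scale n then 1 else 0 :: real)"
      using A by (intro sum.cong refl) (auto simp: indicator_def field_simps)
    also have "\<dots> = ?\<tau> (x k)"
      unfolding row_count_def by (subst sum.inter_filter[symmetric]) auto
    finally show ?thesis .
  qed
  have "measure (eigenvalues n w) (grid_cell m x k) = (\<Sum>i<p n. indicator (grid_cell m x k) (ereal (row_sum n i w / scale n)))"
    if k: "k \<le> m" for k
  proof -
    have "measure (eigenvalues n w) (grid_cell m x k) = grid_mass ?\<tau> m x k"
      by (rule measure_grid_cell(2)[OF x k sets_eigenvalue_process])
         (simp_all add: eq ennreal_of_nat_eq_real_of_nat)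
    also have "\<dots> = measure ?\<mu> (grid_cell m x k)"
      by (rule measure_grid_cell(2)[OF x k sets\<mu>, symmetric]) (simp_all add: \<mu>\<tau>)
    also have "\<dots> = (\<Sum>i<p n. indicator (grid_cell m x k) (ereal (row_sum n i w / scale n)))"
      unfolding measure_def em[OF sets_grid_cell[OF x k]] by (simp add: sum_nonneg)
    finally show ?thesis .
  qed
  then have "(\<Sum>k\<le>m. c k * measure (eigenvalues n w) (grid_cell m x k))
      = (\<Sum>k\<le>m. \<Sum>i<p n. c k * indicator (grid_cell m x k) (ereal (row_sum n i w / scale n)))"
    by (simp add: sum_distrib_left)
  also have "\<dots> = (\<Sum>i<p n. step_value m x c n (row_sum n i w))"
    unfolding step_value_def by (rule sum.swap)
  finally show ?thesis .
qed

lemma expectation_row_count: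
  "integrable M (\<lambda>w. real (row_count n (y * scale n) w))"
  "expectation (\<lambda>w. real (row_count n (y * scale n) w)) = real (p n) * row_tail n y"
proof -
  let ?E = "\<lambda>i. {w \<in> space M. row_sum n i w > y * scale n}"
  have eq: "real (row_count n (y * scale n) w) = (\<Sum>i<p n. indicator (?E i) w)" if "w \<in> space M" for w
  proof -
    have "(\<Sum>i<p n. indicator (?E i) w :: real) = (\<Sum>i<p n. if row_sum n i w > y * scale n then 1 else 0)"
      using that by (intro sum.cong refl) (auto simp: indicator_def)
    also have "\<dots> = real (row_count n (y * scale n) w)"
      unfolding row_count_def by (subst sum.inter_filter[symmetric]) auto
    finally show ?thesis by simp
  qed
  have int: "integrable M (indicator (?E i) :: 'a \<Rightarrow> real)" for i
    by (intro integrable_real_indicator) (auto simp: emeasure_eq_measure)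
  have "integrable M (\<lambda>w. \<Sum>i<p n. indicator (?E i) w :: real)"
    by (intro Bochner_Integration.integrable_sum int)
  then show "integrable M (\<lambda>w. real (row_count n (y * scale n) w))"
    by (subst Bochner_Integration.integrable_cong[OF refl eq])
  have "expectation (\<lambda>w. real (row_count n (y * scale n) w)) = expectation (\<lambda>w. \<Sum>i<p n. indicator (?E i) w)"
    by (intro Bochner_Integration.integral_cong refl eq)
  also have "\<dots> = (\<Sum>i<p n. expectation (indicator (?E i)))"
    by (intro Bochner_Integration.integral_sum int)
  also have "\<dots> = real (p n) * row_tail n y" by (simp add: prob_row_greater)
  finally show "expectation (\<lambda>w. real (row_count n (y * scale n) w)) = real (p n) * row_tail n y" .
qed

lemma eigenvalues_point_process: "point_process {0<..} M (eigenvalues n)"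
  by (rule point_process_eigenvalue_process) measurable

text \<open>
  Outside \<open>Bad\<close> the two functionals differ by at most \<open>1 / (j + 1)\<close> times the number of row sums above
  \<open>x0 A\<^sup>2\<close>, whose expectation is \<open>p n * row_tail n x0\<close>; on \<open>Bad\<close> the exponentials differ by at most \<open>2\<close>.
\<close>

lemma eigenvalue_char_approximation:
  assumes f: "pp_test_function {0<..} f" and st: "step_approximation f x0 m x c"
    and n: "n \<ge> 1" and Bad: "Bad \<in> events"
    and eq: "\<And>w k. w \<in> space M - Bad \<Longrightarrow> k \<le> m j \<Longrightarrow>
       emeasure (eigenvalues n w) {ereal (x j k)<..} = of_nat (row_count n (x j k * scale n) w)"
  shows "norm (char (distr M borel (\<lambda>w. \<integral>y. f y \<partial>eigenvalues n w)) s
      - char (distr M borel (\<lambda>w. \<Sum>i<p n. step_value (m j) (x j) (c j) n (row_sum n i w))) s)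
    \<le> \<bar>s\<bar> / real (Suc j) * (real (p n) * row_tail n x0) + 2 * prob Bad"
proof -
  have x: "mono (x j)" "x j 0 > 0" "x j 0 = x0" using st unfolding step_approximation_def by auto
  let ?I = "\<lambda>w. \<integral>y. f y \<partial>eigenvalues n w"
  let ?S = "\<lambda>w. \<Sum>i<p n. step_value (m j) (x j) (c j) n (row_sum n i w)"
  let ?R = "\<lambda>w. real (row_count n (x0 * scale n) w)"
  have I[measurable]: "?I \<in> borel_measurable M"
    by (rule borel_measurable_point_process_integral[OF eigenvalues_point_process f])
  have S[measurable]: "?S \<in> borel_measurable M" by measurable
  have int: "integrable M (\<lambda>w. iexp (s * ?I w))" "integrable M (\<lambda>w. iexp (s * ?S w))"
    by (auto intro!: integrable_iexp)
  have pt: "norm (iexp (s * ?I w) - iexp (s * ?S w)) \<le> \<bar>s\<bar> / real (Suc j) * ?R w + 2 * indicator Bad w"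
    if w: "w \<in> space M" for w
  proof (cases "w \<in> Bad")
    case True
    have "0 \<le> \<bar>s\<bar> / real (Suc j) * ?R w" by (intro mult_nonneg_nonneg) auto
    moreover have "indicator Bad w = (1 :: real)" using True by simp
    ultimately show ?thesis using norm_iexp_diff_le_2[of "s * ?I w" "s * ?S w"] by linarith
  next
    case False
    then have eq': "emeasure (eigenvalues n w) {ereal (x j k)<..} = of_nat (row_count n (x j k * scale n) w)"
      if "k \<le> m j" for k using eq[OF _ that] w by blast
    have e0: "emeasure (eigenvalues n w) {ereal x0<..} = of_nat (row_count n (x0 * scale n) w)"
      using eq'[of 0] x(3) by simp
    have fin: "emeasure (eigenvalues n w) {ereal x0<..} < \<infinity>" unfolding e0 by (simp add: of_nat_less_top)
    have m0: "measure (eigenvalues n w) {ereal x0<..} = ?R w"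
      unfolding measure_def e0 by simp
    have step_eq: "(\<Sum>k\<le>m j. c j k * measure (eigenvalues n w) (grid_cell (m j) (x j) k)) = ?S w"
      by (rule eigenvalue_step_sum[OF n x(1,2) eq'])
    have "\<bar>?I w - ?S w\<bar> \<le> 1 / real (Suc j) * ?R w"
      using step_approximation_integral[OF f st sets_eigenvalue_process fin, of j]
      by (simp only: step_eq m0)
    then have "\<bar>s\<bar> * \<bar>?I w - ?S w\<bar> \<le> \<bar>s\<bar> * (1 / real (Suc j) * ?R w)" by (intro mult_left_mono) auto
    moreover have "norm (iexp (s * ?I w) - iexp (s * ?S w)) \<le> \<bar>s\<bar> * \<bar>?I w - ?S w\<bar>"
      using norm_iexp_diff_le[of "s * ?I w" "s * ?S w"] by (simp add: abs_mult right_diff_distrib[symmetric])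
    ultimately show ?thesis using False by simp
  qed
  have "norm (char (distr M borel ?I) s - char (distr M borel ?S) s)
      = norm (CLINT w|M. iexp (s * ?I w) - iexp (s * ?S w))"
    unfolding char_distr[OF I] char_distr[OF S] by (simp only: Bochner_Integration.integral_diff[OF int])
  also have "\<dots> \<le> expectation (\<lambda>w. norm (iexp (s * ?I w) - iexp (s * ?S w)))"
    by (rule integral_norm_bound)
  also have "\<dots> \<le> expectation (\<lambda>w. \<bar>s\<bar> / real (Suc j) * ?R w + 2 * indicator Bad w)"
    using Bad by (intro integral_mono pt integrable_norm Bochner_Integration.integrable_diff int
        Bochner_Integration.integrable_add integrable_mult_right expectation_row_count integrable_real_indicator)
      (auto simp: emeasure_eq_measure)
  also have "\<dots> = expectation (\<lambda>w. \<bar>s\<bar> / real (Suc j) * ?R w) + expectation (\<lambda>w. 2 * indicator Bad w)"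
    using Bad by (intro Bochner_Integration.integral_add integrable_mult_right expectation_row_count integrable_real_indicator)
      (auto simp: emeasure_eq_measure)
  also have "expectation (\<lambda>w. \<bar>s\<bar> / real (Suc j) * ?R w) = \<bar>s\<bar> / real (Suc j) * (real (p n) * row_tail n x0)"
    by (simp only: integral_mult_right_zero expectation_row_count(2))
  also have "expectation (\<lambda>w. 2 * indicator Bad w) = 2 * prob Bad"
    using Bad by simp
  finally show ?thesis .
qed

text \<open>
  For fixed \<open>j\<close> the step functionals of the row sums converge to that of the Poisson process. As \<open>j\<close>
  grows, the error made by the step approximation vanishes on the Poisson side by dominated convergence,
  and on the side of the eigenvalues uniformly for large \<open>n\<close>.
\<close>

theorem eigenvalues_converge_to_poisson:
  assumes \<nu>: "\<And>x::real. x > 0 \<Longrightarrow> emeasure \<nu> {ereal x<..} = ennreal (x powr (-\<alpha> / 2))"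
    and poisson: "poisson_point_process {0<..} M' N \<nu>"
  shows "pp_converges_in_distribution {0<..} (\<lambda>_. M) eigenvalues M' N"
proof -
  have M': "prob_space M'" and N: "point_process {0<..} M' N" using poisson by (auto simp: poisson_point_process_def)
  interpret M': prob_space M' by fact
  let ?\<tau> = "\<lambda>y. y powr (-\<alpha> / 2)"
  have "weak_conv_m (\<lambda>n. distr M borel (\<lambda>w. \<integral>y. f y \<partial>eigenvalues n w)) (distr M' borel (\<lambda>w. \<integral>y. f y \<partial>N w))"
    if f: "pp_test_function {0<..} f" for f
  proof (rule levy_continuity)
    have In: "(\<lambda>w. \<integral>y. f y \<partial>eigenvalues n w) \<in> borel_measurable M" for n
      by (rule borel_measurable_point_process_integral[OF eigenvalues_point_process f])
    have IN[measurable]: "(\<lambda>w. \<integral>y. f y \<partial>N w) \<in> borel_measurable M'"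
      by (rule borel_measurable_point_process_integral[OF N f])
    show "real_distribution (distr M borel (\<lambda>w. \<integral>y. f y \<partial>eigenvalues n w))" for n
      by (rule real_distribution_distr[OF In])
    show "real_distribution (distr M' borel (\<lambda>w. \<integral>y. f y \<partial>N w))"
      by (rule M'.real_distribution_distr[OF IN])
    fix s
    obtain x0 m x c where st: "step_approximation f x0 m x c"
      using step_approximation_exists[OF f] by blast
    have x: "mono (x j)" "x j 0 > 0" "x j 0 = x0" and x0: "x0 > 0" for j
      using st unfolding step_approximation_def by auto
    let ?SN = "\<lambda>j w. \<Sum>k\<le>m j. c j k * measure (N w) (grid_cell (m j) (x j) k)"
    let ?SD = "\<lambda>j n w. \<Sum>i<p n. step_value (m j) (x j) (c j) n (row_sum n i w)"
    let ?cN = "char (distr M' borel (\<lambda>w. \<integral>y. f y \<partial>N w)) s"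
    let ?cn = "\<lambda>n. char (distr M borel (\<lambda>w. \<integral>y. f y \<partial>eigenvalues n w)) s"
    have SN[measurable]: "?SN j \<in> borel_measurable M'" for j
      using x by (intro borel_measurable_sum borel_measurable_times borel_measurable_const
          borel_measurable_point_process_measure[OF N]) auto
    have "(\<lambda>j. CLINT w|M'. iexp (s * ?SN j w)) \<longlonglongrightarrow> (CLINT w|M'. iexp (s * (\<integral>y. f y \<partial>N w)))"
    proof (rule integral_dominated_convergence[where w = "\<lambda>_. 1"])
      show "AE w in M'. (\<lambda>j. iexp (s * ?SN j w)) \<longlonglongrightarrow> iexp (s * (\<integral>y. f y \<partial>N w))"
      proof (rule AE_I2)
        fix w assume w: "w \<in> space M'"
        have "sets (N w) = sets (restrict_space borel {0<..})" using N w by (simp add: point_process_def)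
        from step_approximation_tendsto[OF f st this point_process_finite[OF N x0 w]]
        show "(\<lambda>j. iexp (s * ?SN j w)) \<longlonglongrightarrow> iexp (s * (\<integral>y. f y \<partial>N w))"
          by (intro tendsto_exp tendsto_mult tendsto_const tendsto_of_real)
      qed
    qed (auto simp del: of_real_mult)
    then have lim_j: "(\<lambda>j. char (distr M' borel (?SN j)) s) \<longlonglongrightarrow> ?cN"
      by (simp only: char_distr[OF SN] char_distr[OF IN])
    have lim_n: "(\<lambda>n. char (distr M borel (?SD j n)) s) \<longlonglongrightarrow> char (distr M' borel (?SN j)) s" for j
    proof -
      have "char (distr M' borel (?SN j)) s = exp (\<Sum>k\<le>m j. (iexp (s * c j k) - 1) * of_real (grid_mass ?\<tau> (m j) (x j) k))"
        using x(1,2) by (intro poisson_step_char[OF poisson]) (auto simp: \<nu>)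
      then show ?thesis using row_step_sum_char_limit[OF x(1,2), of "m j" j "c j" s] by simp
    qed
    show "?cn \<longlonglongrightarrow> ?cN"
    proof (rule tendstoI)
      fix r :: real assume r: "r > 0"
      have "(\<lambda>j. 1 / real (Suc j)) \<longlonglongrightarrow> 0" using lim_1_over_n[where 'a = real] by (rule LIMSEQ_Suc)
      then have "(\<lambda>j. \<bar>s\<bar> * (1 / real (Suc j)) * (?\<tau> x0 + 1)) \<longlonglongrightarrow> \<bar>s\<bar> * 0 * (?\<tau> x0 + 1)"
        by (intro tendsto_intros)
      then have "\<forall>\<^sub>F j in sequentially. \<bar>s\<bar> * (1 / real (Suc j)) * (?\<tau> x0 + 1) < r / 8"
        using r by (intro order_tendstoD(2)) auto
      moreover have "\<forall>\<^sub>F j in sequentially. dist (char (distr M' borel (?SN j)) s) ?cN < r / 4"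
        using r by (intro tendstoD[OF lim_j]) simp
      ultimately have "\<forall>\<^sub>F j in sequentially. \<bar>s\<bar> * (1 / real (Suc j)) * (?\<tau> x0 + 1) < r / 8
          \<and> dist (char (distr M' borel (?SN j)) s) ?cN < r / 4" by (rule eventually_conj)
      then obtain j where j: "\<bar>s\<bar> * (1 / real (Suc j)) * (?\<tau> x0 + 1) < r / 8"
          "dist (char (distr M' borel (?SN j)) s) ?cN < r / 4"
        using eventually_happens'[OF sequentially_bot] by blast
      have r16: "r / 16 > 0" using r by simp
      obtain Bad where Bad: "\<And>n. Bad n \<in> events" "\<forall>\<^sub>F n in sequentially. prob (Bad n) < r / 16"
        "\<And>n w k. n \<ge> 1 \<Longrightarrow> w \<in> space M - Bad n \<Longrightarrow> k \<le> m j \<Longrightarrow>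
           emeasure (eigenvalues n w) {ereal (x j k)<..} = of_nat (row_count n (x j k * scale n) w)"
        using exceptional_set[OF x(1,2) r16, of "m j" j] by metis
      have T: "\<forall>\<^sub>F n in sequentially. real (p n) * row_tail n x0 < ?\<tau> x0 + 1"
        by (rule order_tendstoD(2)[OF row_tail_limit[OF x0]]) simp
      have D: "\<forall>\<^sub>F n in sequentially. dist (char (distr M borel (?SD j n)) s) (char (distr M' borel (?SN j)) s) < r / 4"
        using r by (intro tendstoD[OF lim_n]) simp
      show "\<forall>\<^sub>F n in sequentially. dist (?cn n) ?cN < r"
        using Bad(2) T D eventually_ge_at_top[of 1]
      proof eventually_elim
        case (elim n)
        have "dist (?cn n) (char (distr M borel (?SD j n)) s)
            \<le> \<bar>s\<bar> / real (Suc j) * (real (p n) * row_tail n x0) + 2 * prob (Bad n)"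
          unfolding dist_norm
          by (rule eigenvalue_char_approximation[OF f st elim(4) Bad(1) Bad(3)[OF elim(4)]])
        also have "\<bar>s\<bar> / real (Suc j) * (real (p n) * row_tail n x0) \<le> \<bar>s\<bar> / real (Suc j) * (?\<tau> x0 + 1)"
          using elim(2) by (intro mult_left_mono) auto
        also have "\<dots> < r / 8" using j(1) by simp
        finally have "dist (?cn n) (char (distr M borel (?SD j n)) s) < r / 4" using elim(1) by simp
        then show ?case
          using r elim(3) j(2) dist_triangle[of "?cn n" ?cN "char (distr M borel (?SD j n)) s"]
            dist_triangle[of "char (distr M borel (?SD j n)) s" ?cN "char (distr M' borel (?SN j)) s"]
          by linarith
      qed
    qed
  qed
  then show ?thesis using N eigenvalues_point_process by (simp add: pp_converges_in_distribution_def)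
qed

end

theorem theorem2:
  fixes M :: "'a measure" and Z :: "nat \<Rightarrow> nat \<Rightarrow> 'a \<Rightarrow> real"
    and a :: "nat \<Rightarrow> real" and p :: "nat \<Rightarrow> nat" and \<alpha> :: real
    and M' :: "'b measure" and N :: "'b \<Rightarrow> ereal measure" and \<nu> :: "ereal measure"
  assumes alpha: "0 < \<alpha>" "\<alpha> < 2"
    and prob: "prob_space M"
    and indep: "prob_space.indep_vars M (\<lambda>_. borel) (\<lambda>(i, t). Z i t) UNIV"
    and ident: "\<And>i t. distr M borel (Z i t) = distr M borel (Z 0 0)"
    and a_pos: "\<And>n. n \<ge> 1 \<Longrightarrow> a n > 0"
    and tail: "\<And>x::real. x > 0 \<Longrightarrow>
      (\<lambda>n. real n * measure M {\<omega> \<in> space M. \<bar>Z 0 0 \<omega>\<bar> > a n * x}) \<longlonglongrightarrow> x powr (-\<alpha>)"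
    and p_pos: "\<And>n. n \<ge> 1 \<Longrightarrow> p n \<ge> 1"
    and p_lim: "filterlim p at_top sequentially"
    and growth:
      "(\<exists>(\<kappa>::real) l. \<kappa> \<ge> 0 \<and> slowly_varying l \<and>
          (\<kappa> = 0 \<longrightarrow> filterlim l at_top at_top) \<and>
          (\<kappa> = 1 \<longrightarrow> (\<exists>\<delta>>0. \<forall>\<^sub>F x in at_top. l x \<ge> \<delta>)) \<and>
          (\<forall>n\<ge>1. real (p n) = real n powr \<kappa> * l (real n))) \<or>
       (\<exists>(\<kappa>::real) c C. \<kappa> > 0 \<and> c > 0 \<and> C > 0 \<and>
          (\<lambda>n. real (p n)) \<sim>[sequentially] (\<lambda>n. C * exp (c * real n powr \<kappa>)))"
    and nu_sets: "sets \<nu> = sets (restrict_space borel {0<..})"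
    and nu: "\<And>x::real. x > 0 \<Longrightarrow> emeasure \<nu> {ereal x<..} = ennreal (x powr (-\<alpha> / 2))"
    and poisson: "poisson_point_process {0<..} M' N \<nu>"
  shows "pp_converges_in_distribution {0<..} (\<lambda>_. M) (eigenvalue_process Z a p) M' N"
proof -
  interpret prob_space M by (rule prob)
  interpret heavy_tailed_array M Z a \<alpha> p
    using alpha indep ident a_pos tail p_pos p_lim by unfold_locales auto
  show ?thesis by (rule eigenvalues_converge_to_poisson[OF nu poisson])
qed

end
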